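(* Let $G=B\ltimes_\tau(L\times\mathbb{R})$ be an abstract wavelet group, where $L$ is a compact group, and let $\psi$ be a feasible wavelet. Then for any $f\in L^2(L\times\mathbb{R})$, $$\left(\int_B\int_L\int_{\mathbb{R}}|t|^2|W_\psi f(b,l,t)|^2\,\delta_\tau(b)\,dt\,dl\,db\right)^{1/2}\left(\int_{\widehat L}\int_{\widehat{\mathbb{R}}}|\gamma|^2\,\|(\delta,\gamma)f\|_{\mathrm{HS}}^2\,d\delta\,d\gamma\right)^{1/2}\ge\frac{\sqrt{C_\psi}}{2}\|f\|^2.$$
   Context: Let $A=L\times\mathbb{R}$ and $B$ be locally compact, second countable, unimodular groups of type I, and let $\tau:B\to\mathrm{Aut}(A)$, $b\mapsto\tau_b$, be a homomorphism (with $(b,a)\mapsto\tau_b(a)$ continuous). The abstract wavelet group $G=B\ltimes_\tau A$ has group law $(b,a)(b_1,a_1)=(bb_1,a\tau_b(a_1))$ and left Haar measure $\delta_\tau(b)\,da\,db$, where $da=dl\,dt$ and $\delta_\tau$ is the positive homomorphism of $B$ satisfying $d(a)=\delta_\tau(b)\,d(\tau_b(a))$. The representation $\pi$ of $G$ on $L^2(A)$ is $\pi(b,a)f(x)=\delta_\tau(b)^{1/2}f(\tau_{b^{-1}}(a^{-1}x))$. For $\sigma$ in the unitary dual $\widehat A$ and $f\in L^1(A)$, $\sigma(f)=\int_A f(x)\sigma(x)\,dx$. A function $\psi\in L^1\cap L^2(A)$ is a feasible wavelet if there is a constant $0<C_\psi<\infty$ such that for almost every $\sigma\in\widehat A$ and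 all $f,g\in L^1\cap L^2(A)$, $$\int_B\mathrm{tr}\big(\sigma(f)\sigma(g)\sigma(\psi\circ\tau_{b^{-1}})^{*}\sigma(\psi\circ\tau_{b^{-1}})\big)\,\delta_\tau(b)^2\,db=C_\psi\,\mathrm{tr}(\sigma(f)\sigma(g)).$$ The wavelet transform is $W_\psi:L^2(A)\to L^2(G)$, $W_\psi f(b,a)=\langle f,\pi(b,a)\psi\rangle$; write $W_\psi f(b,l,t)$ for $a=(l,t)$. Here $\widehat A=\widehat L\times\widehat{\mathbb{R}}$, where $\gamma\in\mathbb{R}\cong\widehat{\mathbb{R}}$ is identified with the character $t\mapsto e^{i\gamma t}$; $(\delta,\gamma)f=\int_L\int_{\mathbb{R}}f(l,t)e^{i\gamma t}\delta(l)\,dt\,dl$ denotes the operator-valued group Fourier transform (extended to $L^2(A)$ by Plancherel's theorem), $\|\cdot\|_{\mathrm{HS}}$ is the Hilbert–Schmidt norm, and $d\delta\,d\gamma$ is the Plancherel measure of $A$, so that $\|f\|^2=\int_{\widehat L}\int_{\widehat{\mathbb{R}}}\|(\delta,\gamma)f\|_{\mathrm{HS}}^2\,d\delta\,d\gamma$ (thus $d\gamma$ is Lebesgue measure divided by $2\pi$ when $dt$ is Lebesgue measure). The left-hand side may be infinite. *)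

theory Defs
  imports "HOL-Analysis.Analysis"
begin

section \<open>The separable Hilbert space \<open>\<ell>\<^sup>2\<close>\<close>

typedef ell2 = "{x :: nat \<Rightarrow> complex. summable (\<lambda>n. (cmod (x n))\<^sup>2)}"
  by (rule exI[of _ "\<lambda>_. 0"]) simp

lemma summable_ell2: "summable (\<lambda>n. (cmod (Rep_ell2 x n))\<^sup>2)"
  using Rep_ell2[of x] by simp

lemma sq_sum_le: "(cmod (a + b))\<^sup>2 \<le> 2 * (cmod a)\<^sup>2 + 2 * (cmod b)\<^sup>2"
proof -
  have "(cmod (a + b))\<^sup>2 \<le> (cmod a + cmod b)\<^sup>2"
    by (intro power_mono norm_triangle_ineq) auto
  also have "\<dots> \<le> 2 * (cmod a)\<^sup>2 + 2 * (cmod b)\<^sup>2"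
    using zero_le_power2[of "cmod a - cmod b"]
    unfolding power2_diff power2_sum by linarith
  finally show ?thesis .
qed

lemma summable_ell2_add:
  fixes x y :: "nat \<Rightarrow> complex"
  assumes "summable (\<lambda>n. (cmod (x n))\<^sup>2)" "summable (\<lambda>n. (cmod (y n))\<^sup>2)"
  shows "summable (\<lambda>n. (cmod (x n + y n))\<^sup>2)"
  by (rule summable_comparison_test'[where N = 0
        and g = "\<lambda>n. 2 * (cmod (x n))\<^sup>2 + 2 * (cmod (y n))\<^sup>2"])
     (auto intro!: summable_add summable_mult assms sq_sum_le)

lemma summable_ell2_scale:
  fixes x :: "nat \<Rightarrow> complex"
  assumes "summable (\<lambda>n. (cmod (x n))\<^sup>2)"
  shows "summable (\<lambda>n. (cmod (c * x n))\<^sup>2)"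
  using summable_mult[OF assms, of "(cmod c)\<^sup>2"] by (simp add: norm_mult power_mult_distrib)

lemma summable_ell2_prod:
  fixes x y :: "nat \<Rightarrow> complex"
  assumes "summable (\<lambda>n. (cmod (x n))\<^sup>2)" "summable (\<lambda>n. (cmod (y n))\<^sup>2)"
  shows "summable (\<lambda>n. x n * cnj (y n))"
proof (rule summable_comparison_test'[where N = 0
        and g = "\<lambda>n. (cmod (x n))\<^sup>2 + (cmod (y n))\<^sup>2"])
  show "summable (\<lambda>n. (cmod (x n))\<^sup>2 + (cmod (y n))\<^sup>2)" by (intro summable_add assms)
  fix n
  have "2 * (cmod (x n) * cmod (y n)) \<le> (cmod (x n))\<^sup>2 + (cmod (y n))\<^sup>2"
    using zero_le_power2[of "cmod (x n) - cmod (y n)"] unfolding power2_diff by linarith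
  moreover have "0 \<le> cmod (x n) * cmod (y n)" by simp
  ultimately have "cmod (x n) * cmod (y n) \<le> (cmod (x n))\<^sup>2 + (cmod (y n))\<^sup>2" by linarith
  then show "norm (x n * cnj (y n)) \<le> (cmod (x n))\<^sup>2 + (cmod (y n))\<^sup>2"
    by (simp add: norm_mult)
qed

definition scaleC :: "complex \<Rightarrow> ell2 \<Rightarrow> ell2" (infixr \<open>*\<^sub>C\<close> 75) where
  "c *\<^sub>C x = Abs_ell2 (\<lambda>n. c * Rep_ell2 x n)"

definition cinner :: "ell2 \<Rightarrow> ell2 \<Rightarrow> complex" where
  "cinner x y = (\<Sum>n. Rep_ell2 x n * cnj (Rep_ell2 y n))"

definition ket :: "nat \<Rightarrow> ell2" where
  "ket k = Abs_ell2 (\<lambda>n. if n = k then 1 else 0)"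

lemma Rep_scaleC: "Rep_ell2 (c *\<^sub>C x) n = c * Rep_ell2 x n"
  unfolding scaleC_def using summable_ell2_scale[OF summable_ell2, of c x]
  by (simp add: Abs_ell2_inverse)

lemma Rep_ket: "Rep_ell2 (ket k) n = (if n = k then 1 else 0)"
proof -
  have "summable (\<lambda>n. (cmod (if n = k then 1 else 0))\<^sup>2)"
    by (rule summable_finite[of "{k}"]) auto
  then show ?thesis unfolding ket_def by (simp add: Abs_ell2_inverse)
qed

instantiation ell2 :: real_inner
begin

definition "0 = Abs_ell2 (\<lambda>_. 0)"
definition "x + y = Abs_ell2 (\<lambda>n. Rep_ell2 x n + Rep_ell2 y n)"
definition "- x = Abs_ell2 (\<lambda>n. - Rep_ell2 x n)"
definition "x - y = x + (- y)" for x y :: ell2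
definition "scaleR r x = complex_of_real r *\<^sub>C x"
definition "inner x y = Re (cinner x y)"
definition "norm x = sqrt (inner x x)" for x :: ell2
definition "dist x y = norm (x - y)" for x y :: ell2
definition "sgn x = complex_of_real (inverse (norm x)) *\<^sub>C x" for x :: ell2
definition  "(uniformity :: (ell2 \<times> ell2) filter) =
  (INF e\<in>{0 <..}. principal {(x, y). dist x y < e})"
definition  "open U = (\<forall>x\<in>U. eventually (\<lambda>(x', y). x' = x \<longrightarrow> y \<in> U) uniformity)"
  for U :: "ell2 set"

lemma Rep_zero_ell2: "Rep_ell2 0 n = 0"
  unfolding zero_ell2_def by (simp add: Abs_ell2_inverse)

lemma Rep_plus_ell2: "Rep_ell2 (x + y) n = Rep_ell2 x n + Rep_ell2 y n"
  unfolding plus_ell2_def using summable_ell2_add[OF summable_ell2 summable_ell2, of x y]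
  by (simp add: Abs_ell2_inverse)

lemma Rep_uminus_ell2: "Rep_ell2 (- x) n = - Rep_ell2 x n"
  unfolding uminus_ell2_def using summable_ell2[of x] by (simp add: Abs_ell2_inverse)

lemma Rep_minus_ell2: "Rep_ell2 (x - y) n = Rep_ell2 x n - Rep_ell2 y n"
  unfolding minus_ell2_def by (simp add: Rep_plus_ell2 Rep_uminus_ell2)

lemma Rep_scaleR_ell2: "Rep_ell2 (scaleR r x) n = complex_of_real r * Rep_ell2 x n"
  unfolding scaleR_ell2_def by (rule Rep_scaleC)

lemmas Rep_ell2_simps =
  Rep_zero_ell2 Rep_plus_ell2 Rep_uminus_ell2 Rep_minus_ell2 Rep_scaleR_ell2 Rep_scaleC Rep_ket

lemma ell2_eqI: "(\<And>n. Rep_ell2 x n = Rep_ell2 y n) \<Longrightarrow> x = y"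
  by (metis Rep_ell2_inject ext)

lemma summable_cinner: "summable (\<lambda>n. Rep_ell2 x n * cnj (Rep_ell2 y n))"
  by (rule summable_ell2_prod[OF summable_ell2 summable_ell2])

lemma inner_self_ell2: "inner x x = (\<Sum>n. (cmod (Rep_ell2 x n))\<^sup>2)"
proof -
  have "cinner x x = (\<Sum>n. complex_of_real ((cmod (Rep_ell2 x n))\<^sup>2))"
    unfolding cinner_def by (simp add: complex_norm_square[symmetric])
  also have "\<dots> = complex_of_real (\<Sum>n. (cmod (Rep_ell2 x n))\<^sup>2)"
    by (rule suminf_of_real[symmetric, OF summable_ell2])
  finally show ?thesis by (simp add: inner_ell2_def)
qed

instance
proof
  fix x y z :: ell2 and r s :: real
  show "dist x y = norm (x - y)" by (rule dist_ell2_def)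
  show "x + y + z = x + (y + z)" by (rule ell2_eqI) (simp add: Rep_ell2_simps)
  show "x + y = y + x" by (rule ell2_eqI) (simp add: Rep_ell2_simps)
  show "0 + x = x" by (rule ell2_eqI) (simp add: Rep_ell2_simps)
  show "- x + x = 0" by (rule ell2_eqI) (simp add: Rep_ell2_simps)
  show "x - y = x + - y" by (rule minus_ell2_def)
  show "r *\<^sub>R (x + y) = r *\<^sub>R x + r *\<^sub>R y"
    by (rule ell2_eqI) (simp add: Rep_ell2_simps algebra_simps)
  show "(r + s) *\<^sub>R x = r *\<^sub>R x + s *\<^sub>R x"
    by (rule ell2_eqI) (simp add: Rep_ell2_simps algebra_simps)
  show "r *\<^sub>R s *\<^sub>R x = (r * s) *\<^sub>R x"
    by (rule ell2_eqI) (simp add: Rep_ell2_simps algebra_simps)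
  show "1 *\<^sub>R x = x" by (rule ell2_eqI) (simp add: Rep_ell2_simps)
  show "sgn x = inverse (norm x) *\<^sub>R x" by (simp add: sgn_ell2_def scaleR_ell2_def)
  show "(uniformity :: (ell2 \<times> ell2) filter) =
      (INF e\<in>{0 <..}. principal {(x, y). dist x y < e})"
    by (rule uniformity_ell2_def)
  show "open U = (\<forall>x\<in>U. eventually (\<lambda>(x', y). x' = x \<longrightarrow> y \<in> U) uniformity)"
    for U :: "ell2 set" by (rule open_ell2_def)
  have "cinner y x = cnj (cinner x y)" unfolding cinner_def
    by (subst bounded_linear.suminf[OF bounded_linear_cnj summable_cinner])
       (simp add: mult.commute)
  then show "inner x y = inner y x" by (simp add: inner_ell2_def)
  have "cinner (x + y) z = cinner x z + cinner y z" unfolding cinner_def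
    by (subst suminf_add[OF summable_cinner summable_cinner])
       (simp add: Rep_ell2_simps algebra_simps)
  then show "inner (x + y) z = inner x z + inner y z" by (simp add: inner_ell2_def)
  have "cinner (r *\<^sub>R x) y = complex_of_real r * cinner x y" unfolding cinner_def
    by (subst suminf_mult[OF summable_cinner, symmetric])
       (simp add: Rep_ell2_simps algebra_simps)
  then show "inner (r *\<^sub>R x) y = r * inner x y" by (simp add: inner_ell2_def)
  show "0 \<le> inner x x" unfolding inner_self_ell2
    by (intro suminf_nonneg summable_ell2) auto
  show "(inner x x = 0) = (x = 0)"
  proof
    assume "inner x x = 0"
    then have "\<forall>n. (cmod (Rep_ell2 x n))\<^sup>2 = 0" unfolding inner_self_ell2
      by (subst (asm) suminf_eq_zero_iff[OF summable_ell2]) auto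
    then show "x = 0" by (intro ell2_eqI) (simp add: Rep_ell2_simps)
  qed (simp add: inner_self_ell2 Rep_ell2_simps)
  show "norm x = sqrt (inner x x)" by (rule norm_ell2_def)
qed

end

lemma norm_ell2_eq: "(norm x)\<^sup>2 = (\<Sum>n. (cmod (Rep_ell2 x n))\<^sup>2)" for x :: ell2
  by (simp add: power2_norm_eq_inner inner_self_ell2)

lemma partial_le_norm_ell2: "(\<Sum>i<n. (cmod (Rep_ell2 x i))\<^sup>2) \<le> (norm x)\<^sup>2"
  unfolding norm_ell2_eq by (intro sum_le_suminf summable_ell2) auto

lemma coord_le_norm_ell2: "cmod (Rep_ell2 x n) \<le> norm x"
proof -
  have "(cmod (Rep_ell2 x n))\<^sup>2 \<le> (\<Sum>i<Suc n. (cmod (Rep_ell2 x i))\<^sup>2)"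
    by (simp add: sum_nonneg)
  also have "\<dots> \<le> (norm x)\<^sup>2" by (rule partial_le_norm_ell2)
  finally show ?thesis by (rule power2_le_imp_le) simp
qed

instance ell2 :: banach
proof
  fix X :: "nat \<Rightarrow> ell2"
  assume X: "Cauchy X"
  have "Cauchy (\<lambda>k. Rep_ell2 (X k) n)" for n
  proof (rule CauchyI)
    fix e :: real assume "0 < e"
    with X obtain N where N: "\<forall>m\<ge>N. \<forall>k\<ge>N. norm (X m - X k) < e"
      using CauchyD by blast
    show "\<exists>N. \<forall>m\<ge>N. \<forall>k\<ge>N. norm (Rep_ell2 (X m) n - Rep_ell2 (X k) n) < e"
    proof (intro exI[of _ N] allI impI)
      fix m k assume "N \<le> m" "N \<le> k"
      with N have "norm (X m - X k) < e" by blast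
      then show "norm (Rep_ell2 (X m) n - Rep_ell2 (X k) n) < e"
        using coord_le_norm_ell2[of "X m - X k" n] by (simp add: Rep_ell2_simps)
    qed
  qed
  then have "\<forall>n. \<exists>l. (\<lambda>k. Rep_ell2 (X k) n) \<longlonglongrightarrow> l"
    by (simp add: Cauchy_convergent_iff convergent_def)
  then obtain l where l: "\<And>n. (\<lambda>k. Rep_ell2 (X k) n) \<longlonglongrightarrow> l n" by metis
  have bound: "(\<Sum>i<n. (cmod (Rep_ell2 (X m) i - l i))\<^sup>2) \<le> e\<^sup>2"
    if N: "\<forall>m\<ge>N. \<forall>k\<ge>N. norm (X m - X k) < e" and m: "m \<ge> N" for N e m n
  proof (rule tendsto_upperbound)
    show "(\<lambda>k. \<Sum>i<n. (cmod (Rep_ell2 (X m) i - Rep_ell2 (X k) i))\<^sup>2)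
        \<longlonglongrightarrow> (\<Sum>i<n. (cmod (Rep_ell2 (X m) i - l i))\<^sup>2)"
      by (intro tendsto_intros l)
    show "\<forall>\<^sub>F k in sequentially. (\<Sum>i<n. (cmod (Rep_ell2 (X m) i - Rep_ell2 (X k) i))\<^sup>2) \<le> e\<^sup>2"
      using eventually_ge_at_top[of N]
    proof eventually_elim
      case (elim k)
      have "(\<Sum>i<n. (cmod (Rep_ell2 (X m) i - Rep_ell2 (X k) i))\<^sup>2) \<le> (norm (X m - X k))\<^sup>2"
        using partial_le_norm_ell2[where x = "X m - X k" and n = n] by (simp add: Rep_ell2_simps)
      also have "\<dots> \<le> e\<^sup>2"
        using N[rule_format, OF m elim] by (intro power_mono) auto
      finally show ?case .
    qed
  qed simp
  have summ: "summable (\<lambda>i. (cmod (Rep_ell2 (X m) i - l i))\<^sup>2)"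
    if N: "\<forall>m\<ge>N. \<forall>k\<ge>N. norm (X m - X k) < e" and m: "m \<ge> N" for N e m
  proof (rule summableI_nonneg_bounded)
    show "(\<Sum>i<n. (cmod (Rep_ell2 (X m) i - l i))\<^sup>2) \<le> e\<^sup>2" for n by (rule bound[OF N m])
  qed simp
  obtain N0 where N0: "\<forall>m\<ge>N0. \<forall>k\<ge>N0. norm (X m - X k) < 1"
    using CauchyD[OF X, of 1] by auto
  have "summable (\<lambda>i. (cmod (l i))\<^sup>2)"
  proof -
    have a: "summable (\<lambda>i. (cmod (- 1 * (Rep_ell2 (X N0) i - l i)))\<^sup>2)"
      by (rule summable_ell2_scale[OF summ[OF N0 order_refl]])
    show ?thesis using summable_ell2_add[OF summable_ell2[of "X N0"] a] by simp
  qed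
  then have L: "Rep_ell2 (Abs_ell2 l) n = l n" for n by (simp add: Abs_ell2_inverse)
  have "X \<longlonglongrightarrow> Abs_ell2 l"
  proof (rule metric_LIMSEQ_I)
    fix r :: real assume r: "0 < r"
    then obtain N where N: "\<forall>m\<ge>N. \<forall>k\<ge>N. norm (X m - X k) < r / 2"
      using CauchyD[OF X, of "r / 2"] by auto
    show "\<exists>N. \<forall>m\<ge>N. dist (X m) (Abs_ell2 l) < r"
    proof (intro exI[of _ N] allI impI)
      fix m assume m: "N \<le> m"
      have "(norm (X m - Abs_ell2 l))\<^sup>2 = (\<Sum>i. (cmod (Rep_ell2 (X m) i - l i))\<^sup>2)"
        unfolding norm_ell2_eq by (simp add: Rep_ell2_simps L)
      also have "\<dots> \<le> (r / 2)\<^sup>2"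
        by (rule suminf_le_const[OF summ[OF N m] bound[OF N m]])
      finally have "norm (X m - Abs_ell2 l) \<le> r / 2"
        by (rule power2_le_imp_le) (use r in linarith)
      then show "dist (X m) (Abs_ell2 l) < r" using r by (simp add: dist_norm)
    qed
  qed
  then show "convergent X" by (rule convergentI)
qed

lemma ell2_dense:
  obtains D :: "ell2 set" where "countable D" "\<And>x e. 0 < e \<Longrightarrow> \<exists>d\<in>D. dist d x < e"
proof -
  obtain Q :: "complex set" where Q: "countable Q"
    and Qd: "\<And>X. open X \<Longrightarrow> X \<noteq> {} \<Longrightarrow> \<exists>d\<in>Q. d \<in> X"
    by (rule countable_dense_setE) blast
  define emb where "emb xs = (\<Sum>k<length xs. xs ! k *\<^sub>C ket k)" for xs
  have Rep_sum: "Rep_ell2 (\<Sum>k\<in>A. g k) n = (\<Sum>k\<in>A. Rep_ell2 (g k) n)"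
    for g :: "nat \<Rightarrow> ell2" and A n
    by (induction A rule: infinite_finite_induct) (auto simp: Rep_ell2_simps)
  have Rep_emb: "Rep_ell2 (emb xs) n = (if n < length xs then xs ! n else 0)" for xs n
    unfolding emb_def Rep_sum by (simp add: Rep_ell2_simps if_distrib cong: if_cong)
  have "\<exists>d\<in>emb ` lists Q. dist d x < e" if e: "0 < e" for x e
  proof -
    define u where "u n = (cmod (Rep_ell2 x n))\<^sup>2" for n
    have su: "summable u" unfolding u_def by (rule summable_ell2)
    obtain N where N: "norm (\<Sum>i. u (i + N)) < e\<^sup>2 / 4"
      using suminf_exist_split[OF _ su, of "e\<^sup>2 / 4"] e by auto
    define c where "c = e / (2 * (1 + real N))"
    have c: "0 < c" unfolding c_def using e by simp
    have ce: "(1 + real N) * c = e / 2"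
    proof -
      have "1 + real N \<noteq> 0" by linarith
      then show ?thesis unfolding c_def by (simp add: field_simps)
    qed
    have "\<exists>q\<in>Q. dist (Rep_ell2 x n) q < c" for n
    proof -
      have "ball (Rep_ell2 x n) c \<noteq> {}" using c by simp
      from Qd[OF open_ball this] show ?thesis by (simp only: mem_ball)
    qed
    then obtain q where q: "\<And>n. q n \<in> Q" "\<And>n. dist (Rep_ell2 x n) (q n) < c"
      by metis
    define d where "d = emb (map q [0..<N])"
    have Rd: "Rep_ell2 d n = (if n < N then q n else 0)" for n by (simp add: Rep_emb d_def)
    define w where "w n = (cmod (Rep_ell2 (d - x) n))\<^sup>2" for n
    have sw: "summable w" unfolding w_def by (rule summable_ell2)
    have 1: "(norm (d - x))\<^sup>2 = suminf w" unfolding w_def by (rule norm_ell2_eq)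
    have 2: "suminf w = (\<Sum>n. w (n + N)) + (\<Sum>n<N. w n)"
      by (rule suminf_split_initial_segment[OF sw])
    have "w (n + N) = u (n + N)" for n unfolding w_def u_def by (simp add: Rep_ell2_simps Rd)
    then have 3: "(\<Sum>n. w (n + N)) < e\<^sup>2 / 4" using N by simp
    have "w n \<le> c\<^sup>2" if "n < N" for n
    proof -
      have "cmod (q n - Rep_ell2 x n) < c" using q(2)[of n] by (simp only: dist_commute dist_norm)
      then show ?thesis unfolding w_def using that
        by (intro power_mono) (simp_all add: Rep_ell2_simps Rd)
    qed
    then have "(\<Sum>n<N. w n) \<le> (\<Sum>n<N. c\<^sup>2)" by (intro sum_mono) simp
    also have "\<dots> = real N * c\<^sup>2" by simp
    also have "\<dots> \<le> (1 + real N)\<^sup>2 * c\<^sup>2"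
    proof (rule mult_right_mono)
      have "0 \<le> (real N)\<^sup>2" by (rule zero_le_power2)
      then show "real N \<le> (1 + real N)\<^sup>2" unfolding power2_sum one_power2 by linarith
    qed (rule zero_le_power2)
    also have "\<dots> = (e / 2)\<^sup>2" unfolding ce[symmetric] by (rule power_mult_distrib[symmetric])
    also have "\<dots> = e\<^sup>2 / 4" by (simp add: power_divide)
    finally have "(norm (d - x))\<^sup>2 < e\<^sup>2" using 1 2 3 zero_le_power2[of e] by linarith
    then have "norm (d - x) < e" by (rule power2_less_imp_less) (use e in simp)
    then have "dist d x < e" unfolding dist_norm .
    moreover have "d \<in> emb ` lists Q" unfolding d_def
      by (rule imageI) (use q(1) in \<open>auto simp: lists_eq_set\<close>)
    ultimately show ?thesis by blast
  qed
  moreover have "countable (emb ` lists Q)" using Q by simp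
  ultimately show ?thesis using that by blast
qed

instance ell2 :: second_countable_topology
proof
  obtain D :: "ell2 set" where D: "countable D" "\<And>x e. 0 < e \<Longrightarrow> \<exists>d\<in>D. dist d x < e"
    by (rule ell2_dense) blast
  let ?B = "(\<lambda>(d, n). ball d (1 / Suc n)) ` (D \<times> (UNIV :: nat set))"
  have "topological_basis ?B"
  proof (rule topological_basisI)
    fix U :: "ell2 set" and x assume "open U" "x \<in> U"
    then obtain e where e: "0 < e" "ball x e \<subseteq> U" by (auto simp: open_contains_ball)
    obtain n where n: "1 / Suc n < e / 2"
      using nat_approx_posE[of "e / 2"] e by auto
    obtain d where d: "d \<in> D" "dist d x < 1 / Suc n" using D(2)[of "1 / Suc n" x] by auto
    have "ball d (1 / Suc n) \<subseteq> ball x e"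
    proof
      fix y assume "y \<in> ball d (1 / Suc n)"
      then have "dist d y < e / 2" "dist d x < e / 2" using d n by auto
      then show "y \<in> ball x e" using dist_triangle[of x y d] by (simp add: dist_commute)
    qed
    then show "\<exists>B'\<in>?B. x \<in> B' \<and> B' \<subseteq> U" using d e
      by (intro bexI[of _ "ball d (1 / Suc n)"]) auto
  qed auto
  then have "open = generate_topology ?B" by (rule topological_basis_imp_subbasis)
  moreover have "countable ?B" using D(1) by auto
  ultimately show "\<exists>B :: ell2 set set. countable B \<and> open = generate_topology B" by blast
qed

section \<open>Operators on \<open>\<ell>\<^sup>2\<close>\<close>

definition bounded_clinear :: "(ell2 \<Rightarrow> ell2) \<Rightarrow> bool" where
  "bounded_clinear T \<longleftrightarrow> bounded_linear T \<and> (\<forall>c v. T (c *\<^sub>C v) = c *\<^sub>C T v)"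

definition cadjoint :: "(ell2 \<Rightarrow> ell2) \<Rightarrow> ell2 \<Rightarrow> ell2" where
  "cadjoint T = (SOME S. \<forall>v w. cinner (T v) w = cinner v (S w))"

definition op_trace :: "(ell2 \<Rightarrow> ell2) \<Rightarrow> complex" where
  "op_trace T = (\<Sum>n. cinner (T (ket n)) (ket n))"

definition ennreal_sqrt :: "ennreal \<Rightarrow> ennreal" where
  "ennreal_sqrt x = (if x = \<infinity> then \<infinity> else ennreal (sqrt (enn2real x)))"

definition hs_norm :: "(ell2 \<Rightarrow> ell2) \<Rightarrow> ennreal" where
  "hs_norm T = ennreal_sqrt (\<Sum>n. ennreal ((norm (T (ket n)))\<^sup>2))"

section \<open>Topological groups and their Haar measures\<close>

text \<open>
  Groups are written additively, as this is the notation of the library class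
  \<^class>\<open>topological_group_add\<close>; they are not assumed to be commutative. Hence
  \<open>- a + x\<close> stands for the product of the inverse of \<open>a\<close> with \<open>x\<close>.
\<close>

instance prod :: (topological_monoid_add, topological_monoid_add) topological_monoid_add
proof
  fix a b :: "'a \<times> 'b"
  have "((\<lambda>x. (fst (fst x) + fst (snd x), snd (fst x) + snd (snd x)))
      \<longlongrightarrow> (fst a + fst b, snd a + snd b)) (nhds a \<times>\<^sub>F nhds b)"
    by (intro tendsto_Pair tendsto_add tendsto_fst tendsto_snd filterlim_fst filterlim_snd)
  then show "((\<lambda>x. fst x + snd x) \<longlongrightarrow> a + b) (nhds a \<times>\<^sub>F nhds b)"
    by (simp add: plus_prod_def)
qed

instance prod :: (topological_group_add, topological_group_add) topological_group_add
proof
  fix a :: "'a \<times> 'b"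
  have "((\<lambda>x. (- fst x, - snd x)) \<longlongrightarrow> (- fst a, - snd a)) (nhds a)"
    by (intro tendsto_Pair tendsto_minus tendsto_fst tendsto_snd filterlim_ident)
  then show "(uminus \<longlongrightarrow> - a) (nhds a)"
    by (simp add: uminus_prod_def[abs_def])
qed

text \<open>
  For second countable locally compact groups, Borel measures that are finite on compact sets
  are automatically regular.
\<close>

definition haar_measure :: "'g::topological_group_add measure \<Rightarrow> bool" where
  "haar_measure M \<longleftrightarrow> sets M = sets borel
    \<and> (\<forall>K. compact K \<longrightarrow> emeasure M K < \<infinity>)
    \<and> (\<forall>U. open U \<and> U \<noteq> {} \<longrightarrow> 0 < emeasure M U)
    \<and> (\<forall>g. \<forall>E\<in>sets borel. emeasure M ((\<lambda>x. g + x) ` E) = emeasure M E)"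

definition unimodular :: "'g::topological_group_add itself \<Rightarrow> bool" where
  "unimodular _ \<longleftrightarrow> (\<forall>M :: 'g measure. haar_measure M \<longrightarrow>
    (\<forall>g. \<forall>E\<in>sets borel. emeasure M ((\<lambda>x. x + g) ` E) = emeasure M E))"

section \<open>Unitary representations\<close>

text \<open>
  All groups considered are second countable, so it suffices to consider representations on
  separable Hilbert spaces, i.e. on closed subspaces \<open>H\<close> of \<open>\<ell>\<^sup>2\<close>. A unitary representation on
  \<open>H\<close> is encoded by its extension by \<open>0\<close> to the orthogonal complement of \<open>H\<close>: thus \<open>\<pi> 0\<close> is the
  orthogonal projection onto \<open>H\<close>, which need not be the identity, and \<open>H\<close> is recovered as the
  range of \<open>\<pi> 0\<close>. Traces and Hilbert--Schmidt norms of operators on \<open>H\<close> agree with those of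
  their extensions by \<open>0\<close>.
\<close>

type_synonym 'g rep = "'g \<Rightarrow> ell2 \<Rightarrow> ell2"

definition unitary_rep :: "'g::topological_group_add rep \<Rightarrow> bool" where
  "unitary_rep \<pi> \<longleftrightarrow> (\<forall>g. bounded_clinear (\<pi> g))
    \<and> (\<forall>g h. \<pi> (g + h) = \<pi> g \<circ> \<pi> h)
    \<and> (\<forall>g v w. cinner (\<pi> g v) w = cinner v (\<pi> (- g) w))
    \<and> (\<forall>v. continuous_on UNIV (\<lambda>g. \<pi> g v))"

definition rep_space :: "'g::topological_group_add rep \<Rightarrow> ell2 set" where
  "rep_space \<pi> = range (\<pi> 0)"

definition irreducible_rep :: "'g::topological_group_add rep \<Rightarrow> bool" where
  "irreducible_rep \<pi> \<longleftrightarrow> unitary_rep \<pi> \<and> rep_space \<pi> \<noteq> {0}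
    \<and> (\<forall>K. K \<subseteq> rep_space \<pi> \<and> closed K \<and> subspace K \<and> (\<forall>c. \<forall>v\<in>K. c *\<^sub>C v \<in> K)
          \<and> (\<forall>g. \<pi> g ` K \<subseteq> K) \<longrightarrow> K = {0} \<or> K = rep_space \<pi>)"

definition isometric_intertwiner ::
    "(ell2 \<Rightarrow> ell2) \<Rightarrow> 'g::topological_group_add rep \<Rightarrow> 'g rep \<Rightarrow> bool" where
  "isometric_intertwiner U \<rho> \<pi> \<longleftrightarrow> bounded_clinear U
    \<and> (\<forall>v\<in>rep_space \<rho>. U v \<in> rep_space \<pi> \<and> norm (U v) = norm v)
    \<and> (\<forall>g. \<forall>v\<in>rep_space \<rho>. U (\<rho> g v) = \<pi> g (U v))"

definition equivalent_rep :: "'g::topological_group_add rep \<Rightarrow> 'g rep \<Rightarrow> bool" where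
  "equivalent_rep \<rho> \<pi> \<longleftrightarrow>
    (\<exists>U. isometric_intertwiner U \<rho> \<pi> \<and> U ` rep_space \<rho> = rep_space \<pi>)"

definition unitary_dual :: "'g::topological_group_add rep set set" where
  "unitary_dual = {\<pi>. irreducible_rep \<pi>} //
    {(\<rho>, \<pi>). irreducible_rep \<rho> \<and> irreducible_rep \<pi> \<and> equivalent_rep \<rho> \<pi>}"

text \<open>
  A representative of a class. Up to unitary conjugation nothing below depends on the choice.
\<close>

definition rep_of :: "'g::topological_group_add rep set \<Rightarrow> 'g rep" where
  "rep_of \<delta> = (SOME \<pi>. \<pi> \<in> \<delta>)"

text \<open>
  A group is of type I if every primary representation (one whose commutant has trivial center)
  is a direct sum of copies of an irreducible representation. An operator commuting with \<open>\<pi> 0\<close>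
  leaves the representation space invariant; elements of the commutant are again extended by \<open>0\<close>.
\<close>

definition commutant :: "'g::topological_group_add rep \<Rightarrow> (ell2 \<Rightarrow> ell2) set" where
  "commutant \<pi> = {T. bounded_clinear T \<and> (\<forall>g. T \<circ> \<pi> g = \<pi> g \<circ> T) \<and> T \<circ> \<pi> 0 = T}"

definition primary_rep :: "'g::topological_group_add rep \<Rightarrow> bool" where
  "primary_rep \<pi> \<longleftrightarrow> unitary_rep \<pi> \<and> rep_space \<pi> \<noteq> {0}
    \<and> (\<forall>T\<in>commutant \<pi>. (\<forall>S\<in>commutant \<pi>. S \<circ> T = T \<circ> S) \<longrightarrow> (\<exists>c. T = (\<lambda>v. c *\<^sub>C \<pi> 0 v)))"

definition direct_sum_of_copies :: "'g::topological_group_add rep \<Rightarrow> 'g rep \<Rightarrow> bool" where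
  "direct_sum_of_copies \<pi> \<rho> \<longleftrightarrow> (\<exists>(I :: nat set) U.
      (\<forall>i\<in>I. isometric_intertwiner (U i) \<rho> \<pi>)
    \<and> (\<forall>i\<in>I. \<forall>j\<in>I. i \<noteq> j \<longrightarrow>
          (\<forall>v\<in>rep_space \<rho>. \<forall>w\<in>rep_space \<rho>. cinner (U i v) (U j w) = 0))
    \<and> closure (span (\<Union>i\<in>I. U i ` rep_space \<rho>)) = rep_space \<pi>)"

definition type_I :: "'g::topological_group_add itself \<Rightarrow> bool" where
  "type_I _ \<longleftrightarrow> (\<forall>\<pi> :: 'g rep. primary_rep \<pi> \<longrightarrow>
    (\<exists>\<rho>. irreducible_rep \<rho> \<and> direct_sum_of_copies \<pi> \<rho>))"

section \<open>Fourier analysis on \<open>A = L \<times> \<real>\<close>\<close>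

text \<open>
  The parameter \<open>\<mu>\<close> is the Haar measure \<open>dl\<close> of \<open>L\<close>; \<open>dt\<close> is Lebesgue measure.
\<close>

abbreviation haar_A :: "'l::topological_group_add measure \<Rightarrow> ('l \<times> real) measure" where
  "haar_A \<mu> \<equiv> \<mu> \<Otimes>\<^sub>M lborel"

definition L2 :: "'a measure \<Rightarrow> ('a \<Rightarrow> complex) set" where
  "L2 M = {f \<in> borel_measurable M. integrable M (\<lambda>x. (cmod (f x))\<^sup>2)}"

definition L1_L2 :: "'a measure \<Rightarrow> ('a \<Rightarrow> complex) set" where
  "L1_L2 M = {f \<in> L2 M. integrable M f}"

text \<open>
  \<^term>\<open>fourier \<mu> f \<delta> \<gamma>\<close> is the operator \<open>\<sigma>(f)\<close> for the representation
  \<open>\<sigma>(l, t) = exp(i \<gamma> t) \<delta>(l)\<close> of \<open>A\<close>.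
\<close>

definition fourier ::
    "'l::topological_group_add measure \<Rightarrow> ('l \<times> real \<Rightarrow> complex) \<Rightarrow> 'l rep set \<Rightarrow> real \<Rightarrow> ell2 \<Rightarrow> ell2"
  where
  "fourier \<mu> f \<delta> \<gamma> v = (LINT (l, t)|haar_A \<mu>. (f (l, t) * cis (\<gamma> * t)) *\<^sub>C rep_of \<delta> l v)"

definition dgamma :: "real measure" where
  "dgamma = density lborel (\<lambda>_. ennreal (1 / (2 * pi)))"

text \<open>
  The unitary dual of a compact group is discrete, so a measure on it is given by point weights.
  The Plancherel measure \<open>d\<delta>\<close> of \<open>L\<close> is characterised by the Plancherel formula for
  \<open>A\<close> with respect to \<open>d\<delta> d\<gamma>\<close>; the weights depend on the normalisation of \<open>\<mu>\<close>.
\<close>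

definition plancherel_measure ::
    "'l::topological_group_add measure \<Rightarrow> 'l rep set measure \<Rightarrow> bool" where
  "plancherel_measure \<mu> \<nu> \<longleftrightarrow>
    (\<exists>w :: 'l rep set \<Rightarrow> real. \<nu> = density (count_space unitary_dual) (\<lambda>\<delta>. ennreal (w \<delta>)))
    \<and> (\<forall>f\<in>L1_L2 (haar_A \<mu>).
        (\<integral>\<^sup>+\<delta>. \<integral>\<^sup>+\<gamma>. (hs_norm (fourier \<mu> f \<delta> \<gamma>))\<^sup>2 \<partial>dgamma \<partial>\<nu>) =
        (\<integral>\<^sup>+a. ennreal ((cmod (f a))\<^sup>2) \<partial>haar_A \<mu>))"

text \<open>
  The continuous extension of the Fourier transform from \<open>L\<^sup>1 \<inter> L\<^sup>2\<close> to \<open>L\<^sup>2\<close>: a measurable field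
  of operators which is the limit of the transforms of any approximating sequence. It is
  determined up to null sets, and exists by the Plancherel formula.
\<close>

definition plancherel_extension ::
    "'l::topological_group_add measure \<Rightarrow> 'l rep set measure \<Rightarrow> ('l \<times> real \<Rightarrow> complex)
      \<Rightarrow> ('l rep set \<Rightarrow> real \<Rightarrow> ell2 \<Rightarrow> ell2) \<Rightarrow> bool" where
  "plancherel_extension \<mu> \<nu> f F \<longleftrightarrow>
    (\<forall>\<delta> \<gamma>. bounded_clinear (F \<delta> \<gamma>))
    \<and> (\<forall>\<delta> v. (\<lambda>\<gamma>. F \<delta> \<gamma> v) \<in> borel_measurable borel)
    \<and> (\<forall>g. (\<forall>k. g k \<in> L1_L2 (haar_A \<mu>))
          \<and> (\<lambda>k. LINT a|haar_A \<mu>. (cmod (g k a - f a))\<^sup>2) \<longlonglongrightarrow> 0 \<longrightarrow>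
        (\<lambda>k. \<integral>\<^sup>+\<delta>. \<integral>\<^sup>+\<gamma>. (hs_norm (\<lambda>v. fourier \<mu> (g k) \<delta> \<gamma> v - F \<delta> \<gamma> v))\<^sup>2 \<partial>dgamma \<partial>\<nu>)
          \<longlonglongrightarrow> 0)"

definition fourier_L2 ::
    "'l::topological_group_add measure \<Rightarrow> 'l rep set measure \<Rightarrow> ('l \<times> real \<Rightarrow> complex)
      \<Rightarrow> 'l rep set \<Rightarrow> real \<Rightarrow> ell2 \<Rightarrow> ell2" where
  "fourier_L2 \<mu> \<nu> f = (SOME F. plancherel_extension \<mu> \<nu> f F)"

section \<open>Abstract wavelet groups\<close>

text \<open>
  Here \<open>\<tau>\<close> is a continuous action of \<open>B\<close> on \<open>A\<close> by automorphisms, and \<open>\<Delta>\<close> is the positive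
  homomorphism \<open>\<delta>\<^sub>\<tau>\<close> with \<open>d(a) = \<delta>\<^sub>\<tau>(b) d(\<tau>\<^sub>b(a))\<close>.
\<close>

definition automorphism_action ::
    "('b::topological_group_add \<Rightarrow> 'a::topological_group_add \<Rightarrow> 'a) \<Rightarrow> bool" where
  "automorphism_action \<tau> \<longleftrightarrow> (\<forall>b. bij (\<tau> b))
    \<and> (\<forall>b x y. \<tau> b (x + y) = \<tau> b x + \<tau> b y)
    \<and> (\<forall>b c. \<tau> (b + c) = \<tau> b \<circ> \<tau> c)
    \<and> continuous_on UNIV (\<lambda>(b, x). \<tau> b x)"

definition modular_hom ::
    "'a::topological_group_add measure \<Rightarrow> ('b::topological_group_add \<Rightarrow> 'a \<Rightarrow> 'a)
      \<Rightarrow> ('b \<Rightarrow> real) \<Rightarrow> bool" where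
  "modular_hom M \<tau> \<Delta> \<longleftrightarrow> (\<forall>b. 0 < \<Delta> b)
    \<and> (\<forall>b c. \<Delta> (b + c) = \<Delta> b * \<Delta> c)
    \<and> (\<forall>b. \<forall>E\<in>sets borel. emeasure M E = ennreal (\<Delta> b) * emeasure M (\<tau> b ` E))"

definition wavelet_rep ::
    "('b::topological_group_add \<Rightarrow> 'a::topological_group_add \<Rightarrow> 'a) \<Rightarrow> ('b \<Rightarrow> real)
      \<Rightarrow> 'b \<times> 'a \<Rightarrow> ('a \<Rightarrow> complex) \<Rightarrow> 'a \<Rightarrow> complex" where
  "wavelet_rep \<tau> \<Delta> = (\<lambda>(b, a) f x. complex_of_real (sqrt (\<Delta> b)) * f (\<tau> (- b) (- a + x)))"

definition wavelet_transform ::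
    "'a::topological_group_add measure \<Rightarrow> ('b::topological_group_add \<Rightarrow> 'a \<Rightarrow> 'a) \<Rightarrow> ('b \<Rightarrow> real)
      \<Rightarrow> ('a \<Rightarrow> complex) \<Rightarrow> ('a \<Rightarrow> complex) \<Rightarrow> 'b \<times> 'a \<Rightarrow> complex" where
  "wavelet_transform M \<tau> \<Delta> \<psi> f p = (LINT x|M. f x * cnj (wavelet_rep \<tau> \<Delta> p \<psi> x))"

definition feasible_wavelet ::
    "'l::topological_group_add measure \<Rightarrow> 'b::topological_group_add measure \<Rightarrow> 'l rep set measure
      \<Rightarrow> ('b \<Rightarrow> 'l \<times> real \<Rightarrow> 'l \<times> real) \<Rightarrow> ('b \<Rightarrow> real) \<Rightarrow> ('l \<times> real \<Rightarrow> complex) \<Rightarrow> real \<Rightarrow> bool" where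
  "feasible_wavelet \<mu> \<beta> \<nu> \<tau> \<Delta> \<psi> C \<longleftrightarrow> \<psi> \<in> L1_L2 (haar_A \<mu>) \<and> 0 < C
    \<and> (AE \<delta> in \<nu>. AE \<gamma> in dgamma. \<forall>f\<in>L1_L2 (haar_A \<mu>). \<forall>g\<in>L1_L2 (haar_A \<mu>).
        has_bochner_integral \<beta>
          (\<lambda>b. let \<sigma> = (\<lambda>h. fourier \<mu> h \<delta> \<gamma>); \<psi>\<^sub>b = \<psi> \<circ> \<tau> (- b) in
            op_trace (\<sigma> f \<circ> \<sigma> g \<circ> cadjoint (\<sigma> \<psi>\<^sub>b) \<circ> \<sigma> \<psi>\<^sub>b) * complex_of_real ((\<Delta> b)\<^sup>2))
          (complex_of_real C * op_trace (fourier \<mu> f \<delta> \<gamma> \<circ> fourier \<mu> g \<delta> \<gamma>)))"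

end

theory Submission
  imports Defs
begin

text \<open>
  Let \<open>M\<close> be the Haar measure of \<open>A = L \<times> \<real>\<close> and let
  \<open>H\<^sub>f(b, a) = \<Delta>(b) \<langle>f, \<psi> (\<tau>\<^sub>-\<^sub>b (- a + \<cdot>))\<rangle>\<close>, so that \<open>|W f|\<^sup>2 \<Delta> = |H\<^sub>f|\<^sup>2\<close>. The proof rests on
  three facts.

  \<^item> Parseval: \<open>\<integral>\<^sub>B \<integral>\<^sub>A |H\<^sub>f|\<^sup>2 = C \<integral> |f|\<^sup>2\<close> (\<open>parseval\<close>). The function \<open>a \<mapsto> H\<^sub>f(b, a)\<close> is \<open>\<Delta>(b)\<close> times
    the convolution of \<open>f\<close> with the involution of \<open>\<psi> \<circ> \<tau>\<^sub>-\<^sub>b\<close>, and its Fourier transform is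
    \<open>\<Delta>(b) \<sigma>(f) \<sigma>(\<psi> \<circ> \<tau>\<^sub>-\<^sub>b)\<^sup>*\<close>. By the Plancherel formula the left-hand side is the integral over \<open>b\<close>
    and \<open>\<sigma>\<close> of \<open>\<Delta>(b)\<^sup>2 tr(\<sigma>(f)\<^sup>* \<sigma>(f) \<sigma>(\<psi> \<circ> \<tau>\<^sub>-\<^sub>b)\<^sup>* \<sigma>(\<psi> \<circ> \<tau>\<^sub>-\<^sub>b))\<close>, and the integral over \<open>b\<close> is given by
    feasibility.
  \<^item> Translation by \<open>s\<close> in the real variable multiplies \<open>\<sigma>(f)\<close> by a number \<open>e\<^sup>-\<^sup>i\<^sup>\<gamma>\<^sup>s\<close> with
    \<open>|e\<^sup>-\<^sup>i\<^sup>\<gamma>\<^sup>s - 1| \<le> |\<gamma> s|\<close>. So the difference \<open>D\<^sub>s f\<close> of \<open>f\<close> and its translate satisfies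
    \<open>\<integral> |D\<^sub>s f|\<^sup>2 \<le> s\<^sup>2 K\<close>, where \<open>K\<close> is the second moment of the Fourier transform (\<open>difference_bound\<close>).
  \<^item> Heisenberg's inequality holds with difference quotients in place of a derivative
    (\<open>heisenberg_difference\<close>).

  As the real line is central in \<open>A\<close>, the wavelet transform commutes with translations along it:
  \<open>D\<^sub>s H\<^sub>f = H\<close> of \<open>D\<^sub>s f\<close>. Parseval's identity for \<open>D\<^sub>s f\<close> gives \<open>\<integral> |D\<^sub>s H\<^sub>f|\<^sup>2 \<le> s\<^sup>2 C K\<close>, and Heisenberg's
  inequality for \<open>H\<^sub>f\<close> as a function of \<open>t\<close>, integrated over \<open>b\<close> and \<open>l\<close>, reads
  \<open>C \<integral> |f|\<^sup>2 \<le> 2 (C K)\<^sup>1\<^sup>/\<^sup>2 T\<^sup>1\<^sup>/\<^sup>2\<close> with \<open>T = \<integral> t\<^sup>2 |H\<^sub>f|\<^sup>2\<close>. This is the claim. Working with differences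
  keeps every function in \<open>L\<^sup>2\<close>, where both Parseval and Plancherel are available, and avoids weak
  derivatives and a Fourier transform in the real variable alone.

  Two points of measure theory need care. The Fourier transform of \<open>f \<in> L\<^sup>2\<close> is a choice among the
  continuous extensions from \<open>L\<^sup>1 \<inter> L\<^sup>2\<close>, so their existence has to be shown
  (\<open>plancherel_extension_exists\<close>). And interchanging the integrals over \<open>b\<close> and \<open>\<delta>\<close> requires that
  the Plancherel measure has countable support (\<open>countable_supp\<close>).
\<close>

section \<open>Operators on \<open>\<ell>\<^sup>2\<close>: adjoints, Hilbert--Schmidt norms and traces\<close>

lemma cinner_add_left: "cinner (x + y) z = cinner x z + cinner y z"
  unfolding cinner_def
  by (subst suminf_add[OF summable_cinner summable_cinner]) (simp add: Rep_ell2_simps algebra_simps)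

lemma cinner_scaleC_left: "cinner (c *\<^sub>C x) y = c * cinner x y"
  unfolding cinner_def
  by (subst suminf_mult[OF summable_cinner, symmetric]) (simp add: Rep_ell2_simps algebra_simps)

lemma cinner_commute: "cinner y x = cnj (cinner x y)"
  unfolding cinner_def
  by (subst bounded_linear.suminf[OF bounded_linear_cnj summable_cinner]) (simp add: mult.commute)

lemma cinner_scaleC_right: "cinner x (c *\<^sub>C y) = cnj c * cinner x y"
  by (metis cinner_commute cinner_scaleC_left complex_cnj_mult)

lemma cinner_add_right: "cinner x (y + z) = cinner x y + cinner x z"
  by (metis cinner_commute cinner_add_left complex_cnj_add)

lemma cinner_self: "cinner x x = complex_of_real ((norm x)\<^sup>2)"
proof -
  have "cinner x x = (\<Sum>n. complex_of_real ((cmod (Rep_ell2 x n))\<^sup>2))"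
    unfolding cinner_def by (simp add: complex_norm_square[symmetric])
  also have "\<dots> = complex_of_real (\<Sum>n. (cmod (Rep_ell2 x n))\<^sup>2)"
    by (rule suminf_of_real[symmetric, OF summable_ell2])
  finally show ?thesis by (simp add: norm_ell2_eq)
qed

lemma scaleR_eq_scaleC: "r *\<^sub>R x = complex_of_real r *\<^sub>C x" for x :: ell2
  by (rule scaleR_ell2_def)

lemma norm_scaleC: "norm (c *\<^sub>C x) = cmod c * norm x"
proof -
  have "complex_of_real ((norm (c *\<^sub>C x))\<^sup>2) = complex_of_real ((cmod c * norm x)\<^sup>2)"
    unfolding cinner_self[symmetric] cinner_scaleC_left cinner_scaleC_right
    by (simp only: cinner_self of_real_mult power_mult_distrib complex_norm_square mult.assoc[symmetric])
      (simp add: mult.commute)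
  then have "(norm (c *\<^sub>C x))\<^sup>2 = (cmod c * norm x)\<^sup>2"
    by (rule of_real_eq_iff[THEN iffD1])
  then show ?thesis by (rule power2_eq_imp_eq) auto
qed

lemma norm_cinner_le: "cmod (cinner x y) \<le> norm x * norm y"
proof (cases "cinner x y = 0")
  case False
  \<comment> \<open>Rotating \<open>x\<close> by a phase makes the scalar product real, and real Cauchy--Schwarz applies.\<close>
  define c where "c = cnj (sgn (cinner x y))"
  have c: "cmod c = 1" unfolding c_def using False by (simp add: norm_sgn)
  have "c * cinner x y = complex_of_real (cmod (cinner x y))"
    unfolding c_def using False
    by (simp add: sgn_eq complex_norm_square[symmetric] field_simps power2_eq_square
        flip: of_real_mult)
  then have "inner (c *\<^sub>C x) y = cmod (cinner x y)"
    by (simp add: inner_ell2_def cinner_scaleC_left)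
  then show ?thesis
    using norm_cauchy_schwarz[of "c *\<^sub>C x" y] c by (simp add: norm_scaleC)
qed simp

lemma cinner_ket: "cinner x (ket n) = Rep_ell2 x n"
proof -
  have "cinner x (ket n) = (\<Sum>m. if m = n then Rep_ell2 x m else 0)"
    unfolding cinner_def by (intro suminf_cong) (simp add: Rep_ell2_simps)
  also have "\<dots> = Rep_ell2 x n"
    by (subst suminf_finite[of "{n}"]) auto
  finally show ?thesis .
qed

lemma bounded_bilinear_cinner: "bounded_bilinear cinner"
  by (standard; (intro exI[of _ 1] allI)?)
    (simp_all add: cinner_add_left cinner_add_right scaleR_eq_scaleC cinner_scaleC_left
      cinner_scaleC_right norm_cinner_le scaleR_conv_of_real)

lemma bounded_bilinear_scaleC: "bounded_bilinear (*\<^sub>C)"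
proof (standard, goal_cases)
  case 5 show ?case by (intro exI[of _ 1]) (simp add: norm_scaleC)
qed (auto intro!: ell2_eqI simp: Rep_ell2_simps algebra_simps scaleR_conv_of_real)

lemmas bounded_linear_cinner_left = bounded_bilinear.bounded_linear_left[OF bounded_bilinear_cinner]
lemmas bounded_linear_scaleC_right = bounded_bilinear.bounded_linear_right[OF bounded_bilinear_scaleC]

lemma measurable_scaleC[measurable (raw)]:
  assumes "f \<in> borel_measurable M" "g \<in> borel_measurable M"
  shows "(\<lambda>x. f x *\<^sub>C g x) \<in> borel_measurable M"
proof (rule borel_measurable_continuous_Pair[OF assms])
  show "continuous_on UNIV (\<lambda>p. fst p *\<^sub>C snd p)"
    by (intro bounded_bilinear.continuous_on[OF bounded_bilinear_scaleC] continuous_intros)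
qed

lemma ell2_eq_cinnerI:
  assumes "\<And>v. cinner v x = cinner v y"
  shows "x = y"
proof (rule ell2_eqI)
  show "Rep_ell2 x n = Rep_ell2 y n" for n
    using assms[of "ket n"] cinner_commute[of "ket n" x] cinner_commute[of "ket n" y]
    by (metis cinner_ket cinner_commute)
qed

subsection \<open>Adjoint pairs\<close>

text \<open>
  A relation instead of an operation, because all adjoints below are known explicitly: those of
  Fourier transforms come from the involution of functions.
\<close>

definition adjoint_pair :: "(ell2 \<Rightarrow> ell2) \<Rightarrow> (ell2 \<Rightarrow> ell2) \<Rightarrow> bool" where
  "adjoint_pair T T' \<longleftrightarrow> (\<forall>v w. cinner (T v) w = cinner v (T' w))"

lemma adjoint_pairD: "adjoint_pair T T' \<Longrightarrow> cinner (T v) w = cinner v (T' w)"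
  by (simp add: adjoint_pair_def)

lemma adjoint_pair_sym: "adjoint_pair T T' \<Longrightarrow> adjoint_pair T' T"
  unfolding adjoint_pair_def by (metis cinner_commute)

lemma adjoint_pair_comp:
  "adjoint_pair S S' \<Longrightarrow> adjoint_pair T T' \<Longrightarrow> adjoint_pair (S \<circ> T) (T' \<circ> S')"
  by (simp add: adjoint_pair_def)

lemma cadjoint_eq:
  assumes "adjoint_pair T T'"
  shows "cadjoint T = T'"
proof -
  have "\<forall>v w. cinner (T v) w = cinner v (cadjoint T w)"
    unfolding cadjoint_def by (rule someI[of _ T']) (use assms in \<open>simp add: adjoint_pair_def\<close>)
  then show ?thesis
    using adjoint_pairD[OF assms] by (intro ext ell2_eq_cinnerI) metis
qed

lemma ennreal_sqrt_power2: "(ennreal_sqrt x)\<^sup>2 = x"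
  by (cases x) (auto simp: ennreal_sqrt_def ennreal_power)

lemma hs_norm_power2: "(hs_norm T)\<^sup>2 = (\<Sum>n. ennreal ((norm (T (ket n)))\<^sup>2))"
  by (simp add: hs_norm_def ennreal_sqrt_power2)

lemma ennreal_norm_ell2: "ennreal ((norm x)\<^sup>2) = (\<Sum>n. ennreal ((cmod (Rep_ell2 x n))\<^sup>2))"
  unfolding norm_ell2_eq by (rule suminf_ennreal2[symmetric]) (auto intro: summable_ell2)

lemma ennreal_suminf_swap:
  "(\<Sum>m. \<Sum>n. f m n) = (\<Sum>n. \<Sum>m. f m n :: ennreal)"
proof -
  have "(\<Sum>m. \<Sum>n. f m n) = (\<integral>\<^sup>+m. (\<Sum>n. f m n) \<partial>count_space UNIV)"
    by (simp add: nn_integral_count_space_nat)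
  also have "\<dots> = (\<Sum>n. \<integral>\<^sup>+m. f m n \<partial>count_space UNIV)"
    by (rule nn_integral_suminf) simp
  finally show ?thesis by (simp add: nn_integral_count_space_nat)
qed

text \<open>Both sides are the sum of the squares of all matrix entries, taken by columns or by rows.\<close>

lemma hs_norm_adjoint:
  assumes "adjoint_pair T T'"
  shows "(hs_norm T)\<^sup>2 = (hs_norm T')\<^sup>2"
proof -
  have "cmod (Rep_ell2 (T (ket n)) m) = cmod (Rep_ell2 (T' (ket m)) n)" for m n
    using adjoint_pairD[OF assms, of "ket n" "ket m"] cinner_commute[of "ket n" "T' (ket m)"]
    by (metis cinner_ket complex_mod_cnj)
  then show ?thesis
    unfolding hs_norm_power2 ennreal_norm_ell2 by (subst ennreal_suminf_swap) simp
qed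

text \<open>The coordinates of \<open>T v\<close> are the scalar products of \<open>v\<close> with the vectors \<open>T\<^sup>* e\<^sub>n\<close>.\<close>

lemma norm_le_hs_norm:
  assumes "adjoint_pair T T'"
  shows "ennreal ((norm (T v))\<^sup>2) \<le> ennreal ((norm v)\<^sup>2) * (hs_norm T)\<^sup>2"
proof -
  have le: "(cmod (Rep_ell2 (T v) n))\<^sup>2 \<le> (norm v)\<^sup>2 * (norm (T' (ket n)))\<^sup>2" for n
    unfolding cinner_ket[symmetric] adjoint_pairD[OF assms] power_mult_distrib[symmetric]
    by (intro power_mono norm_cinner_le) simp
  have "ennreal ((norm (T v))\<^sup>2) \<le> (\<Sum>n. ennreal ((norm v)\<^sup>2 * (norm (T' (ket n)))\<^sup>2))"
    unfolding ennreal_norm_ell2 by (intro suminf_le ennreal_leI le summableI)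
  also have "\<dots> = ennreal ((norm v)\<^sup>2) * (hs_norm T)\<^sup>2"
    by (simp add: hs_norm_adjoint[OF assms] ennreal_mult) (simp add: hs_norm_power2)
  finally show ?thesis .
qed

text \<open>In the adjoint product \<open>Q\<^sup>* S\<^sup>*\<close> the bounded factor acts on each column separately.\<close>

lemma hs_norm_comp_le:
  assumes S: "adjoint_pair S S'" and Q: "adjoint_pair Q Q'"
    and bound: "\<And>v. norm (Q' v) \<le> q * norm v"
  shows "(hs_norm (S \<circ> Q))\<^sup>2 \<le> ennreal (q\<^sup>2) * (hs_norm S)\<^sup>2"
proof -
  have "(hs_norm (S \<circ> Q))\<^sup>2 = (hs_norm (Q' \<circ> S'))\<^sup>2"
    by (rule hs_norm_adjoint[OF adjoint_pair_comp[OF S Q]])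
  also have "\<dots> \<le> (\<Sum>n. ennreal (q\<^sup>2) * ennreal ((norm (S' (ket n)))\<^sup>2))"
    unfolding hs_norm_power2
  proof (intro suminf_le summableI)
    fix n
    have "(norm (Q' (S' (ket n))))\<^sup>2 \<le> (q * norm (S' (ket n)))\<^sup>2"
      by (intro power_mono bound) simp
    then show "ennreal ((norm ((Q' \<circ> S') (ket n)))\<^sup>2) \<le> ennreal (q\<^sup>2) * ennreal ((norm (S' (ket n)))\<^sup>2)"
      by (simp add: power_mult_distrib ennreal_leI flip: ennreal_mult)
  qed
  also have "\<dots> = ennreal (q\<^sup>2) * (hs_norm S)\<^sup>2"
    unfolding hs_norm_adjoint[OF S] by (simp add: hs_norm_power2)
  finally show ?thesis .
qed

lemma suminf_swap_complex:
  fixes X :: "nat \<Rightarrow> nat \<Rightarrow> complex"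
  assumes "(\<Sum>n. \<Sum>m. ennreal (cmod (X n m))) < \<infinity>"
  shows "(\<Sum>n. \<Sum>m. X n m) = (\<Sum>m. \<Sum>n. X n m)"
proof -
  interpret pair_sigma_finite "count_space (UNIV :: nat set)" "count_space (UNIV :: nat set)"
    by (intro pair_sigma_finite.intro sigma_finite_measure_count_space)
  have [measurable]: "g \<in> borel_measurable (count_space UNIV \<Otimes>\<^sub>M count_space UNIV)"
    for g :: "nat \<times> nat \<Rightarrow> complex"
    by (simp add: pair_measure_countable)
  let ?N = "count_space (UNIV :: nat set)"
  have fin: "integrable (?N \<Otimes>\<^sub>M ?N) (\<lambda>(n, m). X n m)"
    unfolding integrable_iff_bounded
  proof
    have "(\<integral>\<^sup>+p. ennreal (cmod (X (fst p) (snd p))) \<partial>(?N \<Otimes>\<^sub>M ?N))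
        = (\<Sum>n. \<Sum>m. ennreal (cmod (X n m)))"
      by (subst sigma_finite_measure.nn_integral_fst[OF sigma_finite_measure_count_space, symmetric])
        (simp_all add: nn_integral_count_space_nat pair_measure_countable)
    then show "(\<integral>\<^sup>+p. ennreal (norm (case p of (n, m) \<Rightarrow> X n m)) \<partial>(?N \<Otimes>\<^sub>M ?N)) < \<infinity>"
      using assms by (simp add: split_beta)
  qed measurable
  have row: "integrable ?N (X n)" for n
    using AE_integrable_fst'[OF fin] by (simp add: AE_count_space)
  have col: "integrable ?N (\<lambda>n. X n m)" for m
    using AE_integrable_snd[OF fin] by (simp add: AE_count_space)
  have "(\<Sum>n. \<Sum>m. X n m) = (LINT n|?N. LINT m|?N. X n m)"
    using integrable_fst[OF fin] row by (simp add: integral_count_space_nat)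
  also have "\<dots> = (LINT m|?N. LINT n|?N. X n m)"
    by (rule Fubini_integral[OF fin, symmetric])
  also have "\<dots> = (\<Sum>m. \<Sum>n. X n m)"
    using integrable_snd[OF fin] col by (simp add: integral_count_space_nat)
  finally show ?thesis .
qed

text \<open>
  The cyclic property of the trace. As \<open>S\<close> and \<open>S P\<^sup>* P\<close> are Hilbert--Schmidt operators, their
  matrix entries are square summable, so the double sum of their products may be taken by columns,
  which gives the trace, or by rows, which gives the norm.
\<close>

lemma op_trace_eq_hs_norm:
  assumes S: "adjoint_pair S S'" and P: "adjoint_pair P P'"
    and bound: "\<And>v. norm (P v) \<le> p * norm v" "\<And>v. norm (P' v) \<le> p * norm v"
    and p: "0 \<le> p" and fin: "(hs_norm S)\<^sup>2 < \<infinity>"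
  shows "op_trace (S' \<circ> S \<circ> P' \<circ> P) = complex_of_real (enn2real ((hs_norm (S \<circ> P'))\<^sup>2))"
    and "(hs_norm (S \<circ> P'))\<^sup>2 < \<infinity>"
proof -
  define Q where "Q = P' \<circ> P"
  have Q: "adjoint_pair Q Q"
    unfolding Q_def using adjoint_pair_comp[OF adjoint_pair_sym[OF P] P] .
  have Qb: "norm (Q v) \<le> p * p * norm v" for v
    using order_trans[OF bound(2)[of "P v"] mult_left_mono[OF bound(1)[of v] p]]
    by (simp add: Q_def mult.assoc)
  have finSP: "(hs_norm (S \<circ> P'))\<^sup>2 < \<infinity>"
    using hs_norm_comp_le[OF S adjoint_pair_sym[OF P] bound(1)] fin
    by (metis ennreal_mult_less_top ennreal_less_top infinity_ennreal_def le_less_trans)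
  then show "(hs_norm (S \<circ> P'))\<^sup>2 < \<infinity>" .
  have finSQ: "(hs_norm (S \<circ> Q))\<^sup>2 < \<infinity>"
    using hs_norm_comp_le[OF S Q Qb] fin
    by (metis ennreal_mult_less_top ennreal_less_top infinity_ennreal_def le_less_trans)
  define X where "X n m = Rep_ell2 (S (Q (ket n))) m * cnj (Rep_ell2 (S (ket n)) m)" for n m
  have Xalt: "X n m = Rep_ell2 (S' (ket m)) n * cnj (Rep_ell2 (Q (S' (ket m))) n)" for n m
  proof -
    have "Rep_ell2 (S (Q (ket n))) m = cnj (Rep_ell2 (Q (S' (ket m))) n)"
      by (metis Q S adjoint_pairD cinner_commute cinner_ket)
    moreover have "cnj (Rep_ell2 (S (ket n)) m) = Rep_ell2 (S' (ket m)) n"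
      by (metis S adjoint_pairD cinner_commute cinner_ket)
    ultimately show ?thesis by (simp add: X_def)
  qed
  have "ennreal (cmod (X n m)) \<le> ennreal ((cmod (Rep_ell2 (S (Q (ket n))) m))\<^sup>2)
      + ennreal ((cmod (Rep_ell2 (S (ket n)) m))\<^sup>2)" for n m
  proof -
    have "a * b \<le> a\<^sup>2 + b\<^sup>2" if "0 \<le> a" "0 \<le> b" for a b :: real
      using sum_squares_bound[of a b] mult_nonneg_nonneg[OF that] by linarith
    then show ?thesis
      by (simp add: X_def norm_mult ennreal_leI flip: ennreal_plus)
  qed
  then have "(\<Sum>n. \<Sum>m. ennreal (cmod (X n m))) \<le>
      (\<Sum>n. \<Sum>m. ennreal ((cmod (Rep_ell2 (S (Q (ket n))) m))\<^sup>2)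
        + ennreal ((cmod (Rep_ell2 (S (ket n)) m))\<^sup>2))"
    by (intro suminf_le summableI) auto
  also have "\<dots> = (hs_norm (S \<circ> Q))\<^sup>2 + (hs_norm S)\<^sup>2"
    by (simp add: hs_norm_power2 ennreal_norm_ell2 suminf_add[symmetric] summableI)
  also have "\<dots> < \<infinity>" using fin finSQ by simp
  finally have swap: "(\<Sum>n. \<Sum>m. X n m) = (\<Sum>m. \<Sum>n. X n m)" by (rule suminf_swap_complex)
  have norms: "cinner (S' (ket m)) (Q (S' (ket m))) = complex_of_real ((norm (P (S' (ket m))))\<^sup>2)" for m
    by (metis P Q_def adjoint_pairD cinner_self comp_apply)
  have hs: "(hs_norm (S \<circ> P'))\<^sup>2 = (\<Sum>m. ennreal ((norm (P (S' (ket m))))\<^sup>2))"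
    using hs_norm_adjoint[OF adjoint_pair_comp[OF S adjoint_pair_sym[OF P]]]
    by (simp add: hs_norm_power2)
  then have summ: "summable (\<lambda>m. (norm (P (S' (ket m))))\<^sup>2)"
    using finSP by (intro summable_suminf_not_top) auto
  have "op_trace (S' \<circ> S \<circ> P' \<circ> P) = (\<Sum>n. cinner (S' (S (Q (ket n)))) (ket n))"
    by (simp add: op_trace_def Q_def)
  also have "\<dots> = (\<Sum>n. \<Sum>m. X n m)"
    by (simp add: adjoint_pairD[OF adjoint_pair_sym[OF S]]) (simp add: cinner_def X_def)
  also have "\<dots> = (\<Sum>m. cinner (S' (ket m)) (Q (S' (ket m))))"
    unfolding swap by (simp add: Xalt cinner_def)
  also have "\<dots> = complex_of_real (\<Sum>m. (norm (P (S' (ket m))))\<^sup>2)"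
    unfolding norms by (rule suminf_of_real[symmetric, OF summ])
  also have "(\<Sum>m. (norm (P (S' (ket m))))\<^sup>2) = enn2real ((hs_norm (S \<circ> P'))\<^sup>2)"
    unfolding hs by (subst suminf_ennreal2) (auto intro: summ simp: suminf_nonneg[OF summ])
  finally show "op_trace (S' \<circ> S \<circ> P' \<circ> P) = complex_of_real (enn2real ((hs_norm (S \<circ> P'))\<^sup>2))" .
qed

lemma op_trace_adjoint_comp:
  assumes S: "adjoint_pair S S'" and fin: "(hs_norm S)\<^sup>2 < \<infinity>"
  shows "op_trace (S' \<circ> S) = complex_of_real (enn2real ((hs_norm S)\<^sup>2))"
proof -
  have id: "adjoint_pair (\<lambda>v. v) (\<lambda>v. v)" by (simp add: adjoint_pair_def)
  show ?thesis
    using op_trace_eq_hs_norm(1)[OF S id, of 1] fin by (simp add: comp_def)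
qed

section \<open>Heisenberg's inequality by difference quotients\<close>

lemma heisenberg_pointwise:
  fixes a b :: complex and t s m :: real
  assumes s: "0 < s" and m: "0 < m"
  shows "t * ((cmod a)\<^sup>2 - (cmod b)\<^sup>2) \<le> m / s * (cmod (b - a))\<^sup>2
    + s / (2 * m) * (t\<^sup>2 * (cmod a)\<^sup>2) + s / (2 * m) * ((t + s)\<^sup>2 * (cmod b)\<^sup>2)
    + ((cmod (b - a))\<^sup>2 + s\<^sup>2 * (cmod b)\<^sup>2) / 2"
proof -
  define A B D where "A = cmod a" "B = cmod b" "D = cmod (b - a)"
  have nonneg: "0 \<le> A" "0 \<le> B" "0 \<le> D" by (simp_all add: A_B_D_def)
  have amgm: "D * y \<le> m / (2 * s) * D\<^sup>2 + s / (2 * m) * y\<^sup>2" for y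
  proof -
    have "0 \<le> (m * D - s * y)\<^sup>2 / (2 * m * s)" using s m by simp
    also have "\<dots> = m / (2 * s) * D\<^sup>2 + s / (2 * m) * y\<^sup>2 - D * y"
      using s m by (simp add: power2_diff power2_eq_square field_simps)
    finally show ?thesis by simp
  qed
  have amgm1: "D * (s * B) \<le> (D\<^sup>2 + s\<^sup>2 * B\<^sup>2) / 2"
    using sum_squares_bound[of D "s * B"] by (simp add: power_mult_distrib field_simps)
  have "\<bar>A - B\<bar> \<le> D"
    unfolding A_B_D_def using norm_triangle_ineq3[of a b] by (simp add: norm_minus_commute)
  then have "\<bar>t\<bar> * \<bar>A - B\<bar> * (A + B) \<le> \<bar>t\<bar> * D * (A + B)"
    using nonneg by (intro mult_right_mono mult_left_mono) auto
  moreover have "t * (A\<^sup>2 - B\<^sup>2) \<le> \<bar>t * (A\<^sup>2 - B\<^sup>2)\<bar>" by simp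
  moreover have "\<bar>t * (A\<^sup>2 - B\<^sup>2)\<bar> = \<bar>t\<bar> * \<bar>A - B\<bar> * (A + B)"
    using nonneg by (simp add: abs_mult power2_eq_square square_diff_square_factored)
  ultimately have "t * (A\<^sup>2 - B\<^sup>2) \<le> D * (\<bar>t\<bar> * A) + D * (\<bar>t\<bar> * B)"
    by (simp add: algebra_simps)
  also have "D * (\<bar>t\<bar> * B) \<le> D * (\<bar>t + s\<bar> * B + s * B)"
  proof -
    have "\<bar>t\<bar> \<le> \<bar>t + s\<bar> + s" using s by linarith
    then have "\<bar>t\<bar> * B \<le> (\<bar>t + s\<bar> + s) * B" using nonneg by (intro mult_right_mono)
    then show ?thesis using nonneg by (intro mult_left_mono) (simp_all add: algebra_simps)
  qed
  finally have "t * (A\<^sup>2 - B\<^sup>2) \<le> D * (\<bar>t\<bar> * A) + D * (\<bar>t + s\<bar> * B) + D * (s * B)"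
    by (simp add: algebra_simps)
  also have "\<dots> \<le> m / s * D\<^sup>2 + s / (2 * m) * (t\<^sup>2 * A\<^sup>2) + s / (2 * m) * ((t + s)\<^sup>2 * B\<^sup>2)
      + (D\<^sup>2 + s\<^sup>2 * B\<^sup>2) / 2"
  proof -
    have half: "m / s * D\<^sup>2 = m / (2 * s) * D\<^sup>2 + m / (2 * s) * D\<^sup>2"
      using s by (simp add: field_simps)
    have "D * (\<bar>t\<bar> * A) + D * (\<bar>t + s\<bar> * B) + D * (s * B)
        \<le> (m / (2 * s) * D\<^sup>2 + s / (2 * m) * (\<bar>t\<bar> * A)\<^sup>2)
          + (m / (2 * s) * D\<^sup>2 + s / (2 * m) * (\<bar>t + s\<bar> * B)\<^sup>2) + (D\<^sup>2 + s\<^sup>2 * B\<^sup>2) / 2"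
      by (intro add_mono amgm amgm1)
    then show ?thesis
      unfolding half power_mult_distrib power2_abs by (simp only: ac_simps)
  qed
  finally show ?thesis by (simp add: A_B_D_def)
qed

lemma distr_shift_snd:
  fixes s :: real
  shows "distr (N \<Otimes>\<^sub>M lborel) (N \<Otimes>\<^sub>M lborel) (\<lambda>p. (fst p, snd p + s)) = N \<Otimes>\<^sub>M lborel"
proof -
  have eq: "distr lborel lborel (\<lambda>t. t + s) = lborel"
    using lborel_distr_plus[of s] by (simp add: add.commute cong: distr_cong)
  have "distr N N (\<lambda>x. x) \<Otimes>\<^sub>M distr lborel lborel (\<lambda>t. t + s)
      = distr (N \<Otimes>\<^sub>M lborel) (N \<Otimes>\<^sub>M lborel) (\<lambda>(x, t). (x, t + s))"
    by (rule pair_measure_distr) (simp_all add: eq lborel.sigma_finite_measure_axioms)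
  moreover have "(\<lambda>p. (fst p, snd p + s)) = (\<lambda>(x :: 'a, t). (x, t + s))"
    by (simp add: fun_eq_iff)
  ultimately show ?thesis by (simp only: eq distr_id)
qed

text \<open>
  With \<open>I = \<integral>|H|\<^sup>2\<close>, translation invariance gives
  \<open>s I = \<integral> t (|H(x, t)|\<^sup>2 - |H(x, t + s)|\<^sup>2)\<close>, and the integrand is at most
  \<open>|t| |H(x, t + s) - H(x, t)| (|H(x, t)| + |H(x, t + s)|)\<close>. This replaces the integration by parts
  of the usual argument, so that \<open>H\<close> need not be differentiable; the arithmetic--geometric mean with
  the weight \<open>m\<close> replaces the Cauchy--Schwarz inequality. Division by \<open>s\<close> and \<open>s \<rightarrow> 0\<close> finish the
  proof.
\<close>

lemma heisenberg_difference:
  fixes H :: "'x \<times> real \<Rightarrow> complex"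
  assumes H[measurable]: "H \<in> borel_measurable (N \<Otimes>\<^sub>M lborel)"
    and fin: "integrable (N \<Otimes>\<^sub>M lborel) (\<lambda>p. (cmod (H p))\<^sup>2)"
    and T: "(\<integral>\<^sup>+p. ennreal ((snd p)\<^sup>2 * (cmod (H p))\<^sup>2) \<partial>(N \<Otimes>\<^sub>M lborel)) \<le> ennreal T"
    and K: "\<And>s. 0 < s \<Longrightarrow> (\<integral>\<^sup>+p. ennreal ((cmod (H (fst p, snd p + s) - H p))\<^sup>2) \<partial>(N \<Otimes>\<^sub>M lborel))
        \<le> ennreal (s\<^sup>2 * K)"
    and nonneg: "0 \<le> T" "0 \<le> K" and m: "0 < m"
  shows "(LINT p|(N \<Otimes>\<^sub>M lborel). (cmod (H p))\<^sup>2) \<le> m * K + T / m"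
proof -
  let ?P = "N \<Otimes>\<^sub>M (lborel :: real measure)"
  define I where "I = (LINT p|?P. (cmod (H p))\<^sup>2)"
  have intT: "integrable ?P (\<lambda>p. (snd p)\<^sup>2 * (cmod (H p))\<^sup>2)"
    using T by (intro integrableI_bounded) (auto simp: le_less_trans[OF _ ennreal_less_top])
  have leT: "(LINT p|?P. (snd p)\<^sup>2 * (cmod (H p))\<^sup>2) \<le> T"
    using T nonneg by (subst (asm) nn_integral_eq_integral[OF intT]) auto
  have int1: "integrable ?P (\<lambda>p. snd p * (cmod (H p))\<^sup>2)"
  proof (rule Bochner_Integration.integrable_bound[OF Bochner_Integration.integrable_add[OF fin intT]])
    have "\<bar>t\<bar> \<le> 1 + t\<^sup>2" for t :: real
      using sum_squares_bound[of 1 "\<bar>t\<bar>"] abs_ge_zero[of t] by (simp only: power2_abs) auto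
    then have "\<bar>t\<bar> * r \<le> r + t\<^sup>2 * r" if "0 \<le> r" for t r :: real
      using mult_right_mono[of "\<bar>t\<bar>" "1 + t\<^sup>2" r] that by (simp add: algebra_simps)
    then show "AE p in ?P. norm (snd p * (cmod (H p))\<^sup>2)
        \<le> norm ((cmod (H p))\<^sup>2 + (snd p)\<^sup>2 * (cmod (H p))\<^sup>2)"
      by (auto simp: abs_mult)
  qed measurable
  have "I \<le> m * K + T / m + s * ((K + I) / 2)" if s: "0 < s" for s
  proof -
    let ?S = "\<lambda>p. (fst p, snd p + s :: real)"
    have S[measurable]: "?S \<in> ?P \<rightarrow>\<^sub>M ?P" by measurable
    have Sint: "integrable ?P (\<lambda>p. g (?S p))" "(LINT p|?P. g (?S p)) = (LINT p|?P. g p)"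
      if "integrable ?P g" for g :: "'x \<times> real \<Rightarrow> real"
      using integrable_distr_eq[OF S, of g] integral_distr[OF S, of g] that
        borel_measurable_integrable[OF that] by (simp_all add: distr_shift_snd)
    define D where "D p = (cmod (H (?S p) - H p))\<^sup>2" for p
    have [measurable]: "D \<in> borel_measurable ?P" unfolding D_def by measurable
    have intD: "integrable ?P D"
      using K[OF s] by (intro integrableI_bounded)
        (auto simp: D_def le_less_trans[OF _ ennreal_less_top])
    have leD: "(LINT p|?P. D p) \<le> s\<^sup>2 * K"
    proof -
      have D0: "0 \<le> D p" for p by (simp add: D_def)
      show ?thesis
        using K[OF s] nonneg unfolding D_def[symmetric]
        by (subst (asm) nn_integral_eq_integral[OF intD]) (auto simp: D0)
    qed
    have i1: "integrable ?P (\<lambda>p. (cmod (H (?S p)))\<^sup>2)"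
      and e1: "(LINT p|?P. (cmod (H (?S p)))\<^sup>2) = I"
      using Sint[OF fin] by (simp_all add: I_def)
    have i2: "integrable ?P (\<lambda>p. (snd p + s)\<^sup>2 * (cmod (H (?S p)))\<^sup>2)"
      and e2: "(LINT p|?P. (snd p + s)\<^sup>2 * (cmod (H (?S p)))\<^sup>2) \<le> T"
      using Sint[OF intT] leT by simp_all
    have i3: "integrable ?P (\<lambda>p. (snd p + s) * (cmod (H (?S p)))\<^sup>2)"
      and e3: "(LINT p|?P. (snd p + s) * (cmod (H (?S p)))\<^sup>2) = (LINT p|?P. snd p * (cmod (H p))\<^sup>2)"
      using Sint[OF int1] by simp_all
    have i4: "integrable ?P (\<lambda>p. snd p * (cmod (H (?S p)))\<^sup>2)"
    proof -
      have "integrable ?P (\<lambda>p. (snd p + s) * (cmod (H (?S p)))\<^sup>2 - s * (cmod (H (?S p)))\<^sup>2)"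
        using i3 i1 by (intro Bochner_Integration.integrable_diff integrable_mult_right)
      then show ?thesis by (simp add: algebra_simps)
    qed
    have "(LINT p|?P. snd p * (cmod (H (?S p)))\<^sup>2)
        = (LINT p|?P. (snd p + s) * (cmod (H (?S p)))\<^sup>2 - s * (cmod (H (?S p)))\<^sup>2)"
      by (simp add: algebra_simps)
    also have "\<dots> = (LINT p|?P. snd p * (cmod (H p))\<^sup>2) - s * I"
      using i3 i1 by (simp add: e1 e3)
    finally have "s * I = (LINT p|?P. snd p * (cmod (H p))\<^sup>2 - snd p * (cmod (H (?S p)))\<^sup>2)"
      using int1 i4 by simp
    also have "\<dots> \<le> (LINT p|?P. m / s * D p + s / (2 * m) * ((snd p)\<^sup>2 * (cmod (H p))\<^sup>2)
        + s / (2 * m) * ((snd p + s)\<^sup>2 * (cmod (H (?S p)))\<^sup>2)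
        + (D p + s\<^sup>2 * (cmod (H (?S p)))\<^sup>2) / 2)"
    proof (rule integral_mono)
      show "integrable ?P (\<lambda>p. snd p * (cmod (H p))\<^sup>2 - snd p * (cmod (H (?S p)))\<^sup>2)"
        using int1 i4 by (rule Bochner_Integration.integrable_diff)
      show "integrable ?P (\<lambda>p. m / s * D p + s / (2 * m) * ((snd p)\<^sup>2 * (cmod (H p))\<^sup>2)
        + s / (2 * m) * ((snd p + s)\<^sup>2 * (cmod (H (?S p)))\<^sup>2)
        + (D p + s\<^sup>2 * (cmod (H (?S p)))\<^sup>2) / 2)"
        using intD intT i1 i2
        by (intro Bochner_Integration.integrable_add integrable_mult_right integrable_divide)
    next
      fix p
      show "snd p * (cmod (H p))\<^sup>2 - snd p * (cmod (H (?S p)))\<^sup>2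
        \<le> m / s * D p + s / (2 * m) * ((snd p)\<^sup>2 * (cmod (H p))\<^sup>2)
        + s / (2 * m) * ((snd p + s)\<^sup>2 * (cmod (H (?S p)))\<^sup>2)
        + (D p + s\<^sup>2 * (cmod (H (?S p)))\<^sup>2) / 2"
        using heisenberg_pointwise[OF s m, of "snd p" "H p" "H (?S p)"]
        unfolding D_def right_diff_distrib .
    qed
    also have "\<dots> = m / s * (LINT p|?P. D p) + s / (2 * m) * (LINT p|?P. (snd p)\<^sup>2 * (cmod (H p))\<^sup>2)
        + s / (2 * m) * (LINT p|?P. (snd p + s)\<^sup>2 * (cmod (H (?S p)))\<^sup>2)
        + ((LINT p|?P. D p) + s\<^sup>2 * I) / 2"
      using intD intT i1 i2 by (simp add: e1)
    also have "\<dots> \<le> m / s * (s\<^sup>2 * K) + s / (2 * m) * T + s / (2 * m) * T + (s\<^sup>2 * K + s\<^sup>2 * I) / 2"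
      using leD leT e2 s m by (intro add_mono mult_left_mono divide_right_mono) auto
    also have "\<dots> = s * (m * K + T / m + s * ((K + I) / 2))"
      using s m by (simp add: field_simps power2_eq_square)
    finally show ?thesis using s by simp
  qed
  note bound = this
  have "I \<le> m * K + T / m + e" if e: "0 < e" for e
  proof -
    have I: "0 \<le> I" by (simp add: I_def)
    define J where "J = (K + I) / 2"
    have J: "0 \<le> J" unfolding J_def using nonneg I by simp
    define s where "s = e / (J + 1)"
    have s: "0 < s" unfolding s_def using e J by simp
    have "s * J \<le> s * (J + 1)" using s by (intro mult_left_mono) auto
    also have "\<dots> = e" unfolding s_def using J by simp
    finally show ?thesis using bound[OF s] by (simp add: J_def)
  qed
  then show ?thesis unfolding I_def by (rule field_le_epsilon)
qed

section \<open>Haar measures\<close>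

text \<open>By Lindelof's theorem countably many relatively compact open sets cover the group.\<close>

lemma sigma_finite_haar_measure:
  fixes M :: "'g::{topological_group_add, second_countable_topology, t2_space} measure"
  assumes "locally compact (UNIV :: 'g set)" and M: "haar_measure M"
  shows "sigma_finite_measure M"
proof -
  define F where "F = {U :: 'g set. open U \<and> (\<exists>K. compact K \<and> U \<subseteq> K)}"
  have cover: "\<Union>F = UNIV"
  proof -
    have "\<exists>U\<in>F. x \<in> U" for x :: 'g
    proof -
      obtain U K where "open U" "compact K" "x \<in> U" "U \<subseteq> K"
        using assms(1) unfolding locally_def by (auto dest!: spec[of _ UNIV]) metis
      then show ?thesis unfolding F_def by blast
    qed
    then show ?thesis by blast
  qed
  obtain F' where F': "F' \<subseteq> F" "countable F'" "\<Union>F' = \<Union>F"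
    by (rule Lindelof[of F]) (auto simp: F_def)
  show ?thesis
  proof
    show "\<exists>A. countable A \<and> A \<subseteq> sets M \<and> \<Union>A = space M \<and> (\<forall>a\<in>A. emeasure M a \<noteq> \<infinity>)"
    proof (intro exI[of _ F'] conjI ballI)
      have sets: "sets M = sets borel" using M by (simp add: haar_measure_def)
      show "F' \<subseteq> sets M" using F'(1) by (auto simp: sets F_def)
      show "\<Union>F' = space M" using F'(3) cover sets_eq_imp_space_eq[OF sets] by simp
      fix U assume "U \<in> F'"
      then obtain K where K: "open U" "compact K" "U \<subseteq> K" using F'(1) by (auto simp: F_def)
      have "emeasure M U \<le> emeasure M K"
        using K by (intro emeasure_mono) (auto simp: sets compact_imp_closed)
      also have "\<dots> < \<infinity>" using M K by (simp add: haar_measure_def)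
      finally show "emeasure M U \<noteq> \<infinity>" by simp
    qed (use F' in auto)
  qed
qed

lemma measurable_group_uminus[measurable (raw)]:
  fixes f :: "'x \<Rightarrow> 'g::{topological_group_add, second_countable_topology}"
  assumes "f \<in> borel_measurable M"
  shows "(\<lambda>x. - f x) \<in> borel_measurable M"
  by (rule borel_measurable_continuous_on[OF _ assms, of uminus]) (intro continuous_intros)

lemma distr_haar_plus:
  fixes M :: "'g::{topological_group_add, second_countable_topology} measure"
  assumes M: "haar_measure M"
  shows "distr M M ((+) g) = M"
proof (rule measure_eqI)
  have sets[measurable_cong]: "sets M = sets borel" using M by (simp add: haar_measure_def)
  have meas: "(+) g \<in> M \<rightarrow>\<^sub>M M" by measurable
  fix E assume E: "E \<in> sets (distr M M ((+) g))"
  have "(+) g -` E \<inter> space M = (+) (- g) ` E"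
  proof (intro equalityI subsetI)
    fix x assume "x \<in> (+) g -` E \<inter> space M"
    then show "x \<in> (+) (- g) ` E" by (intro image_eqI[of _ _ "g + x"]) (auto simp: add.assoc[symmetric])
  qed (auto simp: add.assoc[symmetric] sets_eq_imp_space_eq[OF sets])
  then show "emeasure (distr M M ((+) g)) E = emeasure M E"
    using E M by (simp add: emeasure_distr[OF meas] haar_measure_def)
qed simp

locale compact_group_times_real =
  fixes \<mu> :: "'l::{topological_group_add, second_countable_topology, t2_space} measure"
  assumes compact_L: "compact (UNIV :: 'l set)" and haar: "haar_measure \<mu>"
begin

abbreviation M :: "('l \<times> real) measure" where
  "M \<equiv> haar_A \<mu>"

lemma sets_mu[measurable_cong]: "sets \<mu> = sets borel"
  using haar by (simp add: haar_measure_def)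

lemma space_mu: "space \<mu> = UNIV"
  using sets_eq_imp_space_eq[OF sets_mu] by simp

lemma emeasure_mu_UNIV: "emeasure \<mu> UNIV < \<infinity>" "0 < emeasure \<mu> UNIV"
  using haar compact_L by (simp_all add: haar_measure_def)

sublocale mu: finite_measure \<mu>
  by standard (use emeasure_mu_UNIV in \<open>simp add: space_mu less_top\<close>)

sublocale A: pair_sigma_finite \<mu> lborel
  by (intro pair_sigma_finite.intro mu.sigma_finite_measure_axioms lborel.sigma_finite_measure_axioms)

lemma sets_M: "sets M = sets borel"
  unfolding borel_prod[symmetric] by (intro sets_pair_measure_cong sets_mu) simp

lemma space_M[simp]: "space M = UNIV"
  by (simp add: space_pair_measure space_mu)

lemma measurable_M: "measurable M N = measurable borel N" "measurable N' M = measurable N' borel"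
  by (rule measurable_cong_sets[OF sets_M refl], rule measurable_cong_sets[OF refl sets_M])

lemma measurable_borel_comp_plus[measurable]: "(+) a \<in> M \<rightarrow>\<^sub>M M"
  unfolding measurable_M by measurable

lemma measurable_borel_comp_uminus[measurable]: "uminus \<in> M \<rightarrow>\<^sub>M M"
  unfolding measurable_M by measurable

text \<open>
  By left invariance and Fubini, \<open>\<integral>\<integral> g(- x + y) dx dy\<close> is both \<open>\<mu>(L) \<integral> g\<close> and
  \<open>\<mu>(L) \<integral> g(- x) dx\<close>.
\<close>

lemma distr_mu_uminus: "distr \<mu> \<mu> uminus = \<mu>"
proof (rule measure_eqI)
  have meas: "uminus \<in> \<mu> \<rightarrow>\<^sub>M \<mu>" by measurable
  have left: "(\<integral>\<^sup>+y. g (x + y) \<partial>\<mu>) = (\<integral>\<^sup>+y. g y \<partial>\<mu>)" if "g \<in> borel_measurable borel" for g x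
    using nn_integral_distr[of "(+) x" \<mu> \<mu> g] that by (simp add: distr_haar_plus[OF haar])
  fix E assume "E \<in> sets (distr \<mu> \<mu> uminus)"
  then have E[measurable]: "E \<in> sets borel" by (simp add: sets_mu)
  define g :: "'l \<Rightarrow> ennreal" where "g = indicator E"
  have [measurable]: "g \<in> borel_measurable borel" unfolding g_def by measurable
  interpret pair_sigma_finite \<mu> \<mu>
    by (intro pair_sigma_finite.intro mu.sigma_finite_measure_axioms)
  have swap: "(\<integral>\<^sup>+y. \<integral>\<^sup>+x. g (- x + y) \<partial>\<mu> \<partial>\<mu>) = (\<integral>\<^sup>+x. \<integral>\<^sup>+y. g (- x + y) \<partial>\<mu> \<partial>\<mu>)"
    by (rule Fubini') measurable
  have "(\<integral>\<^sup>+x. \<integral>\<^sup>+y. g (- x + y) \<partial>\<mu> \<partial>\<mu>) = emeasure \<mu> UNIV * (\<integral>\<^sup>+y. g y \<partial>\<mu>)"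
    by (simp add: left space_mu mult.commute)
  moreover have "(\<integral>\<^sup>+x. g (- x + y) \<partial>\<mu>) = (\<integral>\<^sup>+x. g (- x) \<partial>\<mu>)" for y
    using left[of "\<lambda>z. g (- z)" "- y"] by (simp add: minus_add)
  then have "(\<integral>\<^sup>+y. \<integral>\<^sup>+x. g (- x + y) \<partial>\<mu> \<partial>\<mu>) = emeasure \<mu> UNIV * (\<integral>\<^sup>+x. g (- x) \<partial>\<mu>)"
    by (simp add: space_mu mult.commute)
  ultimately have "emeasure \<mu> UNIV * (\<integral>\<^sup>+x. g (- x) \<partial>\<mu>) = emeasure \<mu> UNIV * (\<integral>\<^sup>+y. g y \<partial>\<mu>)"
    using swap by simp
  then have "(\<integral>\<^sup>+x. g (- x) \<partial>\<mu>) = (\<integral>\<^sup>+y. g y \<partial>\<mu>)"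
    using emeasure_mu_UNIV by (auto simp: ennreal_mult_cancel_left)
  moreover have "(\<integral>\<^sup>+x. g (- x) \<partial>\<mu>) = (\<integral>\<^sup>+x. g x \<partial>distr \<mu> \<mu> uminus)"
    by (rule nn_integral_distr[symmetric]) measurable
  ultimately show "emeasure (distr \<mu> \<mu> uminus) E = emeasure \<mu> E"
    by (simp add: g_def sets_mu)
qed simp

lemma distr_M_plus: "distr M M ((+) a) = M"
proof -
  have eq: "distr lborel lborel ((+) (snd a)) = (lborel :: real measure)"
    using lborel_distr_plus[of "snd a"] by (simp cong: distr_cong)
  have "distr \<mu> \<mu> ((+) (fst a)) \<Otimes>\<^sub>M distr lborel lborel ((+) (snd a))
      = distr M M (\<lambda>(x, t). (fst a + x, snd a + t))"
    by (rule pair_measure_distr) (simp_all add: eq lborel.sigma_finite_measure_axioms)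
  moreover have "(+) a = (\<lambda>(x, t). (fst a + x, snd a + t))"
    by (auto simp: fun_eq_iff plus_prod_def)
  ultimately show ?thesis by (simp only: eq distr_haar_plus[OF haar])
qed

lemma distr_M_uminus: "distr M M uminus = M"
proof -
  have eq: "distr lborel lborel uminus = (lborel :: real measure)"
    using lborel_distr_uminus by (simp cong: distr_cong)
  have "distr \<mu> \<mu> uminus \<Otimes>\<^sub>M distr lborel lborel uminus = distr M M (\<lambda>(x, t). (- x, - t))"
    by (rule pair_measure_distr) (simp_all add: eq lborel.sigma_finite_measure_axioms)
  moreover have "uminus = (\<lambda>(x :: 'l, t :: real). (- x, - t))"
    by (auto simp: fun_eq_iff uminus_prod_def)
  ultimately show ?thesis by (simp only: eq distr_mu_uminus)
qed

end

section \<open>Square integrable functions\<close>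

lemma L2_measurable[measurable_dest]: "f \<in> L2 M \<Longrightarrow> f \<in> borel_measurable M"
  by (simp add: L2_def)

lemma L1_L2_measurable[measurable_dest]: "f \<in> L1_L2 M \<Longrightarrow> f \<in> borel_measurable M"
  by (simp add: L1_L2_def L2_def)

lemma measurable_cnj[measurable (raw)]:
  "f \<in> borel_measurable M \<Longrightarrow> (\<lambda>x. cnj (f x)) \<in> borel_measurable M"
  by (rule borel_measurable_continuous_on[of cnj]) (intro continuous_intros)

lemma L1_L2_D: "f \<in> L1_L2 M \<Longrightarrow> f \<in> L2 M" "f \<in> L1_L2 M \<Longrightarrow> integrable M f"
  by (simp_all add: L1_L2_def)

lemma L2_iff: "f \<in> L2 M \<longleftrightarrow> f \<in> borel_measurable M \<and> (\<integral>\<^sup>+x. ennreal ((cmod (f x))\<^sup>2) \<partial>M) < \<infinity>"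
  by (auto simp: L2_def integrable_iff_bounded)

lemma L2_nn_integral:
  "f \<in> L2 M \<Longrightarrow> (\<integral>\<^sup>+x. ennreal ((cmod (f x))\<^sup>2) \<partial>M) = ennreal (LINT x|M. (cmod (f x))\<^sup>2)"
  by (rule nn_integral_eq_integral) (auto simp: L2_def)

lemma L2_diff:
  assumes f: "f \<in> L2 M" and g: "g \<in> L2 M"
  shows "(\<lambda>x. f x - g x) \<in> L2 M"
  unfolding L2_def
proof safe
  have "integrable M (\<lambda>x. 2 * (cmod (f x))\<^sup>2 + 2 * (cmod (g x))\<^sup>2)"
    using f g by (simp add: L2_def)
  then show "integrable M (\<lambda>x. (cmod (f x - g x))\<^sup>2)"
  proof (rule Bochner_Integration.integrable_bound)
    show "AE x in M. norm ((cmod (f x - g x))\<^sup>2) \<le> norm (2 * (cmod (f x))\<^sup>2 + 2 * (cmod (g x))\<^sup>2)"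
      using sq_sum_le[of "f _" "- g _"] by simp
  qed (use f g in measurable)
qed (use f g in measurable)

lemma L1_L2_diff: "f \<in> L1_L2 M \<Longrightarrow> g \<in> L1_L2 M \<Longrightarrow> (\<lambda>x. f x - g x) \<in> L1_L2 M"
  by (simp add: L1_L2_def L2_diff)

lemma cmod_mult_cnj_le: "cmod (a * cnj b) \<le> (cmod a)\<^sup>2 + (cmod b)\<^sup>2"
proof -
  have "0 \<le> cmod a * cmod b" by simp
  then show ?thesis
    using sum_squares_bound[of "cmod a" "cmod b"] unfolding norm_mult complex_mod_cnj by linarith
qed

lemma L2_integrable_mult:
  assumes f: "f \<in> L2 M" and g: "g \<in> L2 M"
  shows "integrable M (\<lambda>x. f x * cnj (g x))"
    and "cmod (LINT x|M. f x * cnj (g x)) \<le> (LINT x|M. (cmod (f x))\<^sup>2) + (LINT x|M. (cmod (g x))\<^sup>2)"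
proof -
  have int: "integrable M (\<lambda>x. (cmod (f x))\<^sup>2 + (cmod (g x))\<^sup>2)"
    using f g by (simp add: L2_def)
  then show *: "integrable M (\<lambda>x. f x * cnj (g x))"
    by (rule Bochner_Integration.integrable_bound)
      (use f g cmod_mult_cnj_le in \<open>auto simp: L2_def intro!: AE_I2 borel_measurable_times
        measurable_cnj\<close>)
  have "cmod (LINT x|M. f x * cnj (g x)) \<le> (LINT x|M. (cmod (f x))\<^sup>2 + (cmod (g x))\<^sup>2)"
    by (rule order_trans[OF integral_norm_bound integral_mono[OF integrable_norm[OF *] int]])
      (rule cmod_mult_cnj_le)
  then show "cmod (LINT x|M. f x * cnj (g x))
      \<le> (LINT x|M. (cmod (f x))\<^sup>2) + (LINT x|M. (cmod (g x))\<^sup>2)"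
    using f g by (simp add: L2_def)
qed

text \<open>Minkowski's inequality in a form that needs no square roots and is sharp as \<open>e \<rightarrow> 0\<close>.\<close>

lemma norm_add_power2_le:
  fixes x y :: "'v::real_normed_vector"
  assumes "0 < e"
  shows "(norm (x + y))\<^sup>2 \<le> (1 + e) * (norm x)\<^sup>2 + (1 + 1 / e) * (norm y)\<^sup>2"
proof -
  have "(norm (x + y))\<^sup>2 \<le> (norm x + norm y)\<^sup>2"
    by (intro power_mono norm_triangle_ineq) simp
  moreover have "0 \<le> (e * norm x - norm y)\<^sup>2 / e" using assms by simp
  then have "2 * norm x * norm y \<le> e * (norm x)\<^sup>2 + (norm y)\<^sup>2 / e"
    using assms by (simp add: power2_diff power2_eq_square field_simps)
  ultimately show ?thesis by (simp add: power2_sum algebra_simps)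
qed

lemma ennreal_norm_add_power2_le:
  fixes x y :: "'v::real_normed_vector"
  assumes "0 < e"
  shows "ennreal ((norm (x + y))\<^sup>2)
    \<le> ennreal (1 + e) * ennreal ((norm x)\<^sup>2) + ennreal (1 + 1 / e) * ennreal ((norm y)\<^sup>2)"
  using ennreal_leI[OF norm_add_power2_le[OF assms, of x y]] assms
  by (simp add: ennreal_plus ennreal_mult)

lemma hs_norm_add_power2_le:
  assumes "0 < e"
  shows "(hs_norm (\<lambda>v. S v + T v))\<^sup>2
    \<le> ennreal (1 + e) * (hs_norm S)\<^sup>2 + ennreal (1 + 1 / e) * (hs_norm T)\<^sup>2"
proof -
  have "(hs_norm (\<lambda>v. S v + T v))\<^sup>2 \<le> (\<Sum>n. ennreal (1 + e) * ennreal ((norm (S (ket n)))\<^sup>2)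
      + ennreal (1 + 1 / e) * ennreal ((norm (T (ket n)))\<^sup>2))"
    unfolding hs_norm_power2 by (intro suminf_le summableI ennreal_norm_add_power2_le assms)
  then show ?thesis by (simp add: hs_norm_power2 suminf_add[symmetric] summableI)
qed

text \<open>
  The limit argument for such bounds: \<open>X n\<close> is the squared norm of a perturbation of a vector whose
  squared norm is \<open>Y\<close>, and \<open>d n\<close> is the squared norm of the error.
\<close>

lemma le_of_perturbed_bounds:
  fixes Y :: ennreal and d :: "nat \<Rightarrow> ennreal"
  assumes bound: "\<And>e n. 0 < e \<Longrightarrow> X n \<le> ennreal (1 + e) * Y + ennreal (1 + 1 / e) * d n"
    and d: "d \<longlonglongrightarrow> 0"
  shows "liminf X \<le> Y"
proof (cases Y)
  case (real y)
  have le: "liminf X \<le> ennreal (1 + e) * Y" if e: "0 < e" for e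
  proof -
    have "(\<lambda>n. ennreal (1 + e) * Y + ennreal (1 + 1 / e) * d n)
        \<longlonglongrightarrow> ennreal (1 + e) * Y + ennreal (1 + 1 / e) * 0"
      by (intro tendsto_add tendsto_const ennreal_tendsto_cmult d) simp
    then have "liminf (\<lambda>n. ennreal (1 + e) * Y + ennreal (1 + 1 / e) * d n) = ennreal (1 + e) * Y"
      by (intro lim_imp_Liminf) auto
    moreover have "liminf X \<le> liminf (\<lambda>n. ennreal (1 + e) * Y + ennreal (1 + 1 / e) * d n)"
      by (intro Liminf_mono always_eventually allI bound e)
    ultimately show ?thesis by simp
  qed
  show ?thesis
  proof (rule ennreal_le_epsilon)
    fix e :: real assume e: "0 < e"
    have "liminf X \<le> ennreal (1 + e / (y + 1)) * ennreal y"
      using le[of "e / (y + 1)"] e real by simp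
    also have "\<dots> = ennreal ((1 + e / (y + 1)) * y)"
      using e real by (intro ennreal_mult[symmetric]) auto
    also have "\<dots> \<le> ennreal (y + e)"
      using e real by (intro ennreal_leI) (simp add: field_simps)
    also have "\<dots> = Y + ennreal e" using e real by (simp add: ennreal_plus)
    finally show "liminf X \<le> Y + ennreal e" .
  qed
qed simp

section \<open>Irreducible representations\<close>

lemma bounded_clinear_linear: "bounded_clinear T \<Longrightarrow> linear T"
  unfolding bounded_clinear_def by (intro bounded_linear.linear) simp

text \<open>A class contains its representatives, as \<open>\<pi> 0\<close> intertwines \<open>\<pi>\<close> with itself.\<close>

lemma irreducible_rep_of:
  fixes \<delta> :: "'g::topological_group_add rep set"
  assumes "\<delta> \<in> unitary_dual"
  shows "irreducible_rep (rep_of \<delta>)"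
proof -
  obtain \<pi> where \<pi>: "irreducible_rep \<pi>"
    and \<delta>: "\<delta> = {(\<rho>, \<pi>). irreducible_rep \<rho> \<and> irreducible_rep \<pi> \<and> equivalent_rep \<rho> \<pi>} `` {\<pi>}"
    using assms unfolding unitary_dual_def quotient_def by auto
  have u: "unitary_rep \<pi>" using \<pi> by (simp add: irreducible_rep_def)
  have p: "\<pi> 0 (\<pi> g v) = \<pi> g v" "\<pi> g (\<pi> 0 v) = \<pi> g v" for g v
    using u unfolding unitary_rep_def by (metis add_0 add_0_right comp_apply)+
  have "isometric_intertwiner (\<pi> 0) \<pi> \<pi>" "\<pi> 0 ` rep_space \<pi> = rep_space \<pi>"
    using u unfolding isometric_intertwiner_def rep_space_def unitary_rep_def
    by (auto simp: p image_iff)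
  then have "equivalent_rep \<pi> \<pi>" unfolding equivalent_rep_def by blast
  then have "\<pi> \<in> \<delta>" using \<pi> by (simp add: \<delta>)
  then have "rep_of \<delta> \<in> \<delta>" unfolding rep_of_def by (rule someI[of "\<lambda>\<pi>. \<pi> \<in> \<delta>"])
  then show ?thesis unfolding \<delta> by blast
qed

lemma unitary_rep_of: "\<delta> \<in> unitary_dual \<Longrightarrow> unitary_rep (rep_of \<delta>)"
  using irreducible_rep_of[of \<delta>] by (simp add: irreducible_rep_def)

lemma unitary_rep_norm_le:
  assumes "unitary_rep \<pi>"
  shows "norm (\<pi> g v) \<le> norm v"
proof -
  have eq: "(norm (\<pi> g v))\<^sup>2 = cmod (cinner v (\<pi> 0 v))" for g
  proof -
    have "complex_of_real ((norm (\<pi> g v))\<^sup>2) = cinner v (\<pi> (- g) (\<pi> g v))"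
      using assms unfolding unitary_rep_def by (metis cinner_self)
    also have "\<pi> (- g) (\<pi> g v) = \<pi> 0 v"
      using assms unfolding unitary_rep_def by (metis comp_apply left_minus)
    finally show ?thesis by (metis abs_power2 norm_of_real)
  qed
  have "(norm (\<pi> 0 v))\<^sup>2 \<le> norm v * norm (\<pi> 0 v)" unfolding eq by (rule norm_cinner_le)
  then have "norm (\<pi> 0 v) \<le> norm v"
    unfolding power2_eq_square by (cases "norm (\<pi> 0 v) = 0") auto
  then have "(norm (\<pi> g v))\<^sup>2 \<le> norm v * norm v"
    unfolding eq using norm_cinner_le[of v "\<pi> 0 v"] mult_left_mono[of "norm (\<pi> 0 v)" "norm v" "norm v"]
    by simp
  then show ?thesis by (simp add: power2_eq_square abs_le_square_iff[symmetric] flip: power2_eq_square)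
qed

text \<open>The irreducible representation of \<open>L \<times> \<real>\<close> with the parameters \<open>\<delta>\<close> and \<open>\<gamma>\<close>.\<close>

definition rep_A :: "'l::topological_group_add rep set \<Rightarrow> real \<Rightarrow> 'l \<times> real \<Rightarrow> ell2 \<Rightarrow> ell2" where
  "rep_A \<delta> \<gamma> a v = cis (\<gamma> * snd a) *\<^sub>C rep_of \<delta> (fst a) v"

lemma scaleC_scaleC: "c *\<^sub>C d *\<^sub>C v = (c * d) *\<^sub>C v"
  by (rule ell2_eqI) (simp add: Rep_ell2_simps)

lemma scaleC_one: "1 *\<^sub>C v = v"
  by (rule ell2_eqI) (simp add: Rep_ell2_simps)

lemma norm_rep_A_le: "\<delta> \<in> unitary_dual \<Longrightarrow> norm (rep_A \<delta> \<gamma> a v) \<le> norm v"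
  by (simp add: rep_A_def norm_scaleC unitary_rep_norm_le unitary_rep_of)

lemma rep_A_add:
  assumes "\<delta> \<in> unitary_dual"
  shows "rep_A \<delta> \<gamma> (a + b) v = rep_A \<delta> \<gamma> a (rep_A \<delta> \<gamma> b v)"
  using unitary_rep_of[OF assms]
  by (simp add: rep_A_def unitary_rep_def bounded_clinear_def scaleC_scaleC cis_mult algebra_simps)

lemma adjoint_rep_A:
  assumes "\<delta> \<in> unitary_dual"
  shows "adjoint_pair (rep_A \<delta> \<gamma> a) (rep_A \<delta> \<gamma> (- a))"
  using unitary_rep_of[OF assms]
  by (simp add: adjoint_pair_def rep_A_def unitary_rep_def cinner_scaleC_left cinner_scaleC_right
      cis_cnj)

lemma bounded_linear_rep_A:
  assumes "\<delta> \<in> unitary_dual"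
  shows "bounded_linear (rep_A \<delta> \<gamma> a)"
proof -
  have "bounded_linear (rep_of \<delta> (fst a))"
    using unitary_rep_of[OF assms] by (simp add: unitary_rep_def bounded_clinear_def)
  from bounded_linear_compose[OF bounded_linear_scaleC_right this]
  show ?thesis by (simp add: rep_A_def[abs_def])
qed

lemma rep_A_scaleC: "\<delta> \<in> unitary_dual \<Longrightarrow> rep_A \<delta> \<gamma> a (c *\<^sub>C v) = c *\<^sub>C rep_A \<delta> \<gamma> a v"
  using unitary_rep_of[of \<delta>]
  by (simp add: rep_A_def unitary_rep_def bounded_clinear_def scaleC_scaleC mult.commute)

lemma measurable_rep_A[measurable (raw)]:
  fixes \<delta> :: "'l::{topological_group_add, second_countable_topology, t2_space} rep set"
  assumes \<delta>: "\<delta> \<in> unitary_dual" and [measurable]: "g \<in> borel_measurable N" "h \<in> N \<rightarrow>\<^sub>M borel"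
  shows "(\<lambda>y. rep_A \<delta> (g y) (h y) v) \<in> borel_measurable N"
proof -
  have "continuous_on UNIV (\<lambda>l. rep_of \<delta> l v)"
    using unitary_rep_of[OF \<delta>] by (simp add: unitary_rep_def)
  then have [measurable]: "(\<lambda>l. rep_of \<delta> l v) \<in> borel_measurable borel"
    by (rule borel_measurable_continuous_onI)
  have [measurable]: "(\<lambda>y. fst (h y)) \<in> borel_measurable N" "(\<lambda>y. snd (h y)) \<in> borel_measurable N"
    using assms(3) unfolding borel_prod[symmetric] by measurable
  have [measurable]: "cis \<in> borel_measurable borel"
    by (intro borel_measurable_continuous_onI continuous_intros)
  show ?thesis unfolding rep_A_def by measurable
qed

section \<open>The Fourier transform of integrable functions\<close>

definition involution :: "('a::group_add \<Rightarrow> complex) \<Rightarrow> 'a \<Rightarrow> complex" where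
  "involution f a = cnj (f (- a))"

text \<open>The convolution of \<open>f\<close> with the involution of \<open>g\<close>.\<close>

definition correlation :: "'a::group_add measure \<Rightarrow> ('a \<Rightarrow> complex) \<Rightarrow> ('a \<Rightarrow> complex) \<Rightarrow> 'a \<Rightarrow> complex"
  where "correlation M f g a = (LINT x|M. f x * cnj (g (- a + x)))"

context compact_group_times_real
begin

lemma integral_M_plus:
  fixes g :: "'l \<times> real \<Rightarrow> 'v::{banach, second_countable_topology}"
  assumes "g \<in> borel_measurable M"
  shows "(LINT x|M. g (a + x)) = (LINT x|M. g x)" "integrable M (\<lambda>x. g (a + x)) = integrable M g"
  using integral_distr[OF measurable_borel_comp_plus assms, of a]
    integrable_distr_eq[OF measurable_borel_comp_plus assms, of a] by (simp_all add: distr_M_plus)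

lemma nn_integral_M_plus:
  "g \<in> borel_measurable M \<Longrightarrow> (\<integral>\<^sup>+x. g (a + x) \<partial>M) = (\<integral>\<^sup>+x. g x \<partial>M)"
  using nn_integral_distr[OF measurable_borel_comp_plus, of g a] by (simp add: distr_M_plus)

lemma integral_M_uminus:
  fixes g :: "'l \<times> real \<Rightarrow> 'v::{banach, second_countable_topology}"
  assumes "g \<in> borel_measurable M"
  shows "(LINT x|M. g (- x)) = (LINT x|M. g x)" "integrable M (\<lambda>x. g (- x)) = integrable M g"
  using integral_distr[OF measurable_borel_comp_uminus assms]
    integrable_distr_eq[OF measurable_borel_comp_uminus assms] by (simp_all add: distr_M_uminus)

lemma L2_plus:
  assumes "f \<in> L2 M" shows "(\<lambda>x. f (a + x)) \<in> L2 M"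
proof -
  have [measurable]: "f \<in> borel_measurable M" using assms by measurable
  have "(\<lambda>x. f (a + x)) \<in> borel_measurable M"
    by (rule measurable_compose[OF measurable_borel_comp_plus]) measurable
  then show ?thesis
    using assms nn_integral_M_plus[of "\<lambda>x. ennreal ((cmod (f x))\<^sup>2)" a] by (simp add: L2_iff)
qed

lemma L1_L2_plus:
  assumes "f \<in> L1_L2 M" shows "(\<lambda>x. f (a + x)) \<in> L1_L2 M"
  using assms L2_plus[of f a] integral_M_plus(2)[of f a] by (simp add: L1_L2_def L2_def)

lemma L1_L2_involution:
  assumes f: "f \<in> L1_L2 M" shows "involution f \<in> L1_L2 M"
proof -
  have [measurable]: "f \<in> borel_measurable M" using f by measurable
  have [measurable]: "(\<lambda>x. f (- x)) \<in> borel_measurable M"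
    by (rule measurable_compose[OF measurable_borel_comp_uminus]) measurable
  have "integrable M (\<lambda>x. f (- x))" "integrable M (\<lambda>x. (cmod (f (- x)))\<^sup>2)"
    using f integral_M_uminus(2)[of f] integral_M_uminus(2)[of "\<lambda>x. (cmod (f x))\<^sup>2"]
    by (simp_all add: L1_L2_def L2_def)
  then show ?thesis by (simp add: L1_L2_def L2_def involution_def[abs_def])
qed

lemma fourier_eq: "fourier \<mu> f \<delta> \<gamma> v = (LINT a|M. f a *\<^sub>C rep_A \<delta> \<gamma> a v)"
  unfolding fourier_def rep_A_def scaleC_scaleC split_beta prod.collapse ..

lemma measurable_fourier[measurable (raw)]:
  assumes \<delta>: "\<delta> \<in> unitary_dual" and [measurable]: "case_prod h \<in> borel_measurable (N \<Otimes>\<^sub>M M)"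
    "g \<in> borel_measurable N"
  shows "(\<lambda>y. fourier \<mu> (h y) \<delta> (g y) v) \<in> borel_measurable N"
proof -
  have [measurable]: "snd \<in> N \<Otimes>\<^sub>M M \<rightarrow>\<^sub>M borel" using measurable_snd[of N M] by (simp add: measurable_M)
  show ?thesis unfolding fourier_eq
    by (rule A.borel_measurable_lebesgue_integral) (simp add: split_beta \<delta>)
qed

lemma measurable_fourier_gamma[measurable]:
  assumes \<delta>: "\<delta> \<in> unitary_dual" and f: "f \<in> L1_L2 M"
  shows "(\<lambda>\<gamma>. fourier \<mu> f \<delta> \<gamma> v) \<in> borel_measurable borel"
proof (rule measurable_fourier[OF \<delta>])
  have "f \<in> borel_measurable M" using f by measurable
  then show "case_prod (\<lambda>_. f) \<in> borel_measurable (borel \<Otimes>\<^sub>M M)"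
    unfolding split_beta' by (rule measurable_compose[OF measurable_snd])
qed simp

lemma integrable_fourier:
  assumes \<delta>: "\<delta> \<in> unitary_dual" and f: "f \<in> L1_L2 M"
  shows "integrable M (\<lambda>a. f a *\<^sub>C rep_A \<delta> \<gamma> a v)"
proof (rule Bochner_Integration.integrable_bound)
  show "integrable M (\<lambda>a. norm v * cmod (f a))"
    using L1_L2_D(2)[OF f] by (intro integrable_mult_right integrable_norm)
  have [measurable]: "(\<lambda>a. a) \<in> M \<rightarrow>\<^sub>M borel" by (simp add: measurable_M)
  show "(\<lambda>a. f a *\<^sub>C rep_A \<delta> \<gamma> a v) \<in> borel_measurable M" using f \<delta> by measurable
  show "AE a in M. norm (f a *\<^sub>C rep_A \<delta> \<gamma> a v) \<le> norm (norm v * cmod (f a))"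
    using mult_left_mono[OF norm_rep_A_le[OF \<delta>], of "cmod (f _)"]
    by (auto simp: norm_scaleC mult.commute)
qed

lemma norm_fourier_le:
  assumes \<delta>: "\<delta> \<in> unitary_dual" and f: "f \<in> L1_L2 M"
  shows "norm (fourier \<mu> f \<delta> \<gamma> v) \<le> (LINT a|M. cmod (f a)) * norm v"
proof -
  have "norm (fourier \<mu> f \<delta> \<gamma> v) \<le> (LINT a|M. cmod (f a) * norm v)"
    unfolding fourier_eq
    by (rule order_trans[OF integral_norm_bound
          integral_mono[OF integrable_norm[OF integrable_fourier[OF \<delta> f]]]])
      (use L1_L2_D(2)[OF f] in \<open>auto simp: norm_scaleC intro!: mult_left_mono norm_rep_A_le[OF \<delta>]\<close>)
  then show ?thesis by simp
qed

lemma bounded_clinear_fourier: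
  assumes \<delta>: "\<delta> \<in> unitary_dual" and f: "f \<in> L1_L2 M"
  shows "bounded_clinear (fourier \<mu> f \<delta> \<gamma>)"
  unfolding bounded_clinear_def
proof
  note int = integrable_fourier[OF \<delta> f, of \<gamma>]
  show "bounded_linear (fourier \<mu> f \<delta> \<gamma>)"
  proof (rule bounded_linear_intro[where K = "LINT a|M. cmod (f a)"])
    fix v w
    show "fourier \<mu> f \<delta> \<gamma> (v + w) = fourier \<mu> f \<delta> \<gamma> v + fourier \<mu> f \<delta> \<gamma> w"
      unfolding fourier_eq Bochner_Integration.integral_add[OF int int, symmetric]
      by (simp add: bounded_linear.linear[OF bounded_linear_rep_A[OF \<delta>], THEN linear_add]
          bounded_bilinear.add_right[OF bounded_bilinear_scaleC])
    fix r
    show "fourier \<mu> f \<delta> \<gamma> (r *\<^sub>R v) = r *\<^sub>R fourier \<mu> f \<delta> \<gamma> v"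
      unfolding fourier_eq integral_scaleR_right[symmetric]
      by (simp add: bounded_linear.linear[OF bounded_linear_rep_A[OF \<delta>], THEN linear_scale]
          bounded_bilinear.scaleR_right[OF bounded_bilinear_scaleC])
  qed (use norm_fourier_le[OF \<delta> f] in \<open>simp add: mult.commute\<close>)
  show "\<forall>c v. fourier \<mu> f \<delta> \<gamma> (c *\<^sub>C v) = c *\<^sub>C fourier \<mu> f \<delta> \<gamma> v"
    unfolding fourier_eq integral_bounded_linear[OF bounded_linear_scaleC_right int, symmetric]
    by (simp add: rep_A_scaleC[OF \<delta>] scaleC_scaleC mult.commute)
qed

lemma fourier_diff:
  assumes \<delta>: "\<delta> \<in> unitary_dual" and f: "f \<in> L1_L2 M" and g: "g \<in> L1_L2 M"
  shows "fourier \<mu> (\<lambda>x. f x - g x) \<delta> \<gamma> v = fourier \<mu> f \<delta> \<gamma> v - fourier \<mu> g \<delta> \<gamma> v"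
  unfolding fourier_eq
    Bochner_Integration.integral_diff[OF integrable_fourier[OF \<delta> f] integrable_fourier[OF \<delta> g], symmetric]
  by (simp add: bounded_bilinear.diff_left[OF bounded_bilinear_scaleC])

lemma adjoint_fourier:
  assumes \<delta>: "\<delta> \<in> unitary_dual" and f: "f \<in> L1_L2 M"
  shows "adjoint_pair (fourier \<mu> f \<delta> \<gamma>) (fourier \<mu> (involution f) \<delta> \<gamma>)"
  unfolding adjoint_pair_def
proof safe
  fix v w
  have [measurable]: "f \<in> borel_measurable M" using f by measurable
  have [measurable]: "(\<lambda>a. a) \<in> M \<rightarrow>\<^sub>M borel" by (simp add: measurable_M)
  have [measurable]: "(\<lambda>a. rep_A \<delta> \<gamma> a w) \<in> borel_measurable M" using \<delta> by measurable
  have [measurable]: "(\<lambda>a. f (- a)) \<in> borel_measurable M"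
    by (rule measurable_compose[OF measurable_borel_comp_uminus]) measurable
  have "cinner (fourier \<mu> f \<delta> \<gamma> v) w = (LINT a|M. cinner (f a *\<^sub>C rep_A \<delta> \<gamma> a v) w)"
    unfolding fourier_eq
    by (rule integral_bounded_linear[OF bounded_linear_cinner_left integrable_fourier[OF \<delta> f], symmetric])
  also have "\<dots> = (LINT a|M. cinner v (cnj (f a) *\<^sub>C rep_A \<delta> \<gamma> (- a) w))"
    by (simp add: cinner_scaleC_left cinner_scaleC_right adjoint_pairD[OF adjoint_rep_A[OF \<delta>]])
  also have "\<dots> = cinner v (LINT a|M. cnj (f a) *\<^sub>C rep_A \<delta> \<gamma> (- a) w)"
  proof (rule integral_bounded_linear[OF bounded_bilinear.bounded_linear_right[OF bounded_bilinear_cinner]])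
    have "integrable M (\<lambda>a. involution f a *\<^sub>C rep_A \<delta> \<gamma> a w)"
      by (rule integrable_fourier[OF \<delta> L1_L2_involution[OF f]])
    then show "integrable M (\<lambda>a. cnj (f a) *\<^sub>C rep_A \<delta> \<gamma> (- a) w)"
      by (subst (asm) integral_M_uminus(2)[symmetric]) (auto simp: involution_def)
  qed
  also have "(LINT a|M. cnj (f a) *\<^sub>C rep_A \<delta> \<gamma> (- a) w) = fourier \<mu> (involution f) \<delta> \<gamma> w"
    unfolding fourier_eq
    by (subst integral_M_uminus(1)[symmetric]) (simp_all add: involution_def)
  finally show "cinner (fourier \<mu> f \<delta> \<gamma> v) w = cinner v (fourier \<mu> (involution f) \<delta> \<gamma> w)" .
qed

lemma fourier_translation:
  assumes \<delta>: "\<delta> \<in> unitary_dual" and f: "f \<in> L1_L2 M"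
  shows "fourier \<mu> (\<lambda>x. f ((0, s) + x)) \<delta> \<gamma> v = cis (- (\<gamma> * s)) *\<^sub>C fourier \<mu> f \<delta> \<gamma> v"
proof -
  have rep: "rep_A \<delta> \<gamma> x v = cis (- (\<gamma> * s)) *\<^sub>C rep_A \<delta> \<gamma> ((0, s) + x) v" for x
    by (simp add: rep_A_def scaleC_scaleC cis_mult algebra_simps)
  have "f ((0, s) + x) *\<^sub>C rep_A \<delta> \<gamma> x v
      = cis (- (\<gamma> * s)) *\<^sub>C f ((0, s) + x) *\<^sub>C rep_A \<delta> \<gamma> ((0, s) + x) v" for x
    by (subst rep) (simp only: scaleC_scaleC mult.commute)
  then have "fourier \<mu> (\<lambda>x. f ((0, s) + x)) \<delta> \<gamma> v
      = (LINT x|M. cis (- (\<gamma> * s)) *\<^sub>C f ((0, s) + x) *\<^sub>C rep_A \<delta> \<gamma> ((0, s) + x) v)"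
    unfolding fourier_eq by simp
  also have "\<dots> = (LINT x|M. cis (- (\<gamma> * s)) *\<^sub>C f x *\<^sub>C rep_A \<delta> \<gamma> x v)"
  proof (rule integral_M_plus)
    show "(\<lambda>x. cis (- (\<gamma> * s)) *\<^sub>C f x *\<^sub>C rep_A \<delta> \<gamma> x v) \<in> borel_measurable M"
      using borel_measurable_integrable[OF integrable_fourier[OF \<delta> f]] by measurable
  qed
  also have "\<dots> = cis (- (\<gamma> * s)) *\<^sub>C fourier \<mu> f \<delta> \<gamma> v"
    unfolding fourier_eq
    by (rule integral_bounded_linear[OF bounded_linear_scaleC_right integrable_fourier[OF \<delta> f]])
  finally show ?thesis .
qed

lemma measurable_hs_norm_gamma[measurable]:
  assumes "\<And>v. (\<lambda>y. T y v) \<in> borel_measurable N"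
  shows "(\<lambda>y. (hs_norm (T y))\<^sup>2) \<in> borel_measurable N"
  unfolding hs_norm_power2 using assms by measurable

subsection \<open>Correlations\<close>

lemma measurable_M_pair:
  assumes "case_prod h \<in> borel_measurable (borel \<Otimes>\<^sub>M borel)"
  shows "case_prod h \<in> borel_measurable (M \<Otimes>\<^sub>M M)"
  using assms by (subst measurable_cong_sets[OF sets_pair_measure_cong[OF sets_M sets_M] refl])

lemma integrable_correlation:
  assumes f: "f \<in> L1_L2 M" and g: "g \<in> L1_L2 M"
  shows "integrable (M \<Otimes>\<^sub>M M) (\<lambda>(x, a). f x * cnj (g (- a + x)))"
  unfolding integrable_iff_bounded
proof
  have [measurable]: "f \<in> borel_measurable borel" "g \<in> borel_measurable borel"
    using f g by (simp_all add: L1_L2_def L2_def measurable_M)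
  show meas: "(\<lambda>(x, a). f x * cnj (g (- a + x))) \<in> borel_measurable (M \<Otimes>\<^sub>M M)"
    by (rule measurable_M_pair) measurable
  have gM[measurable]: "(\<lambda>a. ennreal (cmod (g a))) \<in> borel_measurable M"
    unfolding measurable_M by measurable
  have gM'[measurable]: "(\<lambda>a. ennreal (cmod (g (- a)))) \<in> borel_measurable M"
    unfolding measurable_M by measurable
  have inner: "(\<integral>\<^sup>+a. ennreal (cmod (g (- a + x))) \<partial>M) = (\<integral>\<^sup>+a. ennreal (cmod (g a)) \<partial>M)" for x
  proof -
    have "(\<integral>\<^sup>+a. ennreal (cmod (g (- a + x))) \<partial>M) = (\<integral>\<^sup>+a. ennreal (cmod (g (- a))) \<partial>M)"
      using nn_integral_M_plus[OF gM', of "- x"] by (simp only: minus_add minus_minus)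
    also have "\<dots> = (\<integral>\<^sup>+a. ennreal (cmod (g a)) \<partial>distr M M uminus)"
      by (rule nn_integral_distr[symmetric]) measurable
    finally show ?thesis by (simp add: distr_M_uminus)
  qed
  have "(\<integral>\<^sup>+p. ennreal (norm (case p of (x, a) \<Rightarrow> f x * cnj (g (- a + x)))) \<partial>(M \<Otimes>\<^sub>M M))
      = (\<integral>\<^sup>+x. \<integral>\<^sup>+a. ennreal (norm (f x * cnj (g (- a + x)))) \<partial>M \<partial>M)"
    using A.nn_integral_fst[of "\<lambda>p. ennreal (norm (case p of (x, a) \<Rightarrow> f x * cnj (g (- a + x))))" M] meas
    by simp
  also have "\<dots> = (\<integral>\<^sup>+x. ennreal (cmod (f x)) * (\<integral>\<^sup>+a. ennreal (cmod (g (- a + x))) \<partial>M) \<partial>M)"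
  proof (rule nn_integral_cong)
    fix x
    have [measurable]: "(\<lambda>a. ennreal (cmod (g (- a + x)))) \<in> borel_measurable M"
      unfolding measurable_M by measurable
    show "(\<integral>\<^sup>+a. ennreal (norm (f x * cnj (g (- a + x)))) \<partial>M)
        = ennreal (cmod (f x)) * (\<integral>\<^sup>+a. ennreal (cmod (g (- a + x))) \<partial>M)"
      unfolding norm_mult complex_mod_cnj ennreal_mult[OF norm_ge_zero norm_ge_zero]
      by (rule nn_integral_cmult) measurable
  qed
  also have "\<dots> = (\<integral>\<^sup>+x. ennreal (cmod (f x)) \<partial>M) * (\<integral>\<^sup>+a. ennreal (cmod (g a)) \<partial>M)"
  proof -
    have "(\<lambda>x. ennreal (cmod (f x))) \<in> borel_measurable M"
      unfolding measurable_M by measurable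
    then show ?thesis unfolding inner by (rule nn_integral_multc)
  qed
  also have "\<dots> < \<infinity>"
    using L1_L2_D(2)[OF f] L1_L2_D(2)[OF g] by (simp add: integrable_iff_bounded ennreal_mult_less_top)
  finally show "(\<integral>\<^sup>+p. ennreal (norm (case p of (x, a) \<Rightarrow> f x * cnj (g (- a + x)))) \<partial>(M \<Otimes>\<^sub>M M)) < \<infinity>" .
qed

text \<open>
  A correlation is integrable by Fubini's theorem, and it is bounded since both functions are square
  integrable. A bounded integrable function is square integrable.
\<close>

lemma L1_L2_correlation:
  assumes f: "f \<in> L1_L2 M" and g: "g \<in> L1_L2 M"
  shows "correlation M f g \<in> L1_L2 M"
proof -
  interpret MM: pair_sigma_finite M M
    by (intro pair_sigma_finite.intro A.sigma_finite_measure_axioms)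
  have int: "integrable M (correlation M f g)"
    unfolding correlation_def[abs_def] by (rule MM.integrable_snd[OF integrable_correlation[OF f g]])
  define c where "c = (LINT x|M. (cmod (f x))\<^sup>2) + (LINT x|M. (cmod (g x))\<^sup>2)"
  have gm: "(\<lambda>x. (cmod (g x))\<^sup>2) \<in> borel_measurable M" using g by measurable
  have bound: "cmod (correlation M f g a) \<le> c" for a
    using L2_integrable_mult(2)[OF L1_L2_D(1)[OF f] L2_plus[OF L1_L2_D(1)[OF g]], of "- a"]
    unfolding correlation_def c_def integral_M_plus(1)[OF gm] .
  have "integrable M (\<lambda>a. c * cmod (correlation M f g a))" using int by simp
  then have "integrable M (\<lambda>a. (cmod (correlation M f g a))\<^sup>2)"
  proof (rule Bochner_Integration.integrable_bound)
    show "AE a in M. norm ((cmod (correlation M f g a))\<^sup>2) \<le> norm (c * cmod (correlation M f g a))"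
    proof (rule AE_I2)
      fix a
      have "0 \<le> c" by (rule order_trans[OF norm_ge_zero bound])
      then show "norm ((cmod (correlation M f g a))\<^sup>2) \<le> norm (c * cmod (correlation M f g a))"
        using mult_right_mono[OF bound[of a] norm_ge_zero[of "correlation M f g a"]]
        by (simp add: power2_eq_square abs_mult)
    qed
  qed (use int in measurable)
  then show ?thesis using int by (simp add: L1_L2_def L2_def)
qed

text \<open>After Fubini's theorem the substitution \<open>a = x + a'\<close> separates the variables.\<close>

lemma fourier_correlation:
  assumes \<delta>: "\<delta> \<in> unitary_dual" and f: "f \<in> L1_L2 M" and g: "g \<in> L1_L2 M"
  shows "fourier \<mu> (correlation M f g) \<delta> \<gamma> = fourier \<mu> f \<delta> \<gamma> \<circ> fourier \<mu> (involution g) \<delta> \<gamma>"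
proof
  fix v
  interpret MM: pair_sigma_finite M M
    by (intro pair_sigma_finite.intro A.sigma_finite_measure_axioms)
  define F where "F x a = (f x * cnj (g (- a + x))) *\<^sub>C rep_A \<delta> \<gamma> a v" for x a
  have [measurable]: "f \<in> borel_measurable borel" "g \<in> borel_measurable borel"
    using f g by (simp_all add: L1_L2_def L2_def measurable_M)
  have Fm: "case_prod F \<in> borel_measurable (M \<Otimes>\<^sub>M M)"
    unfolding F_def by (rule measurable_M_pair) (use \<delta> in measurable)
  have intF: "integrable (M \<Otimes>\<^sub>M M) (case_prod F)"
  proof (rule Bochner_Integration.integrable_bound)
    show "integrable (M \<Otimes>\<^sub>M M) (\<lambda>p. norm v * norm (case p of (x, a) \<Rightarrow> f x * cnj (g (- a + x))))"
      by (intro integrable_mult_right integrable_norm integrable_correlation f g)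
    show "AE p in M \<Otimes>\<^sub>M M. norm (case_prod F p)
        \<le> norm (norm v * norm (case p of (x, a) \<Rightarrow> f x * cnj (g (- a + x))))"
      by (intro AE_I2) (auto simp: F_def norm_scaleC split_beta mult.commute[of "norm v"]
          intro!: mult_left_mono norm_rep_A_le[OF \<delta>])
  qed (rule Fm)
  have "fourier \<mu> (correlation M f g) \<delta> \<gamma> v = (LINT a|M. LINT x|M. F x a)"
    unfolding fourier_eq correlation_def F_def
    by (intro Bochner_Integration.integral_cong refl integral_bounded_linear[symmetric]
        bounded_bilinear.bounded_linear_left[OF bounded_bilinear_scaleC]
        L2_integrable_mult(1) L2_plus L1_L2_D(1) f g)
  also have "\<dots> = (LINT x|M. LINT a|M. F x a)" by (rule MM.Fubini_integral[OF intF])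
  also have "\<dots> = (LINT x|M. f x *\<^sub>C rep_A \<delta> \<gamma> x (fourier \<mu> (involution g) \<delta> \<gamma> v))"
  proof (rule Bochner_Integration.integral_cong[OF refl])
    fix x
    have F1: "F x \<in> borel_measurable M"
      unfolding F_def[abs_def] measurable_M using \<delta> by measurable
    have "(LINT a|M. F x a) = (LINT a|M. F x (x + a))" by (rule integral_M_plus(1)[OF F1, symmetric])
    also have "\<dots> = (LINT a|M. f x *\<^sub>C rep_A \<delta> \<gamma> x (involution g a *\<^sub>C rep_A \<delta> \<gamma> a v))"
      by (simp add: F_def minus_add add.assoc involution_def rep_A_add[OF \<delta>] rep_A_scaleC[OF \<delta>]
          scaleC_scaleC)
    also have "\<dots> = f x *\<^sub>C rep_A \<delta> \<gamma> x (fourier \<mu> (involution g) \<delta> \<gamma> v)"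
      unfolding fourier_eq
      by (rule integral_bounded_linear[OF bounded_linear_compose[OF bounded_linear_scaleC_right
            bounded_linear_rep_A[OF \<delta>]] integrable_fourier[OF \<delta> L1_L2_involution[OF g]]])
    finally show "(LINT a|M. F x a) = f x *\<^sub>C rep_A \<delta> \<gamma> x (fourier \<mu> (involution g) \<delta> \<gamma> v)" .
  qed
  also have "\<dots> = fourier \<mu> f \<delta> \<gamma> (fourier \<mu> (involution g) \<delta> \<gamma> v)" by (rule fourier_eq[symmetric])
  finally show "fourier \<mu> (correlation M f g) \<delta> \<gamma> v
      = (fourier \<mu> f \<delta> \<gamma> \<circ> fourier \<mu> (involution g) \<delta> \<gamma>) v" by simp
qed

end

section \<open>The Plancherel formula and its extension to \<open>L\<^sup>2\<close>\<close>

lemma liminf_cmult_ennreal: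
  fixes X :: "nat \<Rightarrow> ennreal"
  assumes "c < \<infinity>"
  shows "liminf (\<lambda>n. c * X n) = c * liminf X"
  by (rule Liminf_compose_continuous_mono[where f = "\<lambda>x. c * x"])
    (use assms in \<open>auto intro!: ennreal_continuous_on_cmult monoI mult_left_mono simp: less_top\<close>)

text \<open>Lower semicontinuity of the Hilbert--Schmidt norm, by Fatou's lemma for the sum over the basis.\<close>

lemma hs_norm_liminf:
  assumes "\<And>n. (\<lambda>m. T m (ket n)) \<longlonglongrightarrow> T' (ket n)"
  shows "(hs_norm T')\<^sup>2 \<le> liminf (\<lambda>m. (hs_norm (T m))\<^sup>2)"
proof -
  have "liminf (\<lambda>m. ennreal ((norm (T m (ket n)))\<^sup>2)) = ennreal ((norm (T' (ket n)))\<^sup>2)" for n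
    by (intro lim_imp_Liminf tendsto_ennrealI tendsto_power tendsto_norm assms) simp
  then have "(hs_norm T')\<^sup>2
      = (\<integral>\<^sup>+n. liminf (\<lambda>m. ennreal ((norm (T m (ket n)))\<^sup>2)) \<partial>count_space UNIV)"
    by (simp add: hs_norm_power2 nn_integral_count_space_nat)
  also have "\<dots> \<le> liminf (\<lambda>m. \<integral>\<^sup>+n. ennreal ((norm (T m (ket n)))\<^sup>2) \<partial>count_space UNIV)"
    by (rule nn_integral_liminf) simp
  finally show ?thesis by (simp add: hs_norm_power2 nn_integral_count_space_nat)
qed

lemma countable_support_nn_integral:
  fixes g :: "'x \<Rightarrow> ennreal"
  assumes "(\<integral>\<^sup>+x. g x \<partial>count_space X) < \<infinity>"
  shows "countable {x\<in>X. g x \<noteq> 0}"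
proof -
  define S where "S n = {x\<in>X. ennreal (1 / Suc n) \<le> g x}" for n
  have fin: "finite (S n)" for n
  proof (rule ccontr)
    assume inf: "infinite (S n)"
    have "(\<integral>\<^sup>+x. ennreal (1 / Suc n) * indicator (S n) x \<partial>count_space X)
        \<le> (\<integral>\<^sup>+x. g x \<partial>count_space X)"
      by (intro nn_integral_mono) (auto simp: S_def indicator_def)
    also have "(\<integral>\<^sup>+x. ennreal (1 / Suc n) * indicator (S n) x \<partial>count_space X)
        = ennreal (1 / Suc n) * emeasure (count_space X) (S n)"
      by (rule nn_integral_cmult_indicator) (auto simp: S_def)
    also have "emeasure (count_space X) (S n) = \<infinity>"
      using inf by (subst emeasure_count_space) (auto simp: S_def)
    finally show False using assms by (simp add: ennreal_mult_top top_unique)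
  qed
  moreover have "{x\<in>X. g x \<noteq> 0} \<subseteq> (\<Union>n. S n)"
  proof
    fix x assume x: "x \<in> {x\<in>X. g x \<noteq> 0}"
    show "x \<in> (\<Union>n. S n)"
    proof (cases "g x")
      case (real r)
      then have "0 < r" using x by (auto simp: order_less_le)
      then obtain n where "1 / Suc n < r" by (rule nat_approx_posE)
      then have "ennreal (1 / Suc n) \<le> g x" using real ennreal_leI[of "1 / Suc n" r] by simp
      then show ?thesis using x by (auto simp: S_def)
    qed (use x in \<open>auto simp: S_def\<close>)
  qed
  moreover have "countable (\<Union>n. S n)"
    using fin countable_finite by blast
  ultimately show ?thesis using countable_subset by metis
qed

lemma indicator_L1_L2:
  assumes V: "V \<in> sets M" and fin: "emeasure M V < \<infinity>"
  shows "indicator V \<in> L1_L2 M"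
proof -
  have real: "integrable M (indicator V :: _ \<Rightarrow> real)" using V fin by simp
  have eq: "(indicator V :: _ \<Rightarrow> complex) = (\<lambda>x. of_real (indicator V x))"
    by (auto simp: indicator_def fun_eq_iff)
  have "(cmod (indicator V x))\<^sup>2 = indicator V x" for x by (simp add: indicator_def)
  then show ?thesis using V real by (simp add: L1_L2_def L2_def) (simp add: eq)
qed

lemma sets_dgamma[measurable_cong]: "sets dgamma = sets borel"
  by (simp add: dgamma_def)

lemma nn_integral_dgamma:
  "g \<in> borel_measurable borel \<Longrightarrow> (\<integral>\<^sup>+\<gamma>. g \<gamma> \<partial>dgamma) = ennreal (1 / (2 * pi)) * (\<integral>\<^sup>+\<gamma>. g \<gamma> \<partial>lborel)"
  unfolding dgamma_def by (simp add: nn_integral_density nn_integral_cmult)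

lemma AE_dgamma: "(AE \<gamma> in dgamma. P \<gamma>) \<longleftrightarrow> (AE \<gamma> in lborel. P \<gamma>)"
  unfolding dgamma_def by (subst AE_density) auto

lemma emeasure_lborel_open_pos:
  assumes "open (S :: real set)" "S \<noteq> {}"
  shows "0 < emeasure lborel S"
proof -
  obtain x e where e: "0 < e" "ball x e \<subseteq> S" using assms by (meson openE ex_in_conv)
  have "0 < emeasure lborel {x - e <..< x + e}" using e by simp
  also have "\<dots> \<le> emeasure lborel S"
    using e assms by (intro emeasure_mono) (auto simp: ball_eq_greaterThanLessThan)
  finally show ?thesis .
qed

text \<open>
  As \<open>L\<close> is compact, cutting off \<open>f \<in> L\<^sup>2\<close> in the real variable makes it integrable. Truncations
  converge to \<open>f\<close> both pointwise and in \<open>L\<^sup>2\<close>, which allows dominated convergence and Fatou's lemma.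
\<close>

definition truncation :: "nat \<Rightarrow> ('l \<times> real \<Rightarrow> complex) \<Rightarrow> 'l \<times> real \<Rightarrow> complex" where
  "truncation n f a = (if \<bar>snd a\<bar> \<le> real n then f a else 0)"

lemma truncation_tendsto: "(\<lambda>n. truncation n f a) \<longlonglongrightarrow> f a"
proof (rule tendsto_eventually)
  obtain N where N: "\<bar>snd a\<bar> \<le> real N" using real_arch_simple by blast
  show "\<forall>\<^sub>F n in sequentially. truncation n f a = f a"
    using eventually_ge_at_top[of N] by eventually_elim (use N in \<open>auto simp: truncation_def\<close>)
qed

context compact_group_times_real
begin

lemma emeasure_strip: "emeasure M (UNIV \<times> {- r .. r}) < \<infinity>"
proof -
  have "UNIV \<in> sets \<mu>" using sets.top[of \<mu>] by (simp add: space_mu)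
  then have "emeasure M (UNIV \<times> {- r .. r}) = emeasure \<mu> UNIV * emeasure lborel {- r .. r}"
    by (intro lborel.emeasure_pair_measure_Times) auto
  also have "\<dots> < \<infinity>"
    using emeasure_mu_UNIV by (auto simp: ennreal_mult_less_top emeasure_lborel_Icc_eq)
  finally show ?thesis .
qed

lemma sets_strip: "UNIV \<times> {- r .. r} \<in> sets M"
  unfolding sets_M by (intro borel_closed closed_Times) auto

lemma truncation_L1_L2:
  assumes f: "f \<in> L2 M"
  shows "truncation n f \<in> L1_L2 M"
proof -
  let ?S = "UNIV \<times> {- real n .. real n} :: ('l \<times> real) set"
  have eq: "truncation n f = (\<lambda>a. indicator ?S a * f a)"
    by (auto simp: truncation_def fun_eq_iff indicator_def)
  have [measurable]: "f \<in> borel_measurable M" using f by measurable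
  have [measurable]: "?S \<in> sets M" by (rule sets_strip)
  have meas: "truncation n f \<in> borel_measurable M" unfolding eq by measurable
  have sq: "integrable M (\<lambda>a. (cmod (f a))\<^sup>2)" using f by (simp add: L2_def)
  have "integrable M (indicator ?S :: _ \<Rightarrow> real)"
    using emeasure_strip[of n] sets_strip[of n] by simp
  from Bochner_Integration.integrable_add[OF this sq]
  have "integrable M (truncation n f)"
  proof (rule Bochner_Integration.integrable_bound[OF _ meas])
    have "r \<le> 1 + r\<^sup>2" for r :: real
      using zero_le_power2[of "r - 1"] zero_le_power2[of r]
      unfolding power2_diff one_power2 mult_1_right by linarith
    then show "AE a in M. norm (truncation n f a) \<le> norm (indicator ?S a + (cmod (f a))\<^sup>2)"
      by (intro AE_I2) (auto simp: eq indicator_def)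
  qed
  moreover have "integrable M (\<lambda>a. (cmod (truncation n f a))\<^sup>2)"
    by (rule Bochner_Integration.integrable_bound[OF sq]) (use meas in \<open>auto simp: truncation_def\<close>)
  ultimately show ?thesis using meas by (simp add: L1_L2_def L2_def)
qed

lemma truncation_tendsto_L2:
  assumes f: "f \<in> L2 M"
  shows "(\<lambda>n. LINT a|M. (cmod (truncation n f a - f a))\<^sup>2) \<longlonglongrightarrow> 0"
proof -
  have [measurable]: "truncation n f \<in> borel_measurable M" for n
    using truncation_L1_L2[OF f] by measurable
  have [measurable]: "f \<in> borel_measurable M" using f by measurable
  have "(\<lambda>n. LINT a|M. (cmod (truncation n f a - f a))\<^sup>2) \<longlonglongrightarrow> (LINT a|M. (0 :: real))"
  proof (rule integral_dominated_convergence)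
    show "integrable M (\<lambda>a. (cmod (f a))\<^sup>2)" using f by (simp add: L2_def)
    show "AE a in M. (\<lambda>n. (cmod (truncation n f a - f a))\<^sup>2) \<longlonglongrightarrow> 0"
    proof (rule AE_I2)
      fix a
      have "(\<lambda>n. (cmod (truncation n f a - f a))\<^sup>2) \<longlonglongrightarrow> (cmod (f a - f a))\<^sup>2"
        by (intro tendsto_intros truncation_tendsto)
      then show "(\<lambda>n. (cmod (truncation n f a - f a))\<^sup>2) \<longlonglongrightarrow> 0" by simp
    qed
    show "AE a in M. norm ((cmod (truncation n f a - f a))\<^sup>2) \<le> (cmod (f a))\<^sup>2" for n
      by (auto simp: truncation_def)
  qed measurable
  then show ?thesis by simp
qed

lemma emeasure_M_open_pos:
  assumes "open V" "V \<noteq> {}"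
  shows "0 < emeasure M V"
proof -
  obtain x where "x \<in> V" using assms by blast
  then obtain A B where AB: "open A" "open B" "x \<in> A \<times> B" "A \<times> B \<subseteq> V"
    using open_prod_elim[OF assms(1)] by metis
  have "0 < emeasure \<mu> U" if "open U" "U \<noteq> {}" for U
    using that haar by (simp add: haar_measure_def)
  then have "0 < emeasure \<mu> A" using AB(1,3) by blast
  moreover have "0 < emeasure lborel B" using AB by (intro emeasure_lborel_open_pos) auto
  moreover have "emeasure M (A \<times> B) = emeasure \<mu> A * emeasure lborel B"
    using AB by (intro lborel.emeasure_pair_measure_Times) (auto simp: sets_mu)
  moreover have "emeasure M (A \<times> B) \<le> emeasure M V"
  proof (rule emeasure_mono[OF AB(4)])
    show "V \<in> sets M" unfolding sets_M using assms(1) by (rule borel_open)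
  qed
  ultimately show ?thesis by (metis ennreal_zero_less_mult_iff less_le_trans)
qed

lemma hs_norm_fourier_eq_0:
  assumes "\<delta> \<in> unitary_dual" "f \<in> L1_L2 M" "(hs_norm (fourier \<mu> f \<delta> \<gamma>))\<^sup>2 = 0"
  shows "fourier \<mu> f \<delta> \<gamma> v = 0"
  using norm_le_hs_norm[OF adjoint_fourier[OF assms(1,2)], of \<gamma> v] assms(3) by simp

text \<open>
  The Plancherel measure is to be tested on countably many functions, none of whose transforms may
  vanish at a given \<open>\<delta>\<close> for all of them. Near the unit the matrix coefficient \<open>\<langle>\<sigma>(a) v, u\<rangle>\<close> with \<open>u = \<sigma>(0) v \<noteq> 0\<close> has positive real part,
  and so has its integral over a small open set.
\<close>

lemma fourier_nonvanishing:
  assumes \<delta>: "\<delta> \<in> unitary_dual" and B: "topological_basis B"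
  shows "\<exists>V\<in>B. (\<integral>\<^sup>+\<gamma>. (hs_norm (fourier \<mu> (indicator (V \<inter> UNIV \<times> {-1<..<1})) \<delta> \<gamma>))\<^sup>2 \<partial>dgamma) \<noteq> 0"
proof -
  have irr: "irreducible_rep (rep_of \<delta>)" by (rule irreducible_rep_of[OF \<delta>])
  have uni: "unitary_rep (rep_of \<delta>)" by (rule unitary_rep_of[OF \<delta>])
  have "0 \<in> rep_space (rep_of \<delta>)"
    using uni unfolding unitary_rep_def rep_space_def
    by (metis bounded_clinear_linear linear_0 rangeI)
  then obtain v where v: "rep_of \<delta> 0 v \<noteq> 0"
    using irr unfolding irreducible_rep_def rep_space_def by auto
  define u where "u = rep_of \<delta> 0 v"
  define \<Phi> where "\<Phi> p = Re (cinner (rep_A \<delta> (fst p) (snd p) v) u)" for p :: "real \<times> 'l \<times> real"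
  have "continuous_on UNIV (\<lambda>l. rep_of \<delta> l v)" using uni by (simp add: unitary_rep_def)
  then have "continuous_on UNIV (\<lambda>p :: real \<times> 'l \<times> real. rep_of \<delta> (fst (snd p)) v)"
    by (rule continuous_on_compose2) (auto intro!: continuous_intros)
  then have "continuous_on UNIV \<Phi>"
    unfolding \<Phi>_def rep_A_def
    by (intro bounded_linear.continuous_on[OF bounded_linear_Re]
        bounded_linear.continuous_on[OF bounded_linear_cinner_left]
        bounded_bilinear.continuous_on[OF bounded_bilinear_scaleC] continuous_intros)
  then have "open {p. 0 < \<Phi> p}" by (intro open_Collect_less continuous_intros)
  moreover have "(0, 0) \<in> {p. 0 < \<Phi> p}"
    using v by (simp add: \<Phi>_def rep_A_def scaleC_one cinner_self u_def)
  ultimately obtain S W where S: "open S" "open W" "(0, 0) \<in> S \<times> W" "S \<times> W \<subseteq> {p. 0 < \<Phi> p}"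
    by (rule open_prod_elim)
  obtain V where V: "V \<in> B" "0 \<in> V" "V \<subseteq> W"
    using topological_basisE[OF B S(2), of 0] S(3) by auto
  define V' where "V' = V \<inter> UNIV \<times> {-1<..<1 :: real}"
  have openV': "open V'"
    unfolding V'_def by (intro open_Int open_Times topological_basis_open[OF B V(1)]) auto
  have V'_nonempty: "V' \<noteq> {}" using V by (auto simp: V'_def zero_prod_def)
  have V'_sets[measurable]: "V' \<in> sets M" unfolding sets_M using openV' by (rule borel_open)
  have "emeasure M V' \<le> emeasure M (UNIV \<times> {- 1 .. 1})"
    by (intro emeasure_mono sets_strip) (auto simp: V'_def)
  then have finV': "emeasure M V' < \<infinity>" using emeasure_strip[of 1] by (rule le_less_trans)
  have ind: "indicator V' \<in> L1_L2 M" by (rule indicator_L1_L2[OF V'_sets finV'])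
  have nonzero: "(hs_norm (fourier \<mu> (indicator V') \<delta> \<gamma>))\<^sup>2 \<noteq> 0" if \<gamma>: "\<gamma> \<in> S" for \<gamma>
  proof
    assume "(hs_norm (fourier \<mu> (indicator V') \<delta> \<gamma>))\<^sup>2 = 0"
    then have "fourier \<mu> (indicator V') \<delta> \<gamma> v = 0" by (rule hs_norm_fourier_eq_0[OF \<delta> ind])
    then have zero: "Re (cinner (fourier \<mu> (indicator V') \<delta> \<gamma> v) u) = 0"
      by (simp add: bounded_bilinear.zero_left[OF bounded_bilinear_cinner])
    note lin = bounded_linear_compose[OF bounded_linear_Re bounded_linear_cinner_left[of u]]
    have eq: "Re (cinner (indicator V' a *\<^sub>C rep_A \<delta> \<gamma> a v) u) = indicator V' a * \<Phi> (\<gamma>, a)" for a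
      by (simp add: \<Phi>_def indicator_def cinner_scaleC_left)
    have int: "integrable M (\<lambda>a. indicator V' a * \<Phi> (\<gamma>, a))"
      using integrable_bounded_linear[OF lin integrable_fourier[OF \<delta> ind, of \<gamma> v]] by (simp add: eq)
    have "(LINT a|M. indicator V' a * \<Phi> (\<gamma>, a)) = 0"
      using integral_bounded_linear[OF lin integrable_fourier[OF \<delta> ind, of \<gamma> v]] zero
      by (simp add: eq fourier_eq)
    moreover have pos: "0 < \<Phi> (\<gamma>, a)" if "a \<in> V'" for a
      using that \<gamma> S V by (auto simp: V'_def)
    then have "AE a in M. 0 \<le> indicator V' a * \<Phi> (\<gamma>, a)"
      by (intro AE_I2) (auto simp: indicator_def intro: less_imp_le)
    ultimately have "AE a in M. indicator V' a * \<Phi> (\<gamma>, a) = 0"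
      using integral_nonneg_eq_0_iff_AE[OF int] by simp
    then have "AE a in M. a \<notin> V'" by eventually_elim (use pos in \<open>fastforce simp: indicator_def\<close>)
    then have "emeasure M V' = 0"
      by (subst (asm) AE_iff_measurable[OF _ refl]) (use V'_sets in \<open>auto simp: Collect_neg_eq\<close>)
    then show False using emeasure_M_open_pos[OF openV' V'_nonempty] by simp
  qed
  have meas: "(\<lambda>\<gamma>. (hs_norm (fourier \<mu> (indicator V') \<delta> \<gamma>))\<^sup>2) \<in> borel_measurable dgamma"
    by (intro measurable_hs_norm_gamma) (use measurable_fourier_gamma[OF \<delta> ind] in measurable)
  have "(\<integral>\<^sup>+\<gamma>. (hs_norm (fourier \<mu> (indicator V') \<delta> \<gamma>))\<^sup>2 \<partial>dgamma) \<noteq> 0"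
  proof
    assume "(\<integral>\<^sup>+\<gamma>. (hs_norm (fourier \<mu> (indicator V') \<delta> \<gamma>))\<^sup>2 \<partial>dgamma) = 0"
    then have "AE \<gamma> in lborel. (hs_norm (fourier \<mu> (indicator V') \<delta> \<gamma>))\<^sup>2 = 0"
      unfolding nn_integral_0_iff_AE[OF meas] AE_dgamma .
    then have "AE \<gamma> in lborel. \<gamma> \<notin> S" by eventually_elim (use nonzero in blast)
    then have "emeasure lborel S = 0"
      by (subst (asm) AE_iff_measurable[OF _ refl]) (use S in \<open>auto simp: Collect_neg_eq\<close>)
    then show False using emeasure_lborel_open_pos[OF S(1)] S(3) by auto
  qed
  then show ?thesis using V(1) unfolding V'_def by blast
qed

end

locale plancherel_group = compact_group_times_real \<mu>
  for \<mu> :: "'l::{topological_group_add, second_countable_topology, t2_space} measure" +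
  fixes \<nu> :: "'l rep set measure"
  assumes plancherel: "plancherel_measure \<mu> \<nu>"
begin

text \<open>
  The weights of the points of the dual. Only points of positive weight contribute to an integral,
  hence \<open>supp\<close> takes the place of the dual in all computations.
\<close>

definition weight :: "'l rep set \<Rightarrow> real" where
  "weight = (SOME w. \<nu> = density (count_space unitary_dual) (\<lambda>\<delta>. ennreal (w \<delta>)))"

definition supp :: "'l rep set set" where
  "supp = {\<delta>\<in>unitary_dual. 0 < weight \<delta>}"

lemma nu_eq: "\<nu> = density (count_space unitary_dual) (\<lambda>\<delta>. ennreal (weight \<delta>))"
  unfolding weight_def using plancherel unfolding plancherel_measure_def
  by (intro someI_ex[of "\<lambda>w. \<nu> = density (count_space unitary_dual) (\<lambda>\<delta>. ennreal (w \<delta>))"]) simp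

lemma suppD: "\<delta> \<in> supp \<Longrightarrow> \<delta> \<in> unitary_dual"
  by (simp add: supp_def)

lemma measurable_nu[measurable]: "g \<in> borel_measurable \<nu>"
  by (subst nu_eq) simp

lemma nn_integral_nu:
  "(\<integral>\<^sup>+\<delta>. g \<delta> \<partial>\<nu>) = (\<integral>\<^sup>+\<delta>. ennreal (weight \<delta>) * g \<delta> \<partial>count_space supp)"
proof -
  have "(\<integral>\<^sup>+\<delta>. g \<delta> \<partial>\<nu>) = (\<integral>\<^sup>+\<delta>. ennreal (weight \<delta>) * g \<delta> \<partial>count_space unitary_dual)"
    by (subst nu_eq) (simp add: nn_integral_density)
  also have "\<dots> = (\<integral>\<^sup>+\<delta>. ennreal (weight \<delta>) * g \<delta> \<partial>count_space supp)"
    by (rule nn_integral_count_space_eq) (auto simp: supp_def ennreal_neg)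
  finally show ?thesis .
qed

lemma AE_nu: "(AE \<delta> in \<nu>. P \<delta>) \<longleftrightarrow> (\<forall>\<delta>\<in>supp. P \<delta>)"
  by (subst nu_eq) (auto simp: AE_density AE_count_space supp_def)

text \<open>The squared norm of a field of operators in the direct integral of the Hilbert--Schmidt spaces.\<close>

definition plancherel_norm2 :: "('l rep set \<Rightarrow> real \<Rightarrow> ell2 \<Rightarrow> ell2) \<Rightarrow> ennreal" where
  "plancherel_norm2 T = (\<integral>\<^sup>+\<delta>. \<integral>\<^sup>+\<gamma>. (hs_norm (T \<delta> \<gamma>))\<^sup>2 \<partial>dgamma \<partial>\<nu>)"

lemma plancherel_formula:
  "f \<in> L1_L2 M \<Longrightarrow> plancherel_norm2 (fourier \<mu> f) = (\<integral>\<^sup>+a. ennreal ((cmod (f a))\<^sup>2) \<partial>M)"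
  using plancherel by (simp add: plancherel_measure_def plancherel_norm2_def)

lemma plancherel_formula_diff:
  assumes f: "f \<in> L1_L2 M" and g: "g \<in> L1_L2 M"
  shows "plancherel_norm2 (\<lambda>\<delta> \<gamma> v. fourier \<mu> f \<delta> \<gamma> v - fourier \<mu> g \<delta> \<gamma> v)
    = ennreal (LINT a|M. (cmod (f a - g a))\<^sup>2)"
proof -
  have d: "(\<lambda>x. f x - g x) \<in> L1_L2 M" by (rule L1_L2_diff[OF f g])
  have "(\<lambda>v. fourier \<mu> f \<delta> \<gamma> v - fourier \<mu> g \<delta> \<gamma> v) = fourier \<mu> (\<lambda>x. f x - g x) \<delta> \<gamma>"
    if "\<delta> \<in> supp" for \<delta> \<gamma>
    using fourier_diff[OF suppD[OF that] f g] by auto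
  then have "plancherel_norm2 (\<lambda>\<delta> \<gamma> v. fourier \<mu> f \<delta> \<gamma> v - fourier \<mu> g \<delta> \<gamma> v)
      = plancherel_norm2 (fourier \<mu> (\<lambda>x. f x - g x))"
    unfolding plancherel_norm2_def nn_integral_nu by (intro nn_integral_cong) simp
  also have "\<dots> = ennreal (LINT a|M. (cmod (f a - g a))\<^sup>2)"
    unfolding plancherel_formula[OF d] by (rule L2_nn_integral[OF L1_L2_D(1)[OF d]])
  finally show ?thesis .
qed

lemma plancherel_norm2_liminf:
  assumes meas: "\<And>m \<delta> v. \<delta> \<in> supp \<Longrightarrow> (\<lambda>\<gamma>. T m \<delta> \<gamma> v) \<in> borel_measurable borel"
    and lim: "\<And>\<delta>. \<delta> \<in> supp \<Longrightarrow> AE \<gamma> in dgamma. \<forall>n. (\<lambda>m. T m \<delta> \<gamma> (ket n)) \<longlonglongrightarrow> T' \<delta> \<gamma> (ket n)"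
  shows "plancherel_norm2 T' \<le> liminf (\<lambda>m. plancherel_norm2 (T m))"
proof -
  have "ennreal (weight \<delta>) * (\<integral>\<^sup>+\<gamma>. (hs_norm (T' \<delta> \<gamma>))\<^sup>2 \<partial>dgamma)
      \<le> liminf (\<lambda>m. ennreal (weight \<delta>) * (\<integral>\<^sup>+\<gamma>. (hs_norm (T m \<delta> \<gamma>))\<^sup>2 \<partial>dgamma))"
    if \<delta>: "\<delta> \<in> supp" for \<delta>
  proof -
    have "(\<integral>\<^sup>+\<gamma>. (hs_norm (T' \<delta> \<gamma>))\<^sup>2 \<partial>dgamma)
        \<le> (\<integral>\<^sup>+\<gamma>. liminf (\<lambda>m. (hs_norm (T m \<delta> \<gamma>))\<^sup>2) \<partial>dgamma)"
      using lim[OF \<delta>] by (intro nn_integral_mono_AE) (auto elim!: eventually_mono intro: hs_norm_liminf)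
    also have "\<dots> \<le> liminf (\<lambda>m. \<integral>\<^sup>+\<gamma>. (hs_norm (T m \<delta> \<gamma>))\<^sup>2 \<partial>dgamma)"
      by (intro nn_integral_liminf measurable_hs_norm_gamma) (use meas[OF \<delta>] in measurable)
    finally show ?thesis by (simp add: liminf_cmult_ennreal mult_left_mono)
  qed
  then have "plancherel_norm2 T' \<le> (\<integral>\<^sup>+\<delta>. liminf (\<lambda>m. ennreal (weight \<delta>) *
      (\<integral>\<^sup>+\<gamma>. (hs_norm (T m \<delta> \<gamma>))\<^sup>2 \<partial>dgamma)) \<partial>count_space supp)"
    unfolding plancherel_norm2_def nn_integral_nu by (intro nn_integral_mono) simp
  also have "\<dots> \<le> liminf (\<lambda>m. plancherel_norm2 (T m))"
    unfolding plancherel_norm2_def nn_integral_nu by (rule nn_integral_liminf) simp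
  finally show ?thesis .
qed

text \<open>
  Each of the countably many indicator functions of \<open>fourier_nonvanishing\<close> has a Fourier transform
  that is nonzero at countably many \<open>\<delta>\<close> only, by the Plancherel formula.
\<close>

lemma countable_supp: "countable supp"
proof -
  obtain B :: "('l \<times> real) set set" where B: "countable B" "topological_basis B"
    using ex_countable_basis by blast
  define I where "I V \<delta> = (\<integral>\<^sup>+\<gamma>. (hs_norm (fourier \<mu> (indicator (V \<inter> UNIV \<times> {-1<..<1})) \<delta> \<gamma>))\<^sup>2 \<partial>dgamma)"
    for V \<delta>
  have "countable {\<delta>\<in>supp. I V \<delta> \<noteq> 0}" if V: "V \<in> B" for V
  proof -
    let ?V = "V \<inter> UNIV \<times> {-1<..<1 :: real}"
    have V_sets: "?V \<in> sets M"
      unfolding sets_M by (intro borel_open open_Int open_Times topological_basis_open[OF B(2) V]) auto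
    have "emeasure M ?V \<le> emeasure M (UNIV \<times> {- 1 .. 1})"
      by (intro emeasure_mono sets_strip) auto
    then have fin: "emeasure M ?V < \<infinity>" using emeasure_strip[of 1] by (rule le_less_trans)
    have ind: "indicator ?V \<in> L1_L2 M" by (rule indicator_L1_L2[OF V_sets fin])
    have "(\<integral>\<^sup>+\<delta>. ennreal (weight \<delta>) * I V \<delta> \<partial>count_space supp) < \<infinity>"
      using plancherel_formula[OF ind] L2_nn_integral[OF L1_L2_D(1)[OF ind]]
      unfolding plancherel_norm2_def nn_integral_nu by (simp add: I_def)
    from countable_support_nn_integral[OF this] show ?thesis
      by (rule countable_subset[rotated]) (auto simp: supp_def)
  qed
  then have "countable (\<Union>V\<in>B. {\<delta>\<in>supp. I V \<delta> \<noteq> 0})" using B(1) by (intro countable_UN)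
  moreover have "supp \<subseteq> (\<Union>V\<in>B. {\<delta>\<in>supp. I V \<delta> \<noteq> 0})"
    using fourier_nonvanishing[OF suppD B(2)] unfolding I_def by blast
  ultimately show ?thesis by (rule countable_subset[rotated])
qed

end

lemma L2_dist_le:
  assumes "f \<in> L2 M" "g \<in> L2 M" "h \<in> L2 M"
  shows "(LINT x|M. (cmod (g x - h x))\<^sup>2)
    \<le> 2 * (LINT x|M. (cmod (g x - f x))\<^sup>2) + 2 * (LINT x|M. (cmod (h x - f x))\<^sup>2)"
proof -
  have int: "integrable M (\<lambda>x. (cmod (u x - v x))\<^sup>2)" if "u \<in> L2 M" "v \<in> L2 M" for u v
    using L2_diff[OF that] by (simp add: L2_def)
  have "(LINT x|M. (cmod (g x - h x))\<^sup>2)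
      \<le> (LINT x|M. 2 * (cmod (g x - f x))\<^sup>2 + 2 * (cmod (h x - f x))\<^sup>2)"
  proof (rule integral_mono)
    show "integrable M (\<lambda>x. 2 * (cmod (g x - f x))\<^sup>2 + 2 * (cmod (h x - f x))\<^sup>2)"
      using int assms by simp
    show "(cmod (g x - h x))\<^sup>2 \<le> 2 * (cmod (g x - f x))\<^sup>2 + 2 * (cmod (h x - f x))\<^sup>2" for x
      using sq_sum_le[of "g x - f x" "f x - h x"] by (simp add: norm_minus_commute[of "f x"])
  qed (use int assms in simp)
  then show ?thesis using int assms by simp
qed

lemma bounded_clinear_limit:
  assumes lim: "\<And>v. (\<lambda>n. T n v) \<longlonglongrightarrow> T' v" and T: "\<And>n. bounded_clinear (T n)"
    and bound: "\<And>n v. norm (T n v) \<le> B * norm v"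
  shows "bounded_clinear T'"
  unfolding bounded_clinear_def
proof
  note lin = bounded_clinear_linear[OF T]
  show "bounded_linear T'"
  proof (rule bounded_linear_intro[where K = B])
    fix v w r
    have "(\<lambda>n. T n v + T n w) \<longlonglongrightarrow> T' v + T' w" by (intro tendsto_add lim)
    then show "T' (v + w) = T' v + T' w"
      using LIMSEQ_unique[OF lim[of "v + w"]] by (simp add: linear_add[OF lin])
    have "(\<lambda>n. r *\<^sub>R T n v) \<longlonglongrightarrow> r *\<^sub>R T' v" by (intro tendsto_scaleR tendsto_const lim)
    then show "T' (r *\<^sub>R v) = r *\<^sub>R T' v"
      using LIMSEQ_unique[OF lim[of "r *\<^sub>R v"]] by (simp add: linear_scale[OF lin])
    show "norm (T' v) \<le> norm v * B"
      using bound by (intro LIMSEQ_le_const2[OF tendsto_norm[OF lim]]) (auto simp: mult.commute)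
  qed
  show "\<forall>c v. T' (c *\<^sub>C v) = c *\<^sub>C T' v"
  proof safe
    fix c v
    have "(\<lambda>n. c *\<^sub>C T n v) \<longlonglongrightarrow> c *\<^sub>C T' v"
      by (rule bounded_linear.tendsto[OF bounded_linear_scaleC_right lim])
    then show "T' (c *\<^sub>C v) = c *\<^sub>C T' v"
      using LIMSEQ_unique[OF lim[of "c *\<^sub>C v"]] T by (simp add: bounded_clinear_def)
  qed
qed

context plancherel_group
begin

text \<open>
  This is the completeness of \<open>L\<^sup>2\<close>: along a sequence of truncations of \<open>f\<close> that converges fast
  enough, the Fourier transforms converge almost everywhere in the Hilbert--Schmidt norm, hence
  strongly, and by Fatou's lemma the limit does not depend on the sequence.
\<close>

lemma plancherel_extension_exists:
  assumes f: "f \<in> L2 M"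
  shows "\<exists>F. plancherel_extension \<mu> \<nu> f F"
proof -
  define s where "s n = (LINT a|M. (cmod (truncation n f a - f a))\<^sup>2)" for n
  \<comment> \<open>The rate \<open>8\<^sup>-\<^sup>k\<close> leaves room for the weights \<open>2\<^sup>k\<close> below; the factor \<open>1/4\<close> is absorbed by
    \<open>|x + y|\<^sup>2 \<le> 2 |x|\<^sup>2 + 2 |y|\<^sup>2\<close>.\<close>
  have "\<exists>n. s n \<le> (1 / 8) ^ k / 4" for k
  proof -
    have "s \<longlonglongrightarrow> 0" unfolding s_def[abs_def] by (rule truncation_tendsto_L2[OF f])
    then have "\<forall>\<^sub>F n in sequentially. s n < (1 / 8) ^ k / 4" by (rule order_tendstoD) simp
    then show ?thesis by (meson eventually_sequentially less_imp_le order_refl)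
  qed
  then obtain r where r: "\<And>k. s (r k) \<le> (1 / 8) ^ k / 4" by metis
  define \<phi> where "\<phi> k = truncation (r k) f" for k
  have \<phi>: "\<phi> k \<in> L1_L2 M" for k unfolding \<phi>_def by (rule truncation_L1_L2[OF f])
  define d where "d k a = \<phi> (Suc k) a - \<phi> k a" for k a
  have d: "d k \<in> L1_L2 M" for k unfolding d_def[abs_def] by (rule L1_L2_diff[OF \<phi> \<phi>])
  have dle: "(LINT a|M. (cmod (d k a))\<^sup>2) \<le> (1 / 8) ^ k" for k
  proof -
    have "(LINT a|M. (cmod (d k a))\<^sup>2) \<le> 2 * s (r (Suc k)) + 2 * s (r k)"
      unfolding d_def s_def \<phi>_def[symmetric]
      by (rule L2_dist_le[OF f L1_L2_D(1)[OF \<phi>] L1_L2_D(1)[OF \<phi>]])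
    also have "\<dots> \<le> 2 * ((1 / 8) ^ Suc k / 4) + 2 * ((1 / 8) ^ k / 4)"
      by (intro add_mono mult_left_mono r) auto
    also have "\<dots> \<le> (1 / 8) ^ k" by (simp add: field_simps)
    finally show ?thesis .
  qed
  define e where "e k \<delta> \<gamma> = (hs_norm (fourier \<mu> (d k) \<delta> \<gamma>))\<^sup>2" for k \<delta> \<gamma>
  \<comment> \<open>The weights \<open>2\<^sup>k\<close> still give a finite integral, and they force the differences to decay
    geometrically wherever \<open>E\<close> is finite.\<close>
  define E where "E \<delta> \<gamma> = (\<Sum>k. ennreal (2 ^ k) * e k \<delta> \<gamma>)" for \<delta> \<gamma>
  have em[measurable]: "e k \<delta> \<in> borel_measurable borel" if "\<delta> \<in> unitary_dual" for k \<delta>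
    unfolding e_def[abs_def] by (intro measurable_hs_norm_gamma measurable_fourier_gamma that d)
  have Em[measurable]: "E \<delta> \<in> borel_measurable borel" if "\<delta> \<in> unitary_dual" for \<delta>
    unfolding E_def[abs_def] using that by measurable
  have "(\<integral>\<^sup>+\<delta>. ennreal (weight \<delta>) * (\<integral>\<^sup>+\<gamma>. E \<delta> \<gamma> \<partial>dgamma) \<partial>count_space supp)
      = (\<integral>\<^sup>+\<delta>. (\<Sum>k. ennreal (2 ^ k) * (ennreal (weight \<delta>) * (\<integral>\<^sup>+\<gamma>. e k \<delta> \<gamma> \<partial>dgamma))) \<partial>count_space supp)"
  proof (rule nn_integral_cong)
    fix \<delta> assume "\<delta> \<in> space (count_space supp)"
    then have \<delta>: "\<delta> \<in> unitary_dual" by (simp add: supp_def)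
    have [measurable]: "e k \<delta> \<in> borel_measurable dgamma" for k using em[OF \<delta>] by measurable
    have "(\<integral>\<^sup>+\<gamma>. E \<delta> \<gamma> \<partial>dgamma) = (\<Sum>k. ennreal (2 ^ k) * (\<integral>\<^sup>+\<gamma>. e k \<delta> \<gamma> \<partial>dgamma))"
      unfolding E_def by (simp add: nn_integral_suminf nn_integral_cmult)
    then show "ennreal (weight \<delta>) * (\<integral>\<^sup>+\<gamma>. E \<delta> \<gamma> \<partial>dgamma)
        = (\<Sum>k. ennreal (2 ^ k) * (ennreal (weight \<delta>) * (\<integral>\<^sup>+\<gamma>. e k \<delta> \<gamma> \<partial>dgamma)))"
      by (simp add: mult.left_commute flip: ennreal_suminf_cmult)
  qed
  also have "\<dots> = (\<Sum>k. ennreal (2 ^ k) * plancherel_norm2 (fourier \<mu> (d k)))"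
    unfolding plancherel_norm2_def nn_integral_nu
    by (simp add: nn_integral_suminf nn_integral_cmult e_def)
  also have "\<dots> \<le> (\<Sum>k. ennreal ((1 / 4) ^ k))"
  proof (intro suminf_le summableI)
    fix k
    have "ennreal (2 ^ k) * plancherel_norm2 (fourier \<mu> (d k)) \<le> ennreal (2 ^ k) * ennreal ((1 / 8) ^ k)"
      unfolding plancherel_formula[OF d] L2_nn_integral[OF L1_L2_D(1)[OF d]]
      by (intro mult_left_mono ennreal_leI dle) simp
    also have "\<dots> = ennreal ((1 / 4) ^ k)"
      by (simp flip: ennreal_mult power_mult_distrib)
    finally show "ennreal (2 ^ k) * plancherel_norm2 (fourier \<mu> (d k)) \<le> ennreal ((1 / 4) ^ k)" .
  qed
  also have "\<dots> = ennreal (\<Sum>k. (1 / 4) ^ k)"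
    by (intro suminf_ennreal2 summable_geometric) auto
  also have "\<dots> < \<infinity>" by simp
  finally have fin: "(\<integral>\<^sup>+\<delta>. ennreal (weight \<delta>) * (\<integral>\<^sup>+\<gamma>. E \<delta> \<gamma> \<partial>dgamma) \<partial>count_space supp) < \<infinity>" .
  have AE_E: "AE \<gamma> in dgamma. E \<delta> \<gamma> < \<infinity>" if \<delta>: "\<delta> \<in> supp" for \<delta>
  proof -
    have "ennreal (weight \<delta>) * (\<integral>\<^sup>+\<gamma>. E \<delta> \<gamma> \<partial>dgamma) < \<infinity>"
      using nn_integral_ge_point[OF \<delta>, of "\<lambda>\<delta>. ennreal (weight \<delta>) * (\<integral>\<^sup>+\<gamma>. E \<delta> \<gamma> \<partial>dgamma)"] fin
      by (rule le_less_trans)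
    then have "(\<integral>\<^sup>+\<gamma>. E \<delta> \<gamma> \<partial>dgamma) \<noteq> \<infinity>" using \<delta> by (auto simp: supp_def ennreal_mult_less_top)
    moreover have "E \<delta> \<in> borel_measurable dgamma" using Em[OF suppD[OF \<delta>]] by measurable
    ultimately have "AE \<gamma> in dgamma. E \<delta> \<gamma> \<noteq> \<infinity>" by (intro nn_integral_noteq_infinite)
    then show ?thesis by (auto simp: less_top)
  qed
  define c where "c = sqrt (1 / 2 :: real)"
  have c: "0 \<le> c" "c < 1" "c\<^sup>2 = 1 / 2" unfolding c_def by (auto simp: real_sqrt_lt_1_iff)
  have conv: "convergent (\<lambda>n. fourier \<mu> (\<phi> n) \<delta> \<gamma> v)"
    and bound: "\<exists>B. \<forall>n v. norm (fourier \<mu> (\<phi> n) \<delta> \<gamma> v) \<le> B * norm v"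
    if \<delta>: "\<delta> \<in> unitary_dual" and fin: "E \<delta> \<gamma> < \<infinity>" for \<delta> \<gamma> v
  proof -
    obtain x where x: "E \<delta> \<gamma> = ennreal x" "0 \<le> x" using fin by (cases "E \<delta> \<gamma>") auto
    have dk: "fourier \<mu> (\<phi> (Suc k)) \<delta> \<gamma> v - fourier \<mu> (\<phi> k) \<delta> \<gamma> v = fourier \<mu> (d k) \<delta> \<gamma> v" for k v
      unfolding d_def by (rule fourier_diff[OF \<delta> \<phi> \<phi>, symmetric])
    have small: "norm (fourier \<mu> (d k) \<delta> \<gamma> v) \<le> norm v * sqrt x * c ^ k" for k v
    proof (rule power2_le_imp_le)
      have "ennreal (2 ^ k) * e k \<delta> \<gamma> \<le> E \<delta> \<gamma>"
        unfolding E_def using sum_le_suminf[of "\<lambda>k. ennreal (2 ^ k) * e k \<delta> \<gamma>" "{k}"] by simp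
      have "ennreal (2 ^ k * (norm (fourier \<mu> (d k) \<delta> \<gamma> v))\<^sup>2)
          \<le> ennreal (2 ^ k) * (ennreal ((norm v)\<^sup>2) * e k \<delta> \<gamma>)"
        unfolding e_def using norm_le_hs_norm[OF adjoint_fourier[OF \<delta> d]]
        by (simp add: ennreal_mult mult_left_mono)
      also have "\<dots> = ennreal ((norm v)\<^sup>2) * (ennreal (2 ^ k) * e k \<delta> \<gamma>)" by (simp add: ac_simps)
      also have "\<dots> \<le> ennreal ((norm v)\<^sup>2) * ennreal x"
        using \<open>_ \<le> E \<delta> \<gamma>\<close> by (intro mult_left_mono) (simp_all add: x)
      also have "\<dots> = ennreal ((norm v)\<^sup>2 * x)" using x by (simp add: ennreal_mult)
      finally have "2 ^ k * (norm (fourier \<mu> (d k) \<delta> \<gamma> v))\<^sup>2 \<le> (norm v)\<^sup>2 * x"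
        using x by (simp add: ennreal_le_iff)
      moreover have "(norm v * sqrt x * c ^ k)\<^sup>2 = (norm v)\<^sup>2 * x / 2 ^ k"
        using x by (simp add: power_mult_distrib power_divide c flip: power_mult)
          (simp add: power_mult mult.commute[of k] c power_divide)
      ultimately show "(norm (fourier \<mu> (d k) \<delta> \<gamma> v))\<^sup>2 \<le> (norm v * sqrt x * c ^ k)\<^sup>2"
        by (simp only:) (simp add: field_simps)
    qed (use c x in simp)
    have geom: "summable (\<lambda>k. c ^ k)" using c by (intro summable_geometric) simp
    have sum: "(\<Sum>k<n. fourier \<mu> (d k) \<delta> \<gamma> v) = fourier \<mu> (\<phi> n) \<delta> \<gamma> v - fourier \<mu> (\<phi> 0) \<delta> \<gamma> v"
      for n v
      unfolding dk[symmetric] by (rule sum_lessThan_telescope)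
    have "summable (\<lambda>k. fourier \<mu> (d k) \<delta> \<gamma> v)"
      by (rule summable_comparison_test'[OF summable_mult[OF geom] small])
    then have "convergent (\<lambda>n. (\<Sum>k<n. fourier \<mu> (d k) \<delta> \<gamma> v) + fourier \<mu> (\<phi> 0) \<delta> \<gamma> v)"
      by (intro convergent_add convergent_const) (simp add: summable_iff_convergent)
    then show "convergent (\<lambda>n. fourier \<mu> (\<phi> n) \<delta> \<gamma> v)" by (simp add: sum)
    have "norm (fourier \<mu> (\<phi> n) \<delta> \<gamma> v)
        \<le> ((LINT a|M. cmod (\<phi> 0 a)) + sqrt x * (\<Sum>k. c ^ k)) * norm v" for n v
    proof -
      have "norm (fourier \<mu> (\<phi> n) \<delta> \<gamma> v)
          \<le> norm (fourier \<mu> (\<phi> 0) \<delta> \<gamma> v) + norm (\<Sum>k<n. fourier \<mu> (d k) \<delta> \<gamma> v)"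
        unfolding sum using norm_triangle_ineq[of "fourier \<mu> (\<phi> 0) \<delta> \<gamma> v"
            "fourier \<mu> (\<phi> n) \<delta> \<gamma> v - fourier \<mu> (\<phi> 0) \<delta> \<gamma> v"] by simp
      also have "norm (\<Sum>k<n. fourier \<mu> (d k) \<delta> \<gamma> v) \<le> (\<Sum>k<n. norm v * sqrt x * c ^ k)"
        by (rule sum_norm_le[OF small])
      also have "\<dots> = norm v * sqrt x * (\<Sum>k<n. c ^ k)" by (simp add: sum_distrib_left)
      also have "\<dots> \<le> norm v * sqrt x * (\<Sum>k. c ^ k)"
        using c x by (intro mult_left_mono sum_le_suminf geom) auto
      finally show ?thesis using norm_fourier_le[OF \<delta> \<phi>, of 0 \<gamma> v] by (simp add: algebra_simps)
    qed
    then show "\<exists>B. \<forall>n v. norm (fourier \<mu> (\<phi> n) \<delta> \<gamma> v) \<le> B * norm v" by blast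
  qed
  define F where "F \<delta> \<gamma> v = (if \<delta> \<in> unitary_dual \<and> E \<delta> \<gamma> < \<infinity>
      then lim (\<lambda>n. fourier \<mu> (\<phi> n) \<delta> \<gamma> v) else 0)" for \<delta> \<gamma> v
  have F_lim: "(\<lambda>n. fourier \<mu> (\<phi> n) \<delta> \<gamma> v) \<longlonglongrightarrow> F \<delta> \<gamma> v"
    if "\<delta> \<in> unitary_dual" "E \<delta> \<gamma> < \<infinity>" for \<delta> \<gamma> v
    using conv[OF that] that by (simp add: F_def convergent_LIMSEQ_iff)
  have Fm[measurable]: "(\<lambda>\<gamma>. F \<delta> \<gamma> v) \<in> borel_measurable borel" for \<delta> v
  proof (cases "\<delta> \<in> unitary_dual")
    case True
    have [measurable]: "(\<lambda>\<gamma>. fourier \<mu> (\<phi> n) \<delta> \<gamma> v) \<in> borel_measurable borel" for n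
      by (rule measurable_fourier_gamma[OF True \<phi>])
    have [measurable]: "E \<delta> \<in> borel_measurable borel" by (rule Em[OF True])
    show ?thesis unfolding F_def by measurable
  qed (simp add: F_def)
  have "plancherel_extension \<mu> \<nu> f F"
    unfolding plancherel_extension_def
  proof (intro conjI allI impI)
    fix \<delta> \<gamma>
    show "bounded_clinear (F \<delta> \<gamma>)"
    proof (cases "\<delta> \<in> unitary_dual \<and> E \<delta> \<gamma> < \<infinity>")
      case True
      then obtain B where B: "\<And>n v. norm (fourier \<mu> (\<phi> n) \<delta> \<gamma> v) \<le> B * norm v"
        using bound by blast
      show ?thesis
        by (rule bounded_clinear_limit[OF F_lim bounded_clinear_fourier[OF _ \<phi>] B]) (use True in auto)
    next
      case False
      then have "F \<delta> \<gamma> = (\<lambda>v. 0)" by (auto simp: F_def)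
      then show ?thesis
        by (simp add: bounded_clinear_def bounded_bilinear.zero_right[OF bounded_bilinear_scaleC])
    qed
  next
    fix g assume g: "(\<forall>k. g k \<in> L1_L2 M) \<and> (\<lambda>k. LINT a|M. (cmod (g k a - f a))\<^sup>2) \<longlonglongrightarrow> 0"
    \<comment> \<open>Compare with \<open>\<phi> m\<close> for \<open>m \<rightarrow> \<infinity>\<close>, where the Plancherel formula applies.\<close>
    have le: "plancherel_norm2 (\<lambda>\<delta> \<gamma> v. fourier \<mu> (g k) \<delta> \<gamma> v - F \<delta> \<gamma> v)
        \<le> ennreal (2 * (LINT a|M. (cmod (g k a - f a))\<^sup>2))" for k
    proof -
      have gk: "g k \<in> L1_L2 M" using g by simp
      have "plancherel_norm2 (\<lambda>\<delta> \<gamma> v. fourier \<mu> (g k) \<delta> \<gamma> v - F \<delta> \<gamma> v)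
          \<le> liminf (\<lambda>m. plancherel_norm2 (\<lambda>\<delta> \<gamma> v. fourier \<mu> (g k) \<delta> \<gamma> v - fourier \<mu> (\<phi> m) \<delta> \<gamma> v))"
      proof (rule plancherel_norm2_liminf)
        show "(\<lambda>\<gamma>. fourier \<mu> (g k) \<delta> \<gamma> v - fourier \<mu> (\<phi> m) \<delta> \<gamma> v) \<in> borel_measurable borel"
          if "\<delta> \<in> supp" for m \<delta> v
          by (intro borel_measurable_diff measurable_fourier_gamma suppD[OF that] gk \<phi>)
        show "AE \<gamma> in dgamma. \<forall>n. (\<lambda>m. fourier \<mu> (g k) \<delta> \<gamma> (ket n) - fourier \<mu> (\<phi> m) \<delta> \<gamma> (ket n))
            \<longlonglongrightarrow> fourier \<mu> (g k) \<delta> \<gamma> (ket n) - F \<delta> \<gamma> (ket n)" if "\<delta> \<in> supp" for \<delta>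
          using AE_E[OF that]
          by eventually_elim (intro allI tendsto_diff tendsto_const F_lim suppD[OF that])
      qed
      also have "\<dots> \<le> liminf (\<lambda>m. ennreal (2 * (LINT a|M. (cmod (g k a - f a))\<^sup>2) + 2 * ((1 / 8) ^ m / 4)))"
      proof (intro Liminf_mono always_eventually allI)
        fix m
        have "(LINT a|M. (cmod (g k a - \<phi> m a))\<^sup>2)
            \<le> 2 * (LINT a|M. (cmod (g k a - f a))\<^sup>2) + 2 * s (r m)"
          unfolding s_def \<phi>_def[symmetric]
          by (rule L2_dist_le[OF f L1_L2_D(1)[OF gk] L1_L2_D(1)[OF \<phi>]])
        then show "plancherel_norm2 (\<lambda>\<delta> \<gamma> v. fourier \<mu> (g k) \<delta> \<gamma> v - fourier \<mu> (\<phi> m) \<delta> \<gamma> v)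
            \<le> ennreal (2 * (LINT a|M. (cmod (g k a - f a))\<^sup>2) + 2 * ((1 / 8) ^ m / 4))"
          unfolding plancherel_formula_diff[OF gk \<phi>] using r[of m] by (intro ennreal_leI) simp
      qed
      also have "\<dots> = ennreal (2 * (LINT a|M. (cmod (g k a - f a))\<^sup>2) + 2 * (0 / 4))"
        by (intro lim_imp_Liminf tendsto_ennrealI tendsto_intros LIMSEQ_power_zero) auto
      finally show ?thesis by simp
    qed
    have "(\<lambda>k. ennreal (2 * (LINT a|M. (cmod (g k a - f a))\<^sup>2))) \<longlonglongrightarrow> ennreal (2 * 0)"
      using g by (intro tendsto_ennrealI tendsto_mult tendsto_const) simp
    then have to_0: "(\<lambda>k. ennreal (2 * (LINT a|M. (cmod (g k a - f a))\<^sup>2))) \<longlonglongrightarrow> 0" by simp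
    have "(\<lambda>k. plancherel_norm2 (\<lambda>\<delta> \<gamma> v. fourier \<mu> (g k) \<delta> \<gamma> v - F \<delta> \<gamma> v)) \<longlonglongrightarrow> 0"
      by (rule tendsto_sandwich[OF always_eventually always_eventually tendsto_const to_0])
        (simp_all add: le)
    then show "(\<lambda>k. \<integral>\<^sup>+\<delta>. \<integral>\<^sup>+\<gamma>. (hs_norm (\<lambda>v. fourier \<mu> (g k) \<delta> \<gamma> v - F \<delta> \<gamma> v))\<^sup>2 \<partial>dgamma \<partial>\<nu>)
        \<longlonglongrightarrow> 0"
      by (simp add: plancherel_norm2_def)
  qed (rule Fm)
  then show ?thesis by blast
qed

lemma plancherel_extension_fourier_L2:
  "f \<in> L2 M \<Longrightarrow> plancherel_extension \<mu> \<nu> f (fourier_L2 \<mu> \<nu> f)"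
  unfolding fourier_L2_def by (rule someI_ex[OF plancherel_extension_exists])

text \<open>
  The operation taking \<open>\<phi>\<close> to \<open>A\<close> multiplies the norms of the Fourier transform by \<open>m\<close>, first for
  truncations and then in the limit.
\<close>

lemma multiplier_bound:
  assumes f: "f \<in> L2 M" and A: "\<And>k. A k \<in> L1_L2 M" and lim: "\<And>a. (\<lambda>k. A k a) \<longlonglongrightarrow> A' a"
    and mult: "\<And>k \<delta> \<gamma> v. \<delta> \<in> unitary_dual \<Longrightarrow>
        norm (fourier \<mu> (A k) \<delta> \<gamma> v) = m \<gamma> * norm (fourier \<mu> (truncation k f) \<delta> \<gamma> v)"
    and m[measurable]: "m \<in> borel_measurable borel" and m2: "\<And>\<gamma>. (m \<gamma>)\<^sup>2 \<le> 4"
  shows "(\<integral>\<^sup>+a. ennreal ((cmod (A' a))\<^sup>2) \<partial>M)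
    \<le> (\<integral>\<^sup>+\<delta>. \<integral>\<^sup>+\<gamma>. ennreal ((m \<gamma>)\<^sup>2) * (hs_norm (fourier_L2 \<mu> \<nu> f \<delta> \<gamma>))\<^sup>2 \<partial>dgamma \<partial>\<nu>)"
    (is "_ \<le> ?Y")
proof -
  define F where "F = fourier_L2 \<mu> \<nu> f"
  define \<phi> where "\<phi> k = truncation k f" for k
  define G where "G k \<delta> \<gamma> = (\<lambda>v. fourier \<mu> (\<phi> k) \<delta> \<gamma> v - F \<delta> \<gamma> v)" for k \<delta> \<gamma>
  have \<phi>: "\<phi> k \<in> L1_L2 M" for k unfolding \<phi>_def by (rule truncation_L1_L2[OF f])
  have ext: "plancherel_extension \<mu> \<nu> f F"
    unfolding F_def by (rule plancherel_extension_fourier_L2[OF f])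
  have Fm[measurable]: "(\<lambda>\<gamma>. F \<delta> \<gamma> v) \<in> borel_measurable borel" for \<delta> v
    using ext by (simp add: plancherel_extension_def)
  have "(\<lambda>k. LINT a|M. (cmod (\<phi> k a - f a))\<^sup>2) \<longlonglongrightarrow> 0"
    unfolding \<phi>_def by (rule truncation_tendsto_L2[OF f])
  then have G0: "(\<lambda>k. plancherel_norm2 (G k)) \<longlonglongrightarrow> 0"
    using ext \<phi> unfolding plancherel_extension_def plancherel_norm2_def G_def by blast
  have "(\<integral>\<^sup>+a. ennreal ((cmod (A' a))\<^sup>2) \<partial>M) = (\<integral>\<^sup>+a. liminf (\<lambda>k. ennreal ((cmod (A k a))\<^sup>2)) \<partial>M)"
    by (intro nn_integral_cong lim_imp_Liminf[symmetric] tendsto_ennrealI tendsto_power tendsto_norm lim)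
      simp
  also have "\<dots> \<le> liminf (\<lambda>k. \<integral>\<^sup>+a. ennreal ((cmod (A k a))\<^sup>2) \<partial>M)"
    by (rule nn_integral_liminf) (use A in measurable)
  also have "\<dots> \<le> ?Y"
  proof (rule le_of_perturbed_bounds)
    have "(\<lambda>k. 4 * plancherel_norm2 (G k)) \<longlonglongrightarrow> 4 * 0"
      by (intro ennreal_tendsto_cmult G0) simp
    then show "(\<lambda>k. 4 * plancherel_norm2 (G k)) \<longlonglongrightarrow> 0" by simp
    fix e :: real and k assume e: "0 < e"
    let ?H = "\<lambda>\<delta> \<gamma>. (hs_norm (F \<delta> \<gamma>))\<^sup>2" and ?D = "\<lambda>\<delta> \<gamma>. (hs_norm (G k \<delta> \<gamma>))\<^sup>2"
    have Hm[measurable]: "?H \<delta> \<in> borel_measurable borel" for \<delta>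
      by (intro measurable_hs_norm_gamma Fm)
    have Dm[measurable]: "?D \<delta> \<in> borel_measurable borel" if "\<delta> \<in> supp" for \<delta>
      unfolding G_def
      by (intro measurable_hs_norm_gamma borel_measurable_diff Fm measurable_fourier_gamma suppD[OF that] \<phi>)
    have point: "(hs_norm (fourier \<mu> (A k) \<delta> \<gamma>))\<^sup>2
        \<le> ennreal (1 + e) * (ennreal ((m \<gamma>)\<^sup>2) * ?H \<delta> \<gamma>) + ennreal (1 + 1 / e) * (4 * ?D \<delta> \<gamma>)"
      if \<delta>: "\<delta> \<in> supp" for \<delta> \<gamma>
    proof -
      have "(hs_norm (fourier \<mu> (A k) \<delta> \<gamma>))\<^sup>2 = ennreal ((m \<gamma>)\<^sup>2) * (hs_norm (fourier \<mu> (\<phi> k) \<delta> \<gamma>))\<^sup>2"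
        unfolding hs_norm_power2 mult[OF suppD[OF \<delta>]] \<phi>_def by (simp add: power_mult_distrib ennreal_mult)
      also have "fourier \<mu> (\<phi> k) \<delta> \<gamma> = (\<lambda>v. F \<delta> \<gamma> v + G k \<delta> \<gamma> v)" by (simp add: G_def)
      also have "ennreal ((m \<gamma>)\<^sup>2) * (hs_norm \<dots>)\<^sup>2
          \<le> ennreal ((m \<gamma>)\<^sup>2) * (ennreal (1 + e) * ?H \<delta> \<gamma> + ennreal (1 + 1 / e) * ?D \<delta> \<gamma>)"
        by (intro mult_left_mono hs_norm_add_power2_le e) simp
      also have "\<dots> = ennreal (1 + e) * (ennreal ((m \<gamma>)\<^sup>2) * ?H \<delta> \<gamma>)
          + ennreal (1 + 1 / e) * (ennreal ((m \<gamma>)\<^sup>2) * ?D \<delta> \<gamma>)"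
        by (simp add: algebra_simps)
      also have "\<dots> \<le> ennreal (1 + e) * (ennreal ((m \<gamma>)\<^sup>2) * ?H \<delta> \<gamma>)
          + ennreal (1 + 1 / e) * (4 * ?D \<delta> \<gamma>)"
        using ennreal_leI[OF m2[of \<gamma>]] by (intro add_mono mult_left_mono mult_right_mono order_refl) auto
      finally show ?thesis .
    qed
    have inner: "(\<integral>\<^sup>+\<gamma>. (hs_norm (fourier \<mu> (A k) \<delta> \<gamma>))\<^sup>2 \<partial>dgamma)
        \<le> ennreal (1 + e) * (\<integral>\<^sup>+\<gamma>. ennreal ((m \<gamma>)\<^sup>2) * ?H \<delta> \<gamma> \<partial>dgamma)
          + ennreal (1 + 1 / e) * (4 * (\<integral>\<^sup>+\<gamma>. ?D \<delta> \<gamma> \<partial>dgamma))" if \<delta>: "\<delta> \<in> supp" for \<delta>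
    proof -
      have [measurable]: "?D \<delta> \<in> borel_measurable dgamma" using Dm[OF \<delta>] by measurable
      have "(\<integral>\<^sup>+\<gamma>. (hs_norm (fourier \<mu> (A k) \<delta> \<gamma>))\<^sup>2 \<partial>dgamma)
          \<le> (\<integral>\<^sup>+\<gamma>. ennreal (1 + e) * (ennreal ((m \<gamma>)\<^sup>2) * ?H \<delta> \<gamma>) + ennreal (1 + 1 / e) * (4 * ?D \<delta> \<gamma>) \<partial>dgamma)"
        by (intro nn_integral_mono point[OF \<delta>])
      also have "\<dots> = ennreal (1 + e) * (\<integral>\<^sup>+\<gamma>. ennreal ((m \<gamma>)\<^sup>2) * ?H \<delta> \<gamma> \<partial>dgamma)
          + ennreal (1 + 1 / e) * (4 * (\<integral>\<^sup>+\<gamma>. ?D \<delta> \<gamma> \<partial>dgamma))"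
        by (simp add: nn_integral_add nn_integral_cmult)
      finally show ?thesis .
    qed
    have "(\<integral>\<^sup>+a. ennreal ((cmod (A k a))\<^sup>2) \<partial>M) = plancherel_norm2 (fourier \<mu> (A k))"
      by (rule plancherel_formula[OF A, symmetric])
    also have "\<dots> \<le> (\<integral>\<^sup>+\<delta>. ennreal (1 + e) * (\<integral>\<^sup>+\<gamma>. ennreal ((m \<gamma>)\<^sup>2) * ?H \<delta> \<gamma> \<partial>dgamma)
          + ennreal (1 + 1 / e) * (4 * (\<integral>\<^sup>+\<gamma>. ?D \<delta> \<gamma> \<partial>dgamma)) \<partial>\<nu>)"
      unfolding plancherel_norm2_def by (intro nn_integral_mono_AE) (simp add: AE_nu inner)
    also have "\<dots> = ennreal (1 + e) * (\<integral>\<^sup>+\<delta>. \<integral>\<^sup>+\<gamma>. ennreal ((m \<gamma>)\<^sup>2) * ?H \<delta> \<gamma> \<partial>dgamma \<partial>\<nu>)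
          + ennreal (1 + 1 / e) * (4 * plancherel_norm2 (G k))"
      unfolding plancherel_norm2_def by (simp add: nn_integral_add nn_integral_cmult)
    finally show "(\<integral>\<^sup>+a. ennreal ((cmod (A k a))\<^sup>2) \<partial>M)
        \<le> ennreal (1 + e) * ?Y + ennreal (1 + 1 / e) * (4 * plancherel_norm2 (G k))"
      by (simp add: F_def)
  qed
  finally show ?thesis .
qed

lemma norm_le_fourier_L2:
  assumes f: "f \<in> L2 M"
  shows "(\<integral>\<^sup>+a. ennreal ((cmod (f a))\<^sup>2) \<partial>M)
    \<le> (\<integral>\<^sup>+\<delta>. \<integral>\<^sup>+\<gamma>. (hs_norm (fourier_L2 \<mu> \<nu> f \<delta> \<gamma>))\<^sup>2 \<partial>dgamma \<partial>\<nu>)"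
  using multiplier_bound[OF f truncation_L1_L2[OF f] truncation_tendsto, of "\<lambda>_. 1"] by simp

lemma cmod_cis_minus_1: "(cmod (cis x - 1))\<^sup>2 \<le> 4" "(cmod (cis x - 1))\<^sup>2 \<le> x\<^sup>2"
proof -
  have eq: "cmod (cis x - 1) = 2 * \<bar>sin (x / 2)\<bar>"
    using dist_exp_i_1[of x] by (simp add: cis_conv_exp)
  have "cmod (cis x - 1) \<le> 2" unfolding eq using abs_sin_le_one[of "x / 2"] by linarith
  then show "(cmod (cis x - 1))\<^sup>2 \<le> 4" using power_mono[of "cmod (cis x - 1)" 2 2] by simp
  have "cmod (cis x - 1) \<le> \<bar>x\<bar>" unfolding eq using abs_sin_x_le_abs_x[of "x / 2"] by simp
  then show "(cmod (cis x - 1))\<^sup>2 \<le> x\<^sup>2" using power_mono[of "cmod (cis x - 1)" "\<bar>x\<bar>" 2] by simp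
qed

text \<open>
  Translation by \<open>s\<close> in the real variable multiplies the Fourier transform by \<open>e\<^sup>-\<^sup>i\<^sup>\<gamma>\<^sup>s\<close>, and
  \<open>|e\<^sup>-\<^sup>i\<^sup>\<gamma>\<^sup>s - 1| \<le> |\<gamma> s|\<close>.
\<close>

lemma difference_bound:
  assumes f: "f \<in> L2 M"
  shows "(\<integral>\<^sup>+a. ennreal ((cmod (f ((0, s) + a) - f a))\<^sup>2) \<partial>M)
    \<le> ennreal (s\<^sup>2) * (\<integral>\<^sup>+\<delta>. \<integral>\<^sup>+\<gamma>. ennreal (\<gamma>\<^sup>2) * (hs_norm (fourier_L2 \<mu> \<nu> f \<delta> \<gamma>))\<^sup>2 \<partial>dgamma \<partial>\<nu>)"
proof -
  define \<phi> where "\<phi> k = truncation k f" for k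
  have \<phi>: "\<phi> k \<in> L1_L2 M" for k unfolding \<phi>_def by (rule truncation_L1_L2[OF f])
  define m where "m \<gamma> = cmod (cis (- (\<gamma> * s)) - 1)" for \<gamma>
  have ext: "plancherel_extension \<mu> \<nu> f (fourier_L2 \<mu> \<nu> f)"
    by (rule plancherel_extension_fourier_L2[OF f])
  have [measurable]: "(\<lambda>\<gamma>. (hs_norm (fourier_L2 \<mu> \<nu> f \<delta> \<gamma>))\<^sup>2) \<in> borel_measurable dgamma" for \<delta>
    by (intro measurable_hs_norm_gamma) (use ext in \<open>simp add: plancherel_extension_def measurable_cong_sets[OF sets_dgamma refl]\<close>)
  have "(\<integral>\<^sup>+a. ennreal ((cmod (f ((0, s) + a) - f a))\<^sup>2) \<partial>M)
    \<le> (\<integral>\<^sup>+\<delta>. \<integral>\<^sup>+\<gamma>. ennreal ((m \<gamma>)\<^sup>2) * (hs_norm (fourier_L2 \<mu> \<nu> f \<delta> \<gamma>))\<^sup>2 \<partial>dgamma \<partial>\<nu>)"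
  proof (rule multiplier_bound[OF f])
    show "(\<lambda>a. \<phi> k ((0, s) + a) - \<phi> k a) \<in> L1_L2 M" for k
      by (intro L1_L2_diff L1_L2_plus \<phi>)
    show "(\<lambda>k. \<phi> k ((0, s) + a) - \<phi> k a) \<longlonglongrightarrow> f ((0, s) + a) - f a" for a
      unfolding \<phi>_def by (intro tendsto_diff truncation_tendsto)
    show "norm (fourier \<mu> (\<lambda>a. \<phi> k ((0, s) + a) - \<phi> k a) \<delta> \<gamma> v)
        = m \<gamma> * norm (fourier \<mu> (truncation k f) \<delta> \<gamma> v)" if \<delta>: "\<delta> \<in> unitary_dual" for k \<delta> \<gamma> v
    proof -
      have "fourier \<mu> (\<lambda>a. \<phi> k ((0, s) + a) - \<phi> k a) \<delta> \<gamma> v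
          = (cis (- (\<gamma> * s)) - 1) *\<^sub>C fourier \<mu> (\<phi> k) \<delta> \<gamma> v"
        unfolding fourier_diff[OF \<delta> L1_L2_plus[OF \<phi>] \<phi>] fourier_translation[OF \<delta> \<phi>]
        by (simp add: bounded_bilinear.diff_left[OF bounded_bilinear_scaleC] scaleC_one)
      then show ?thesis by (simp add: norm_scaleC m_def \<phi>_def)
    qed
    have "continuous_on UNIV m" unfolding m_def by (intro continuous_intros)
    then show "m \<in> borel_measurable borel" by (rule borel_measurable_continuous_onI)
    show "(m \<gamma>)\<^sup>2 \<le> 4" for \<gamma> unfolding m_def by (rule cmod_cis_minus_1)
  qed
  also have "\<dots> \<le> (\<integral>\<^sup>+\<delta>. \<integral>\<^sup>+\<gamma>. ennreal (s\<^sup>2) * (ennreal (\<gamma>\<^sup>2) * (hs_norm (fourier_L2 \<mu> \<nu> f \<delta> \<gamma>))\<^sup>2) \<partial>dgamma \<partial>\<nu>)"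
  proof (intro nn_integral_mono)
    fix \<delta> :: "'l rep set" and \<gamma>
    have "ennreal ((m \<gamma>)\<^sup>2) \<le> ennreal (s\<^sup>2 * \<gamma>\<^sup>2)"
      using cmod_cis_minus_1(2)[of "- (\<gamma> * s)"] unfolding m_def
      by (intro ennreal_leI) (simp add: power_mult_distrib mult.commute)
    then show "ennreal ((m \<gamma>)\<^sup>2) * (hs_norm (fourier_L2 \<mu> \<nu> f \<delta> \<gamma>))\<^sup>2
        \<le> ennreal (s\<^sup>2) * (ennreal (\<gamma>\<^sup>2) * (hs_norm (fourier_L2 \<mu> \<nu> f \<delta> \<gamma>))\<^sup>2)"
      by (simp add: mult_right_mono ennreal_mult flip: mult.assoc)
  qed
  also have "\<dots> = ennreal (s\<^sup>2) * (\<integral>\<^sup>+\<delta>. \<integral>\<^sup>+\<gamma>. ennreal (\<gamma>\<^sup>2) * (hs_norm (fourier_L2 \<mu> \<nu> f \<delta> \<gamma>))\<^sup>2 \<partial>dgamma \<partial>\<nu>)"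
    by (simp add: nn_integral_cmult)
  finally show ?thesis .
qed

end

section \<open>The wavelet transform\<close>

lemma sigma_finite_dgamma: "sigma_finite_measure dgamma"
  unfolding dgamma_def
  by (subst sigma_finite_measure.sigma_finite_iff_density_finite[OF lborel.sigma_finite_measure_axioms])
    auto

locale wavelet_group = plancherel_group \<mu> \<nu>
  for \<mu> :: "'l::{topological_group_add, second_countable_topology, t2_space} measure"
    and \<nu> :: "'l rep set measure" +
  fixes \<beta> :: "'b::{topological_group_add, second_countable_topology, t2_space} measure"
    and \<tau> :: "'b \<Rightarrow> 'l \<times> real \<Rightarrow> 'l \<times> real"
    and \<Delta> :: "'b \<Rightarrow> real"
    and \<psi> :: "'l \<times> real \<Rightarrow> complex"
    and C :: real
  assumes locally_compact_B: "locally compact (UNIV :: 'b set)"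
    and haar_B: "haar_measure \<beta>"
    and action: "automorphism_action \<tau>"
    and modular: "modular_hom M \<tau> \<Delta>"
    and feasible: "feasible_wavelet \<mu> \<beta> \<nu> \<tau> \<Delta> \<psi> C"
begin

lemma sets_beta[measurable_cong]: "sets \<beta> = sets borel"
  using haar_B by (simp add: haar_measure_def)

sublocale B: sigma_finite_measure \<beta>
  by (rule sigma_finite_haar_measure[OF locally_compact_B haar_B])

lemma Delta_pos: "0 < \<Delta> b"
  using modular by (simp add: modular_hom_def)

lemma C_pos: "0 < C"
  using feasible by (simp add: feasible_wavelet_def)

lemma psi: "\<psi> \<in> L1_L2 M"
  using feasible by (simp add: feasible_wavelet_def)

lemma tau_inverse: "\<tau> (- b) (\<tau> b x) = x" "\<tau> b (\<tau> (- b) x) = x"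
proof -
  have comp: "\<tau> (b + c) x = \<tau> b (\<tau> c x)" for b c x
    using action by (simp add: automorphism_action_def)
  have "\<tau> 0 (\<tau> 0 x) = \<tau> 0 x" for x using comp[of 0 0 x] by simp
  moreover have "inj (\<tau> 0)" using action by (simp add: automorphism_action_def bij_is_inj)
  ultimately have "\<tau> 0 x = x" for x by (metis injD)
  then show "\<tau> (- b) (\<tau> b x) = x" "\<tau> b (\<tau> (- b) x) = x"
    using comp[of "- b" b x] comp[of b "- b" x] by simp_all
qed

lemma measurable_tau[measurable (raw)]:
  assumes "f \<in> N \<rightarrow>\<^sub>M borel" "g \<in> N \<rightarrow>\<^sub>M borel"
  shows "(\<lambda>y. \<tau> (f y) (g y)) \<in> N \<rightarrow>\<^sub>M borel"
proof -
  have "continuous_on UNIV (\<lambda>p. \<tau> (fst p) (snd p))"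
    using action by (simp add: automorphism_action_def split_beta)
  from borel_measurable_continuous_Pair[OF assms this] show ?thesis by simp
qed

lemma nn_integral_tau:
  assumes g[measurable]: "g \<in> borel_measurable borel"
  shows "(\<integral>\<^sup>+x. g (\<tau> (- b) x) \<partial>M) = ennreal (1 / \<Delta> b) * (\<integral>\<^sup>+x. g x \<partial>M)"
proof -
  have meas: "\<tau> (- b) \<in> M \<rightarrow>\<^sub>M M" unfolding measurable_M by measurable
  have "distr M M (\<tau> (- b)) = scale_measure (ennreal (1 / \<Delta> b)) M"
  proof (rule measure_eqI)
    fix E assume "E \<in> sets (distr M M (\<tau> (- b)))"
    then have E: "E \<in> sets M" "E \<in> sets borel" by (simp_all add: sets_M[symmetric])
    have "\<tau> (- b) -` E \<inter> space M = \<tau> b ` E"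
      by (auto simp: tau_inverse image_iff) (metis tau_inverse(2))
    then have "emeasure (distr M M (\<tau> (- b))) E = emeasure M (\<tau> b ` E)"
      by (simp add: emeasure_distr[OF meas E(1)])
    also have "\<dots> = ennreal (1 / \<Delta> b) * (ennreal (\<Delta> b) * emeasure M (\<tau> b ` E))"
      using Delta_pos[of b] by (simp add: mult.assoc[symmetric] ennreal_mult[symmetric])
    also have "ennreal (\<Delta> b) * emeasure M (\<tau> b ` E) = emeasure M E"
      using modular E(2) by (simp add: modular_hom_def)
    finally show "emeasure (distr M M (\<tau> (- b))) E = emeasure (scale_measure (ennreal (1 / \<Delta> b)) M) E"
      by simp
  qed simp
  moreover have gM: "g \<in> borel_measurable M" unfolding measurable_M by (rule g)
  ultimately show ?thesis
    using nn_integral_distr[OF meas, of g] by (simp add: nn_integral_scale_measure)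
qed

lemma psi_tau: "\<psi> \<circ> \<tau> (- b) \<in> L1_L2 M"
proof -
  have [measurable]: "\<psi> \<in> borel_measurable borel"
    using psi by (simp add: L1_L2_def L2_def measurable_M)
  have meas: "\<psi> \<circ> \<tau> (- b) \<in> borel_measurable M" unfolding measurable_M comp_def by measurable
  have fin: "(\<integral>\<^sup>+x. ennreal (cmod (\<psi> x)) \<partial>M) < \<infinity>" "(\<integral>\<^sup>+x. ennreal ((cmod (\<psi> x))\<^sup>2) \<partial>M) < \<infinity>"
    using L1_L2_D(2)[OF psi] L1_L2_D(1)[OF psi] unfolding integrable_iff_bounded L2_iff by simp_all
  have "(\<integral>\<^sup>+x. ennreal (cmod (\<psi> (\<tau> (- b) x))) \<partial>M) < \<infinity>"
    using nn_integral_tau[of "\<lambda>x. ennreal (cmod (\<psi> x))" b] fin(1) by (simp add: ennreal_mult_less_top)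
  moreover have "(\<integral>\<^sup>+x. ennreal ((cmod (\<psi> (\<tau> (- b) x)))\<^sup>2) \<partial>M) < \<infinity>"
    using nn_integral_tau[of "\<lambda>x. ennreal ((cmod (\<psi> x))\<^sup>2)" b] fin(2) by (simp add: ennreal_mult_less_top)
  ultimately show ?thesis
    using meas unfolding L1_L2_def L2_iff integrable_iff_bounded comp_def by blast
qed

text \<open>
  For a set \<open>E\<close> of positive finite measure \<open>\<delta>\<^sub>\<tau>(b)\<close> is the quotient of the measures of \<open>E\<close> and
  \<open>\<tau>\<^sub>b(E)\<close>, and the latter is measurable in \<open>b\<close> by Tonelli's theorem.
\<close>

lemma measurable_Delta[measurable]: "\<Delta> \<in> borel_measurable \<beta>"
proof -
  define E :: "('l \<times> real) set" where "E = UNIV \<times> {- 1 .. 1}"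
  define g where "g b = (\<integral>\<^sup>+x. indicator E (\<tau> (- b) x) \<partial>M)" for b
  have [measurable]: "E \<in> sets borel" unfolding E_def sets_M[symmetric] by (rule sets_strip)
  have "(\<lambda>(b, x). indicator E (\<tau> (- b) x) :: ennreal) \<in> borel_measurable (\<beta> \<Otimes>\<^sub>M M)"
  proof -
    have "(\<lambda>(b, x). indicator E (\<tau> (- b) x) :: ennreal) \<in> borel_measurable (borel \<Otimes>\<^sub>M borel)"
      by measurable
    then show ?thesis
      by (subst measurable_cong_sets[OF sets_pair_measure_cong[OF sets_beta sets_M] refl])
  qed
  then have [measurable]: "g \<in> borel_measurable \<beta>"
    unfolding g_def by (rule A.borel_measurable_nn_integral)
  have eq: "g b = ennreal (1 / \<Delta> b) * emeasure M E" for b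
  proof -
    have "E \<in> sets M" unfolding E_def by (rule sets_strip)
    then have "(\<integral>\<^sup>+x. indicator E x \<partial>M) = emeasure M E" by (rule nn_integral_indicator)
    then show ?thesis unfolding g_def using nn_integral_tau[of "indicator E" b] by simp
  qed
  have "0 < emeasure M (UNIV \<times> {- 1 <..< 1})"
    by (intro emeasure_M_open_pos open_Times) auto
  also have "\<dots> \<le> emeasure M E" unfolding E_def by (intro emeasure_mono sets_strip) auto
  finally have pos: "0 < emeasure M E" .
  then have pos': "0 < enn2real (emeasure M E)"
    using emeasure_strip[of 1] by (simp add: E_def enn2real_positive_iff)
  have "\<Delta> b = enn2real (emeasure M E) / enn2real (g b)" for b
    unfolding eq using Delta_pos[of b] pos' by (simp add: enn2real_mult)
  then show ?thesis by (simp add: fun_eq_iff[THEN iffD2, of \<Delta>] cong: measurable_cong)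
qed

text \<open>
  The wavelet transform multiplied by the square root of the density of the Haar measure of the
  wavelet group, so that norms can be computed with respect to the product measure.
\<close>

definition weighted_transform :: "('l \<times> real \<Rightarrow> complex) \<Rightarrow> 'b \<times> 'l \<times> real \<Rightarrow> complex" where
  "weighted_transform f p = complex_of_real (\<Delta> (fst p)) * correlation M f (\<psi> \<circ> \<tau> (- fst p)) (snd p)"

lemma weighted_transform_eq:
  "(cmod (wavelet_transform M \<tau> \<Delta> \<psi> f p))\<^sup>2 * \<Delta> (fst p) = (cmod (weighted_transform f p))\<^sup>2"
proof -
  have "wavelet_transform M \<tau> \<Delta> \<psi> f p
      = complex_of_real (sqrt (\<Delta> (fst p))) * correlation M f (\<psi> \<circ> \<tau> (- fst p)) (snd p)"
    unfolding wavelet_transform_def wavelet_rep_def correlation_def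
    by (simp add: split_beta integral_mult_right_zero[symmetric] mult.left_commute)
  then show ?thesis
    using Delta_pos[of "fst p"]
    by (simp add: weighted_transform_def norm_mult power_mult_distrib power2_eq_square[of "\<Delta> _"])
qed

lemma measurable_correlation:
  assumes f: "f \<in> L2 M"
  shows "(\<lambda>p. correlation M f (\<psi> \<circ> \<tau> (- fst p)) (snd p)) \<in> borel_measurable (\<beta> \<Otimes>\<^sub>M M)"
proof -
  have [measurable]: "f \<in> borel_measurable borel" "\<psi> \<in> borel_measurable borel"
    using f psi by (simp_all add: L1_L2_def L2_def measurable_M)
  have "(\<lambda>(p, x). f x * cnj (\<psi> (\<tau> (- fst p) (- snd p + x)))) \<in> borel_measurable ((\<beta> \<Otimes>\<^sub>M M) \<Otimes>\<^sub>M M)"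
  proof -
    have "(\<lambda>(p, x). f x * cnj (\<psi> (\<tau> (- fst p) (- snd p + x))))
        \<in> borel_measurable ((borel \<Otimes>\<^sub>M borel) \<Otimes>\<^sub>M borel)"
      by measurable
    then show ?thesis
      by (subst measurable_cong_sets[OF sets_pair_measure_cong[OF sets_pair_measure_cong[OF sets_beta sets_M] sets_M] refl])
  qed
  then show ?thesis
    unfolding correlation_def comp_def by (rule A.borel_measurable_lebesgue_integral)
qed

lemma measurable_weighted_transform:
  assumes f: "f \<in> L2 M"
  shows "weighted_transform f \<in> borel_measurable (\<beta> \<Otimes>\<^sub>M M)"
proof -
  have "(\<lambda>p. complex_of_real (\<Delta> (fst p))) \<in> borel_measurable (\<beta> \<Otimes>\<^sub>M M)"
    by (rule measurable_compose[OF measurable_fst]) measurable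
  then show ?thesis
    unfolding weighted_transform_def using measurable_correlation[OF f]
    by (intro borel_measurable_times)
qed

lemma weighted_transform_diff:
  assumes f: "f \<in> L2 M" and g: "g \<in> L2 M"
  shows "weighted_transform (\<lambda>x. f x - g x) p = weighted_transform f p - weighted_transform g p"
  unfolding weighted_transform_def correlation_def right_diff_distrib[symmetric] left_diff_distrib
  by (subst Bochner_Integration.integral_diff)
    (intro L2_integrable_mult(1) L2_plus L1_L2_D(1)[OF psi_tau] f g refl)+

text \<open>Translations in the real variable are central, so they can be moved from \<open>a\<close> to \<open>f\<close>.\<close>

lemma weighted_transform_translation:
  assumes f: "f \<in> L2 M"
  shows "weighted_transform (\<lambda>x. f ((0, s) + x)) (b, a) = weighted_transform f (b, (0, s) + a)"
proof -
  define g where "g = \<psi> \<circ> \<tau> (- b)"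
  have g: "g \<in> L2 M" unfolding g_def by (rule L1_L2_D(1)[OF psi_tau])
  have "(\<lambda>x. f x * cnj (g (- ((0, s) + a) + x))) \<in> borel_measurable M"
    using L2_integrable_mult(1)[OF f L2_plus[OF g]] by (rule borel_measurable_integrable)
  from integral_M_plus(1)[OF this, of "(0, s)"]
  have "correlation M (\<lambda>x. f ((0, s) + x)) g a = correlation M f g ((0, s) + a)"
    unfolding correlation_def minus_add by (simp only: add.assoc minus_add_cancel)
  then show ?thesis by (simp add: weighted_transform_def g_def)
qed

text \<open>
  By the Plancherel formula the left-hand side is a weighted integral over \<open>B\<close> of the squared norms of the
  operators \<open>\<sigma>(f) \<sigma>(\<psi> \<circ> \<tau>\<^bsub>-b\<^esub>)\<^sup>*\<close>, which is what feasibility computes when it is applied to the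
  involution of \<open>f\<close> and \<open>f\<close>.
\<close>

lemma parseval_L1_L2:
  assumes f: "f \<in> L1_L2 M"
  shows "(\<integral>\<^sup>+p. ennreal ((cmod (weighted_transform f p))\<^sup>2) \<partial>(\<beta> \<Otimes>\<^sub>M M))
    = ennreal C * (\<integral>\<^sup>+a. ennreal ((cmod (f a))\<^sup>2) \<partial>M)"
proof -
  define h where "h b = correlation M f (\<psi> \<circ> \<tau> (- b))" for b
  have h: "h b \<in> L1_L2 M" for b unfolding h_def by (rule L1_L2_correlation[OF f psi_tau])
  define k where "k \<delta> b \<gamma> = (hs_norm (fourier \<mu> (h b) \<delta> \<gamma>))\<^sup>2" for \<delta> b \<gamma>
  interpret BG: pair_sigma_finite \<beta> dgamma
    by (intro pair_sigma_finite.intro B.sigma_finite_measure_axioms sigma_finite_dgamma)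
  have km: "(\<lambda>(b, \<gamma>). k \<delta> b \<gamma>) \<in> borel_measurable (\<beta> \<Otimes>\<^sub>M dgamma)" if \<delta>: "\<delta> \<in> supp" for \<delta>
    unfolding k_def split_beta
  proof (intro measurable_hs_norm_gamma measurable_fourier[OF suppD[OF \<delta>]])
    have proj: "(\<lambda>q. (fst (fst q), snd q)) \<in> (\<beta> \<Otimes>\<^sub>M dgamma) \<Otimes>\<^sub>M M \<rightarrow>\<^sub>M \<beta> \<Otimes>\<^sub>M M"
      by (intro measurable_Pair measurable_compose[OF measurable_fst measurable_fst] measurable_snd)
    have "(\<lambda>p. h (fst p) (snd p)) \<in> borel_measurable (\<beta> \<Otimes>\<^sub>M M)"
      unfolding h_def by (rule measurable_correlation[OF L1_L2_D(1)[OF f]])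
    from measurable_compose[OF proj this]
    have "(\<lambda>q. h (fst (fst q)) (snd q)) \<in> borel_measurable ((\<beta> \<Otimes>\<^sub>M dgamma) \<Otimes>\<^sub>M M)"
      by (simp only: fst_conv snd_conv)
    then show "(\<lambda>(p, a). h (fst p) a) \<in> borel_measurable ((\<beta> \<Otimes>\<^sub>M dgamma) \<Otimes>\<^sub>M M)"
      by (simp add: split_beta)
  qed measurable
  have feas: "AE \<gamma> in dgamma. (\<integral>\<^sup>+b. ennreal ((\<Delta> b)\<^sup>2) * k \<delta> b \<gamma> \<partial>\<beta>)
      = ennreal C * (hs_norm (fourier \<mu> f \<delta> \<gamma>))\<^sup>2" if \<delta>: "\<delta> \<in> supp" for \<delta>
  proof -
    note dual = suppD[OF \<delta>]
    have "ennreal (weight \<delta>) * (\<integral>\<^sup>+\<gamma>. (hs_norm (fourier \<mu> f \<delta> \<gamma>))\<^sup>2 \<partial>dgamma) \<le> plancherel_norm2 (fourier \<mu> f)"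
      unfolding plancherel_norm2_def nn_integral_nu by (rule nn_integral_ge_point[OF \<delta>])
    also have "\<dots> < \<infinity>"
      unfolding plancherel_formula[OF f] using L1_L2_D(1)[OF f] by (simp add: L2_iff)
    finally have "(\<integral>\<^sup>+\<gamma>. (hs_norm (fourier \<mu> f \<delta> \<gamma>))\<^sup>2 \<partial>dgamma) \<noteq> \<infinity>"
      using \<delta> by (auto simp: supp_def ennreal_mult_less_top)
    moreover have "(\<lambda>\<gamma>. (hs_norm (fourier \<mu> f \<delta> \<gamma>))\<^sup>2) \<in> borel_measurable dgamma"
      by (intro measurable_hs_norm_gamma)
        (use measurable_fourier_gamma[OF dual f] in \<open>simp add: measurable_cong_sets[OF sets_dgamma refl]\<close>)
    ultimately have "AE \<gamma> in dgamma. (hs_norm (fourier \<mu> f \<delta> \<gamma>))\<^sup>2 \<noteq> \<infinity>"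
      by (intro nn_integral_noteq_infinite)
    moreover have "AE \<gamma> in dgamma. has_bochner_integral \<beta>
        (\<lambda>b. op_trace (fourier \<mu> (involution f) \<delta> \<gamma> \<circ> fourier \<mu> f \<delta> \<gamma>
            \<circ> cadjoint (fourier \<mu> (\<psi> \<circ> \<tau> (- b)) \<delta> \<gamma>) \<circ> fourier \<mu> (\<psi> \<circ> \<tau> (- b)) \<delta> \<gamma>)
          * complex_of_real ((\<Delta> b)\<^sup>2))
        (complex_of_real C * op_trace (fourier \<mu> (involution f) \<delta> \<gamma> \<circ> fourier \<mu> f \<delta> \<gamma>))"
    proof -
      have "AE \<gamma> in dgamma. \<forall>f\<in>L1_L2 M. \<forall>g\<in>L1_L2 M. has_bochner_integral \<beta>
        (\<lambda>b. op_trace (fourier \<mu> f \<delta> \<gamma> \<circ> fourier \<mu> g \<delta> \<gamma>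
            \<circ> cadjoint (fourier \<mu> (\<psi> \<circ> \<tau> (- b)) \<delta> \<gamma>) \<circ> fourier \<mu> (\<psi> \<circ> \<tau> (- b)) \<delta> \<gamma>)
          * complex_of_real ((\<Delta> b)\<^sup>2))
        (complex_of_real C * op_trace (fourier \<mu> f \<delta> \<gamma> \<circ> fourier \<mu> g \<delta> \<gamma>))"
        using feasible \<delta> unfolding feasible_wavelet_def Let_def AE_nu by blast
      then show ?thesis by eventually_elim (use f L1_L2_involution[OF f] in blast)
    qed
    ultimately show ?thesis
    proof eventually_elim
      case (elim \<gamma>)
      let ?S = "fourier \<mu> f \<delta> \<gamma>" and ?S' = "fourier \<mu> (involution f) \<delta> \<gamma>"
      let ?P = "\<lambda>b. fourier \<mu> (\<psi> \<circ> \<tau> (- b)) \<delta> \<gamma>"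
      let ?P' = "\<lambda>b. fourier \<mu> (involution (\<psi> \<circ> \<tau> (- b))) \<delta> \<gamma>"
      have S: "adjoint_pair ?S ?S'" by (rule adjoint_fourier[OF dual f])
      have P: "adjoint_pair (?P b) (?P' b)" for b by (rule adjoint_fourier[OF dual psi_tau])
      have fin: "(hs_norm ?S)\<^sup>2 < \<infinity>" using elim(1) by (simp add: less_top)
      have k_eq: "k \<delta> b \<gamma> = (hs_norm (?S \<circ> ?P' b))\<^sup>2" for b
        unfolding k_def h_def fourier_correlation[OF dual f psi_tau] ..
      \<comment> \<open>A common bound for the operator and its adjoint.\<close>
      define p where "p b = max (LINT a|M. cmod ((\<psi> \<circ> \<tau> (- b)) a))
          (LINT a|M. cmod (involution (\<psi> \<circ> \<tau> (- b)) a))" for b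
      have Pb: "norm (?P b v) \<le> p b * norm v" for b v
        by (rule order_trans[OF norm_fourier_le[OF dual psi_tau]]) (auto simp: p_def intro: mult_right_mono)
      have P'b: "norm (?P' b v) \<le> p b * norm v" for b v
        by (rule order_trans[OF norm_fourier_le[OF dual L1_L2_involution[OF psi_tau]]])
          (auto simp: p_def intro: mult_right_mono)
      have p: "0 \<le> p b" for b unfolding p_def by (rule max.coboundedI1) simp
      note trace = op_trace_eq_hs_norm[OF S P Pb P'b p fin, folded k_eq]
      have "has_bochner_integral \<beta> (\<lambda>b. complex_of_real (enn2real (k \<delta> b \<gamma>) * (\<Delta> b)\<^sup>2))
          (complex_of_real (C * enn2real ((hs_norm ?S)\<^sup>2)))"
        using elim(2) by (simp add: cadjoint_eq[OF P] trace(1) op_trace_adjoint_comp[OF S fin])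
      from has_bochner_integral_bounded_linear[OF bounded_linear_Re this]
      have int: "has_bochner_integral \<beta> (\<lambda>b. enn2real (k \<delta> b \<gamma>) * (\<Delta> b)\<^sup>2) (C * enn2real ((hs_norm ?S)\<^sup>2))"
        by simp
      have "(\<integral>\<^sup>+b. ennreal ((\<Delta> b)\<^sup>2) * k \<delta> b \<gamma> \<partial>\<beta>) = (\<integral>\<^sup>+b. ennreal (enn2real (k \<delta> b \<gamma>) * (\<Delta> b)\<^sup>2) \<partial>\<beta>)"
        using trace(2) by (intro nn_integral_cong) (simp add: ennreal_mult less_top mult.commute)
      also have "\<dots> = ennreal (C * enn2real ((hs_norm ?S)\<^sup>2))"
        using int by (subst nn_integral_eq_integral) (auto simp: has_bochner_integral_iff)
      also have "\<dots> = ennreal C * (hs_norm ?S)\<^sup>2"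
        using fin C_pos by (simp add: ennreal_mult less_top)
      finally show ?case .
    qed
  qed
  have kb: "(\<lambda>\<gamma>. k \<delta> b \<gamma>) \<in> borel_measurable dgamma" if "\<delta> \<in> supp" for \<delta> b
    using measurable_Pair2[OF km[OF that], of b] sets_eq_imp_space_eq[OF sets_beta] by simp
  have Dk: "(\<lambda>(b, \<gamma>). ennreal ((\<Delta> b)\<^sup>2) * k \<delta> b \<gamma>) \<in> borel_measurable (\<beta> \<Otimes>\<^sub>M dgamma)"
    if "\<delta> \<in> supp" for \<delta>
    using km[OF that] by (simp add: split_beta) measurable
  have wm: "(\<lambda>p. ennreal ((cmod (weighted_transform f p))\<^sup>2)) \<in> borel_measurable (\<beta> \<Otimes>\<^sub>M M)"
    using measurable_weighted_transform[OF L1_L2_D(1)[OF f]] by measurable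
  have "(\<integral>\<^sup>+p. ennreal ((cmod (weighted_transform f p))\<^sup>2) \<partial>(\<beta> \<Otimes>\<^sub>M M))
      = (\<integral>\<^sup>+b. \<integral>\<^sup>+a. ennreal ((cmod (weighted_transform f (b, a)))\<^sup>2) \<partial>M \<partial>\<beta>)"
    by (rule A.nn_integral_fst[OF wm, symmetric])
  also have "\<dots> = (\<integral>\<^sup>+b. \<integral>\<^sup>+\<delta>. ennreal (weight \<delta>) * (\<integral>\<^sup>+\<gamma>. ennreal ((\<Delta> b)\<^sup>2) * k \<delta> b \<gamma> \<partial>dgamma) \<partial>count_space supp \<partial>\<beta>)"
  proof (rule nn_integral_cong)
    fix b
    have [measurable]: "h b \<in> borel_measurable M" using h by measurable
    have "(\<integral>\<^sup>+a. ennreal ((cmod (weighted_transform f (b, a)))\<^sup>2) \<partial>M)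
        = (\<integral>\<^sup>+a. ennreal ((\<Delta> b)\<^sup>2) * ennreal ((cmod (h b a))\<^sup>2) \<partial>M)"
      by (simp add: weighted_transform_def h_def norm_mult power_mult_distrib ennreal_mult)
    also have "\<dots> = ennreal ((\<Delta> b)\<^sup>2) * plancherel_norm2 (fourier \<mu> (h b))"
      unfolding plancherel_formula[OF h] by (rule nn_integral_cmult) measurable
    also have "\<dots> = (\<integral>\<^sup>+\<delta>. ennreal (weight \<delta>) * (\<integral>\<^sup>+\<gamma>. ennreal ((\<Delta> b)\<^sup>2) * k \<delta> b \<gamma> \<partial>dgamma) \<partial>count_space supp)"
      unfolding plancherel_norm2_def nn_integral_nu
      by (subst nn_integral_cmult[symmetric])
        (auto intro!: nn_integral_cong simp: nn_integral_cmult[OF kb] k_def[symmetric] mult.left_commute)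
    finally show "(\<integral>\<^sup>+a. ennreal ((cmod (weighted_transform f (b, a)))\<^sup>2) \<partial>M)
        = (\<integral>\<^sup>+\<delta>. ennreal (weight \<delta>) * (\<integral>\<^sup>+\<gamma>. ennreal ((\<Delta> b)\<^sup>2) * k \<delta> b \<gamma> \<partial>dgamma) \<partial>count_space supp)" .
  qed
  also have "\<dots> = (\<integral>\<^sup>+\<delta>. \<integral>\<^sup>+b. ennreal (weight \<delta>) * (\<integral>\<^sup>+\<gamma>. ennreal ((\<Delta> b)\<^sup>2) * k \<delta> b \<gamma> \<partial>dgamma) \<partial>\<beta> \<partial>count_space supp)"
    by (intro nn_integral_count_space_nn_integral countable_supp borel_measurable_times_ennreal
        borel_measurable_const BG.M2.borel_measurable_nn_integral Dk)
  also have "\<dots> = (\<integral>\<^sup>+\<delta>. ennreal (weight \<delta>) * (ennreal C * (\<integral>\<^sup>+\<gamma>. (hs_norm (fourier \<mu> f \<delta> \<gamma>))\<^sup>2 \<partial>dgamma)) \<partial>count_space supp)"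
  proof (rule nn_integral_cong)
    fix \<delta> assume "\<delta> \<in> space (count_space supp)"
    then have \<delta>: "\<delta> \<in> supp" by simp
    have "(\<integral>\<^sup>+b. ennreal (weight \<delta>) * (\<integral>\<^sup>+\<gamma>. ennreal ((\<Delta> b)\<^sup>2) * k \<delta> b \<gamma> \<partial>dgamma) \<partial>\<beta>)
        = ennreal (weight \<delta>) * (\<integral>\<^sup>+b. \<integral>\<^sup>+\<gamma>. ennreal ((\<Delta> b)\<^sup>2) * k \<delta> b \<gamma> \<partial>dgamma \<partial>\<beta>)"
      by (intro nn_integral_cmult BG.M2.borel_measurable_nn_integral Dk \<delta>)
    also have "(\<integral>\<^sup>+b. \<integral>\<^sup>+\<gamma>. ennreal ((\<Delta> b)\<^sup>2) * k \<delta> b \<gamma> \<partial>dgamma \<partial>\<beta>)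
        = (\<integral>\<^sup>+\<gamma>. \<integral>\<^sup>+b. ennreal ((\<Delta> b)\<^sup>2) * k \<delta> b \<gamma> \<partial>\<beta> \<partial>dgamma)"
      by (rule BG.Fubini'[OF Dk[OF \<delta>], symmetric])
    also have "\<dots> = (\<integral>\<^sup>+\<gamma>. ennreal C * (hs_norm (fourier \<mu> f \<delta> \<gamma>))\<^sup>2 \<partial>dgamma)"
      by (rule nn_integral_cong_AE[OF feas[OF \<delta>]])
    also have "\<dots> = ennreal C * (\<integral>\<^sup>+\<gamma>. (hs_norm (fourier \<mu> f \<delta> \<gamma>))\<^sup>2 \<partial>dgamma)"
      by (intro nn_integral_cmult measurable_hs_norm_gamma)
        (use measurable_fourier_gamma[OF suppD[OF \<delta>] f] in \<open>simp add: measurable_cong_sets[OF sets_dgamma refl]\<close>)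
    finally show "(\<integral>\<^sup>+b. ennreal (weight \<delta>) * (\<integral>\<^sup>+\<gamma>. ennreal ((\<Delta> b)\<^sup>2) * k \<delta> b \<gamma> \<partial>dgamma) \<partial>\<beta>)
        = ennreal (weight \<delta>) * (ennreal C * (\<integral>\<^sup>+\<gamma>. (hs_norm (fourier \<mu> f \<delta> \<gamma>))\<^sup>2 \<partial>dgamma))" .
  qed
  also have "\<dots> = ennreal C * plancherel_norm2 (fourier \<mu> f)"
    unfolding plancherel_norm2_def nn_integral_nu
    by (simp add: nn_integral_cmult[symmetric] mult.left_commute)
  finally show ?thesis unfolding plancherel_formula[OF f] .
qed

lemma weighted_transform_truncation_tendsto:
  assumes f: "f \<in> L2 M"
  shows "(\<lambda>n. weighted_transform (truncation n f) p) \<longlonglongrightarrow> weighted_transform f p"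
  unfolding weighted_transform_def correlation_def
proof (intro tendsto_mult tendsto_const integral_dominated_convergence)
  let ?g = "\<lambda>x. cnj ((\<psi> \<circ> \<tau> (- fst p)) (- snd p + x))"
  note g = L2_plus[OF L1_L2_D(1)[OF psi_tau]]
  show "(\<lambda>x. f x * ?g x) \<in> borel_measurable M"
    by (rule borel_measurable_integrable[OF L2_integrable_mult(1)[OF f g]])
  show "(\<lambda>x. truncation n f x * ?g x) \<in> borel_measurable M" for n
    by (rule borel_measurable_integrable[OF L2_integrable_mult(1)[OF L1_L2_D(1)[OF truncation_L1_L2[OF f]] g]])
  show "integrable M (\<lambda>x. norm (f x * ?g x))"
    by (rule integrable_norm[OF L2_integrable_mult(1)[OF f g]])
  show "AE x in M. (\<lambda>n. truncation n f x * ?g x) \<longlonglongrightarrow> f x * ?g x"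
    by (intro AE_I2 tendsto_mult truncation_tendsto tendsto_const)
  show "AE x in M. norm (truncation n f x * ?g x) \<le> norm (f x * ?g x)" for n
    by (intro AE_I2) (simp add: truncation_def norm_mult mult_right_mono)
qed

lemma parseval_le:
  assumes f: "f \<in> L2 M"
  shows "(\<integral>\<^sup>+p. ennreal ((cmod (weighted_transform f p))\<^sup>2) \<partial>(\<beta> \<Otimes>\<^sub>M M))
    \<le> ennreal C * (\<integral>\<^sup>+a. ennreal ((cmod (f a))\<^sup>2) \<partial>M)"
proof -
  have \<phi>: "truncation n f \<in> L1_L2 M" for n by (rule truncation_L1_L2[OF f])
  have "(\<integral>\<^sup>+p. ennreal ((cmod (weighted_transform f p))\<^sup>2) \<partial>(\<beta> \<Otimes>\<^sub>M M))
      = (\<integral>\<^sup>+p. liminf (\<lambda>n. ennreal ((cmod (weighted_transform (truncation n f) p))\<^sup>2)) \<partial>(\<beta> \<Otimes>\<^sub>M M))"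
    by (intro nn_integral_cong lim_imp_Liminf[symmetric] tendsto_ennrealI tendsto_power tendsto_norm
        weighted_transform_truncation_tendsto f) simp
  also have "\<dots> \<le> liminf (\<lambda>n. \<integral>\<^sup>+p. ennreal ((cmod (weighted_transform (truncation n f) p))\<^sup>2) \<partial>(\<beta> \<Otimes>\<^sub>M M))"
    by (rule nn_integral_liminf)
      (use measurable_weighted_transform[OF L1_L2_D(1)[OF \<phi>]] in measurable)
  also have "\<dots> \<le> liminf (\<lambda>n. ennreal C * (\<integral>\<^sup>+a. ennreal ((cmod (f a))\<^sup>2) \<partial>M))"
    unfolding parseval_L1_L2[OF \<phi>]
    by (intro Liminf_mono always_eventually allI mult_left_mono nn_integral_mono ennreal_leI)
      (auto simp: truncation_def)
  finally show ?thesis by (simp add: Liminf_const)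
qed

text \<open>
  The upper bound from Fatou's lemma also applies to the errors \<open>truncation n f - f\<close>. By linearity
  the transforms of the truncations therefore converge in \<open>L\<^sup>2\<close>, and equality persists.
\<close>

lemma parseval:
  assumes f: "f \<in> L2 M"
  shows "(\<integral>\<^sup>+p. ennreal ((cmod (weighted_transform f p))\<^sup>2) \<partial>(\<beta> \<Otimes>\<^sub>M M))
    = ennreal C * (\<integral>\<^sup>+a. ennreal ((cmod (f a))\<^sup>2) \<partial>M)" (is "?Y = _")
proof (rule antisym[OF parseval_le[OF f]])
  define \<phi> where "\<phi> n = truncation n f" for n
  have \<phi>: "\<phi> n \<in> L1_L2 M" for n unfolding \<phi>_def by (rule truncation_L1_L2[OF f])
  have \<phi>2: "\<phi> n \<in> L2 M" for n by (rule L1_L2_D(1)[OF \<phi>])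
  have "(\<integral>\<^sup>+a. ennreal ((cmod (f a))\<^sup>2) \<partial>M) = (\<integral>\<^sup>+a. liminf (\<lambda>n. ennreal ((cmod (\<phi> n a))\<^sup>2)) \<partial>M)"
    unfolding \<phi>_def
    by (intro nn_integral_cong lim_imp_Liminf[symmetric] tendsto_ennrealI tendsto_power tendsto_norm
        truncation_tendsto) simp
  also have "\<dots> \<le> liminf (\<lambda>n. \<integral>\<^sup>+a. ennreal ((cmod (\<phi> n a))\<^sup>2) \<partial>M)"
    by (rule nn_integral_liminf) (use \<phi> in measurable)
  finally have "ennreal C * (\<integral>\<^sup>+a. ennreal ((cmod (f a))\<^sup>2) \<partial>M)
      \<le> liminf (\<lambda>n. ennreal C * (\<integral>\<^sup>+a. ennreal ((cmod (\<phi> n a))\<^sup>2) \<partial>M))"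
    by (simp add: liminf_cmult_ennreal mult_left_mono)
  also have "\<dots> \<le> ?Y"
  proof (rule le_of_perturbed_bounds)
    have "(\<lambda>n. ennreal C * ennreal (LINT a|M. (cmod (\<phi> n a - f a))\<^sup>2)) \<longlonglongrightarrow> ennreal C * ennreal 0"
      unfolding \<phi>_def
      by (intro ennreal_tendsto_cmult tendsto_ennrealI truncation_tendsto_L2[OF f]) simp
    then show "(\<lambda>n. ennreal C * ennreal (LINT a|M. (cmod (\<phi> n a - f a))\<^sup>2)) \<longlonglongrightarrow> 0" by simp
    fix e :: real and n assume e: "0 < e"
    define d where "d a = \<phi> n a - f a" for a
    have d: "d \<in> L2 M" unfolding d_def[abs_def] by (rule L2_diff[OF \<phi>2 f])
    have [measurable]: "weighted_transform f \<in> borel_measurable (\<beta> \<Otimes>\<^sub>M M)"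
      "weighted_transform d \<in> borel_measurable (\<beta> \<Otimes>\<^sub>M M)"
      by (rule measurable_weighted_transform[OF f], rule measurable_weighted_transform[OF d])
    have sum: "weighted_transform (\<phi> n) p = weighted_transform f p + weighted_transform d p" for p
      unfolding d_def weighted_transform_diff[OF \<phi>2 f] by simp
    have "ennreal C * (\<integral>\<^sup>+a. ennreal ((cmod (\<phi> n a))\<^sup>2) \<partial>M)
        = (\<integral>\<^sup>+p. ennreal ((cmod (weighted_transform f p + weighted_transform d p))\<^sup>2) \<partial>(\<beta> \<Otimes>\<^sub>M M))"
      unfolding parseval_L1_L2[OF \<phi>, symmetric] sum ..
    also have "\<dots> \<le> (\<integral>\<^sup>+p. ennreal (1 + e) * ennreal ((cmod (weighted_transform f p))\<^sup>2)
        + ennreal (1 + 1 / e) * ennreal ((cmod (weighted_transform d p))\<^sup>2) \<partial>(\<beta> \<Otimes>\<^sub>M M))"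
      by (intro nn_integral_mono ennreal_norm_add_power2_le e)
    also have "\<dots> = ennreal (1 + e) * ?Y
        + ennreal (1 + 1 / e) * (\<integral>\<^sup>+p. ennreal ((cmod (weighted_transform d p))\<^sup>2) \<partial>(\<beta> \<Otimes>\<^sub>M M))"
      by (simp add: nn_integral_add nn_integral_cmult)
    also have "\<dots> \<le> ennreal (1 + e) * ?Y
        + ennreal (1 + 1 / e) * (ennreal C * (\<integral>\<^sup>+a. ennreal ((cmod (d a))\<^sup>2) \<partial>M))"
      by (intro add_mono mult_left_mono parseval_le d order_refl) auto
    finally show "ennreal C * (\<integral>\<^sup>+a. ennreal ((cmod (\<phi> n a))\<^sup>2) \<partial>M)
        \<le> ennreal (1 + e) * ?Y + ennreal (1 + 1 / e) * (ennreal C * ennreal (LINT a|M. (cmod (\<phi> n a - f a))\<^sup>2))"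
      unfolding L2_nn_integral[OF d] by (simp add: d_def)
  qed
  finally show "ennreal C * (\<integral>\<^sup>+a. ennreal ((cmod (f a))\<^sup>2) \<partial>M) \<le> ?Y" .
qed

lemma weighted_transform_difference_bound:
  assumes f: "f \<in> L2 M"
  shows "(\<integral>\<^sup>+p. ennreal ((cmod (weighted_transform f (fst p, (0, s) + snd p) - weighted_transform f p))\<^sup>2) \<partial>(\<beta> \<Otimes>\<^sub>M M))
    \<le> ennreal (C * s\<^sup>2) * (\<integral>\<^sup>+\<delta>. \<integral>\<^sup>+\<gamma>. ennreal (\<gamma>\<^sup>2) * (hs_norm (fourier_L2 \<mu> \<nu> f \<delta> \<gamma>))\<^sup>2 \<partial>dgamma \<partial>\<nu>)"
proof -
  have fs: "(\<lambda>x. f ((0, s) + x)) \<in> L2 M" by (rule L2_plus[OF f])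
  have "weighted_transform f (fst p, (0, s) + snd p) - weighted_transform f p
      = weighted_transform (\<lambda>x. f ((0, s) + x) - f x) p" for p
    unfolding weighted_transform_diff[OF fs f] using weighted_transform_translation[OF f, of s "fst p" "snd p"]
    by simp
  then have "(\<integral>\<^sup>+p. ennreal ((cmod (weighted_transform f (fst p, (0, s) + snd p) - weighted_transform f p))\<^sup>2) \<partial>(\<beta> \<Otimes>\<^sub>M M))
      \<le> ennreal C * (\<integral>\<^sup>+a. ennreal ((cmod (f ((0, s) + a) - f a))\<^sup>2) \<partial>M)"
    using parseval_le[OF L2_diff[OF fs f]] by simp
  also have "\<dots> \<le> ennreal C * (ennreal (s\<^sup>2) *
      (\<integral>\<^sup>+\<delta>. \<integral>\<^sup>+\<gamma>. ennreal (\<gamma>\<^sup>2) * (hs_norm (fourier_L2 \<mu> \<nu> f \<delta> \<gamma>))\<^sup>2 \<partial>dgamma \<partial>\<nu>))"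
    by (intro mult_left_mono difference_bound f) simp
  finally show ?thesis using C_pos by (simp add: ennreal_mult mult.assoc)
qed

end

section \<open>The uncertainty principle\<close>

text \<open>
  If one of the two factors of the uncertainty principle vanishes while the other one is infinite,
  their product is \<open>0\<close> by convention, and the bound does not follow from Heisenberg's inequality.
  But a vanishing second moment forces \<open>f = 0\<close>, as single points are null sets of the real line.
\<close>

lemma zero_second_moment:
  fixes g :: "real \<Rightarrow> ennreal"
  assumes g[measurable]: "g \<in> borel_measurable borel"
    and zero: "(\<integral>\<^sup>+t. ennreal (t\<^sup>2) * g t \<partial>lborel) = 0"
  shows "(\<integral>\<^sup>+t. g t \<partial>lborel) = 0"
proof -
  have "AE t in lborel. ennreal (t\<^sup>2) * g t = 0"
    using zero by (subst (asm) nn_integral_0_iff_AE) auto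
  moreover have "AE t in lborel. t \<noteq> (0 :: real)" by (rule AE_lborel_singleton)
  ultimately have "AE t in lborel. g t = 0" by eventually_elim auto
  then show ?thesis by (subst nn_integral_0_iff_AE) auto
qed

lemma ennreal_sqrt_eq_0: "ennreal_sqrt x = 0 \<longleftrightarrow> x = 0"
  by (metis ennreal_sqrt_power2 power_eq_0_iff zero_neq_numeral zero_power2)

lemma ennreal_sqrt_top: "ennreal_sqrt top = top"
  by (simp add: ennreal_sqrt_def)

lemma ennreal_sqrt_ennreal: "0 \<le> x \<Longrightarrow> ennreal_sqrt (ennreal x) = ennreal (sqrt x)"
  by (simp add: ennreal_sqrt_def)

context plancherel_group
begin

lemma fourier_L2_zero_second_moment:
  assumes f: "f \<in> L2 M"
    and zero: "(\<integral>\<^sup>+\<delta>. \<integral>\<^sup>+\<gamma>. ennreal (\<gamma>\<^sup>2) * (hs_norm (fourier_L2 \<mu> \<nu> f \<delta> \<gamma>))\<^sup>2 \<partial>dgamma \<partial>\<nu>) = 0"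
  shows "(LINT a|M. (cmod (f a))\<^sup>2) = 0"
proof -
  define g where "g \<delta> \<gamma> = (hs_norm (fourier_L2 \<mu> \<nu> f \<delta> \<gamma>))\<^sup>2" for \<delta> \<gamma>
  have [measurable]: "g \<delta> \<in> borel_measurable borel" for \<delta>
    unfolding g_def using plancherel_extension_fourier_L2[OF f]
    by (intro measurable_hs_norm_gamma) (simp add: plancherel_extension_def)
  have "AE \<delta> in \<nu>. (\<integral>\<^sup>+\<gamma>. ennreal (\<gamma>\<^sup>2) * g \<delta> \<gamma> \<partial>dgamma) = 0"
    using zero unfolding g_def by (subst (asm) nn_integral_0_iff_AE) auto
  then have "AE \<delta> in \<nu>. (\<integral>\<^sup>+\<gamma>. g \<delta> \<gamma> \<partial>dgamma) = 0"
    by eventually_elim (simp add: nn_integral_dgamma zero_second_moment)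
  then have "(\<integral>\<^sup>+\<delta>. \<integral>\<^sup>+\<gamma>. g \<delta> \<gamma> \<partial>dgamma \<partial>\<nu>) = 0"
    by (subst nn_integral_0_iff_AE) auto
  then show ?thesis
    using norm_le_fourier_L2[OF f] unfolding g_def L2_nn_integral[OF f] by simp
qed

end

context wavelet_group
begin

text \<open>The variables are grouped as in \<open>heisenberg_difference\<close>, with \<open>t\<close> separated from the others.\<close>

definition regrouped_transform :: "('l \<times> real \<Rightarrow> complex) \<Rightarrow> ('b \<times> 'l) \<times> real \<Rightarrow> complex" where
  "regrouped_transform f q = weighted_transform f (fst (fst q), snd (fst q), snd q)"

lemma measurable_regroup:
  "(\<lambda>q. (fst (fst q), snd (fst q), snd q)) \<in> (\<beta> \<Otimes>\<^sub>M \<mu>) \<Otimes>\<^sub>M lborel \<rightarrow>\<^sub>M \<beta> \<Otimes>\<^sub>M M"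
  by measurable

lemma nn_integral_regroup:
  assumes g: "g \<in> borel_measurable (\<beta> \<Otimes>\<^sub>M M)"
  shows "(\<integral>\<^sup>+q. g (fst (fst q), snd (fst q), snd q) \<partial>((\<beta> \<Otimes>\<^sub>M \<mu>) \<Otimes>\<^sub>M lborel))
      = (\<integral>\<^sup>+b. \<integral>\<^sup>+l. \<integral>\<^sup>+t. g (b, l, t) \<partial>lborel \<partial>\<mu> \<partial>\<beta>)"
    and "(\<integral>\<^sup>+p. g p \<partial>(\<beta> \<Otimes>\<^sub>M M)) = (\<integral>\<^sup>+b. \<integral>\<^sup>+l. \<integral>\<^sup>+t. g (b, l, t) \<partial>lborel \<partial>\<mu> \<partial>\<beta>)"
proof -
  define g' where "g' q = g (fst (fst q), snd (fst q), snd q)" for q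
  have g': "g' \<in> borel_measurable ((\<beta> \<Otimes>\<^sub>M \<mu>) \<Otimes>\<^sub>M lborel)"
    unfolding g'_def by (rule measurable_compose[OF measurable_regroup g])
  have "(\<integral>\<^sup>+q. g' q \<partial>((\<beta> \<Otimes>\<^sub>M \<mu>) \<Otimes>\<^sub>M lborel))
      = (\<integral>\<^sup>+p. \<integral>\<^sup>+t. g' (p, t) \<partial>lborel \<partial>(\<beta> \<Otimes>\<^sub>M \<mu>))"
    by (rule lborel.nn_integral_fst[OF g', symmetric])
  also have "\<dots> = (\<integral>\<^sup>+b. \<integral>\<^sup>+l. \<integral>\<^sup>+t. g' ((b, l), t) \<partial>lborel \<partial>\<mu> \<partial>\<beta>)"
    by (rule mu.nn_integral_fst[OF lborel.borel_measurable_nn_integral_fst[OF g'], symmetric])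
  finally show "(\<integral>\<^sup>+q. g (fst (fst q), snd (fst q), snd q) \<partial>((\<beta> \<Otimes>\<^sub>M \<mu>) \<Otimes>\<^sub>M lborel))
      = (\<integral>\<^sup>+b. \<integral>\<^sup>+l. \<integral>\<^sup>+t. g (b, l, t) \<partial>lborel \<partial>\<mu> \<partial>\<beta>)"
    by (simp add: g'_def)
  have "(\<integral>\<^sup>+p. g p \<partial>(\<beta> \<Otimes>\<^sub>M M)) = (\<integral>\<^sup>+b. \<integral>\<^sup>+a. g (b, a) \<partial>M \<partial>\<beta>)"
    by (rule A.nn_integral_fst[OF g, symmetric])
  also have "\<dots> = (\<integral>\<^sup>+b. \<integral>\<^sup>+l. \<integral>\<^sup>+t. g (b, l, t) \<partial>lborel \<partial>\<mu> \<partial>\<beta>)"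
  proof (rule nn_integral_cong)
    fix b assume "b \<in> space \<beta>"
    then have "(\<lambda>a. g (b, a)) \<in> borel_measurable M" by (rule measurable_Pair2[OF g])
    from lborel.nn_integral_fst[OF this, symmetric]
    show "(\<integral>\<^sup>+a. g (b, a) \<partial>M) = (\<integral>\<^sup>+l. \<integral>\<^sup>+t. g (b, l, t) \<partial>lborel \<partial>\<mu>)" .
  qed
  finally show "(\<integral>\<^sup>+p. g p \<partial>(\<beta> \<Otimes>\<^sub>M M)) = (\<integral>\<^sup>+b. \<integral>\<^sup>+l. \<integral>\<^sup>+t. g (b, l, t) \<partial>lborel \<partial>\<mu> \<partial>\<beta>)" .
qed

lemma parseval_regrouped:
  assumes f: "f \<in> L2 M"
  shows "(\<integral>\<^sup>+q. ennreal ((cmod (regrouped_transform f q))\<^sup>2) \<partial>((\<beta> \<Otimes>\<^sub>M \<mu>) \<Otimes>\<^sub>M lborel))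
    = ennreal (C * (LINT a|M. (cmod (f a))\<^sup>2))"
proof -
  have m: "(\<lambda>p. ennreal ((cmod (weighted_transform f p))\<^sup>2)) \<in> borel_measurable (\<beta> \<Otimes>\<^sub>M M)"
    using measurable_weighted_transform[OF f] by measurable
  show ?thesis
    using nn_integral_regroup[OF m] parseval[OF f] C_pos
    unfolding L2_nn_integral[OF f] by (simp add: regrouped_transform_def ennreal_mult)
qed

lemma measurable_regrouped_transform:
  "f \<in> L2 M \<Longrightarrow> regrouped_transform f \<in> borel_measurable ((\<beta> \<Otimes>\<^sub>M \<mu>) \<Otimes>\<^sub>M lborel)"
  unfolding regrouped_transform_def
  by (rule measurable_compose[OF measurable_regroup measurable_weighted_transform])

lemma regrouped_transform_difference_bound:
  assumes f: "f \<in> L2 M"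
  shows "(\<integral>\<^sup>+q. ennreal ((cmod (regrouped_transform f (fst q, snd q + s) - regrouped_transform f q))\<^sup>2)
      \<partial>((\<beta> \<Otimes>\<^sub>M \<mu>) \<Otimes>\<^sub>M lborel))
    \<le> ennreal (C * s\<^sup>2) * (\<integral>\<^sup>+\<delta>. \<integral>\<^sup>+\<gamma>. ennreal (\<gamma>\<^sup>2) * (hs_norm (fourier_L2 \<mu> \<nu> f \<delta> \<gamma>))\<^sup>2 \<partial>dgamma \<partial>\<nu>)"
proof -
  define g where "g p = ennreal ((cmod (weighted_transform f (fst p, (0, s) + snd p) - weighted_transform f p))\<^sup>2)"
    for p
  have "(\<lambda>p. (fst p, (0, s) + snd p)) \<in> \<beta> \<Otimes>\<^sub>M M \<rightarrow>\<^sub>M \<beta> \<Otimes>\<^sub>M M"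
    by (intro measurable_Pair measurable_fst measurable_compose[OF measurable_snd measurable_borel_comp_plus])
  from measurable_compose[OF this measurable_weighted_transform[OF f]]
  have [measurable]: "(\<lambda>p. weighted_transform f (fst p, (0, s) + snd p)) \<in> borel_measurable (\<beta> \<Otimes>\<^sub>M M)" .
  have [measurable]: "weighted_transform f \<in> borel_measurable (\<beta> \<Otimes>\<^sub>M M)"
    by (rule measurable_weighted_transform[OF f])
  have g: "g \<in> borel_measurable (\<beta> \<Otimes>\<^sub>M M)" unfolding g_def by measurable
  have "(\<integral>\<^sup>+q. ennreal ((cmod (regrouped_transform f (fst q, snd q + s) - regrouped_transform f q))\<^sup>2)
      \<partial>((\<beta> \<Otimes>\<^sub>M \<mu>) \<Otimes>\<^sub>M lborel)) = (\<integral>\<^sup>+p. g p \<partial>(\<beta> \<Otimes>\<^sub>M M))"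
    using nn_integral_regroup[OF g] by (simp add: g_def regrouped_transform_def add.commute)
  then show ?thesis using weighted_transform_difference_bound[OF f, of s] unfolding g_def by simp
qed

lemma zero_moment_transform:
  assumes f: "f \<in> L2 M"
    and zero: "(\<integral>\<^sup>+b. \<integral>\<^sup>+l. \<integral>\<^sup>+t. ennreal (t\<^sup>2 * (cmod (weighted_transform f (b, l, t)))\<^sup>2) \<partial>lborel \<partial>\<mu> \<partial>\<beta>) = 0"
  shows "(LINT a|M. (cmod (f a))\<^sup>2) = 0"
proof -
  define H where "H = regrouped_transform f"
  have H[measurable]: "H \<in> borel_measurable ((\<beta> \<Otimes>\<^sub>M \<mu>) \<Otimes>\<^sub>M lborel)"
    unfolding H_def by (rule measurable_regrouped_transform[OF f])
  have [measurable]: "(\<lambda>q. ennreal ((snd q)\<^sup>2) * ennreal ((cmod (H q))\<^sup>2)) \<in> borel_measurable ((\<beta> \<Otimes>\<^sub>M \<mu>) \<Otimes>\<^sub>M lborel)"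
    by measurable
  have m: "(\<lambda>p. ennreal ((snd (snd p))\<^sup>2 * (cmod (weighted_transform f p))\<^sup>2)) \<in> borel_measurable (\<beta> \<Otimes>\<^sub>M M)"
    using measurable_weighted_transform[OF f] by measurable
  have "(\<integral>\<^sup>+q. ennreal ((snd q)\<^sup>2) * ennreal ((cmod (H q))\<^sup>2) \<partial>((\<beta> \<Otimes>\<^sub>M \<mu>) \<Otimes>\<^sub>M lborel)) = 0"
    using nn_integral_regroup(1)[OF m] zero by (simp add: H_def regrouped_transform_def ennreal_mult)
  then have "(\<integral>\<^sup>+p. \<integral>\<^sup>+t. ennreal (t\<^sup>2) * ennreal ((cmod (H (p, t)))\<^sup>2) \<partial>lborel \<partial>(\<beta> \<Otimes>\<^sub>M \<mu>)) = 0"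
    by (subst (asm) lborel.nn_integral_fst[symmetric]) auto
  then have "AE p in \<beta> \<Otimes>\<^sub>M \<mu>. (\<integral>\<^sup>+t. ennreal (t\<^sup>2) * ennreal ((cmod (H (p, t)))\<^sup>2) \<partial>lborel) = 0"
    by (subst (asm) nn_integral_0_iff_AE) auto
  moreover have "AE p in \<beta> \<Otimes>\<^sub>M \<mu>. (\<lambda>t. ennreal ((cmod (H (p, t)))\<^sup>2)) \<in> borel_measurable borel"
    by (rule AE_I2) (use measurable_Pair2[OF H] in measurable)
  ultimately have "AE p in \<beta> \<Otimes>\<^sub>M \<mu>. (\<integral>\<^sup>+t. ennreal ((cmod (H (p, t)))\<^sup>2) \<partial>lborel) = 0"
    by eventually_elim (rule zero_second_moment)
  then have "(\<integral>\<^sup>+p. \<integral>\<^sup>+t. ennreal ((cmod (H (p, t)))\<^sup>2) \<partial>lborel \<partial>(\<beta> \<Otimes>\<^sub>M \<mu>)) = 0"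
    by (subst nn_integral_0_iff_AE) auto
  then have "(\<integral>\<^sup>+q. ennreal ((cmod (H q))\<^sup>2) \<partial>((\<beta> \<Otimes>\<^sub>M \<mu>) \<Otimes>\<^sub>M lborel)) = 0"
    by (subst lborel.nn_integral_fst[symmetric]) auto
  then have "(LINT a|M. (cmod (f a))\<^sup>2) \<le> 0"
    unfolding H_def parseval_regrouped[OF f] using C_pos
    by (simp add: ennreal_eq_0_iff mult_le_0_iff)
  then show ?thesis by (rule order_antisym) simp
qed

lemma uncertainty_finite:
  assumes f: "f \<in> L2 M" and t: "0 < t" and k: "0 < k"
    and T: "(\<integral>\<^sup>+b. \<integral>\<^sup>+l. \<integral>\<^sup>+t. ennreal (t\<^sup>2 * (cmod (weighted_transform f (b, l, t)))\<^sup>2) \<partial>lborel \<partial>\<mu> \<partial>\<beta>) = ennreal t"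
    and K: "(\<integral>\<^sup>+\<delta>. \<integral>\<^sup>+\<gamma>. ennreal (\<gamma>\<^sup>2) * (hs_norm (fourier_L2 \<mu> \<nu> f \<delta> \<gamma>))\<^sup>2 \<partial>dgamma \<partial>\<nu>) = ennreal k"
  shows "sqrt C / 2 * (LINT a|M. (cmod (f a))\<^sup>2) \<le> sqrt t * sqrt k"
proof -
  define H where "H = regrouped_transform f"
  let ?P = "(\<beta> \<Otimes>\<^sub>M \<mu>) \<Otimes>\<^sub>M (lborel :: real measure)"
  define N where "N = (LINT a|M. (cmod (f a))\<^sup>2)"
  have H[measurable]: "H \<in> borel_measurable ?P"
    unfolding H_def by (rule measurable_regrouped_transform[OF f])
  have norm: "(\<integral>\<^sup>+q. ennreal ((cmod (H q))\<^sup>2) \<partial>?P) = ennreal (C * N)"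
    unfolding H_def N_def by (rule parseval_regrouped[OF f])
  have int: "integrable ?P (\<lambda>q. (cmod (H q))\<^sup>2)"
    using norm by (intro integrableI_bounded) auto
  have N: "(LINT q|?P. (cmod (H q))\<^sup>2) = C * N"
    using norm C_pos unfolding nn_integral_eq_integral[OF int AE_I2[OF zero_le_power2]]
    by (subst (asm) ennreal_inj) (auto simp: N_def)
  \<comment> \<open>The value of \<open>m\<close> for which \<open>m C k\<close> and \<open>t / m\<close> agree minimises their sum.\<close>
  define m where "m = sqrt t / (sqrt C * sqrt k)"
  have m: "0 < m" unfolding m_def using t k C_pos by simp
  have meas: "(\<lambda>p. ennreal ((snd (snd p))\<^sup>2 * (cmod (weighted_transform f p))\<^sup>2)) \<in> borel_measurable (\<beta> \<Otimes>\<^sub>M M)"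
    using measurable_weighted_transform[OF f] by measurable
  have "(LINT q|?P. (cmod (H q))\<^sup>2) \<le> m * (C * k) + t / m"
  proof (rule heisenberg_difference[OF H int])
    show "(\<integral>\<^sup>+q. ennreal ((snd q)\<^sup>2 * (cmod (H q))\<^sup>2) \<partial>?P) \<le> ennreal t"
      using nn_integral_regroup(1)[OF meas] T by (simp add: H_def regrouped_transform_def)
    show "(\<integral>\<^sup>+q. ennreal ((cmod (H (fst q, snd q + s) - H q))\<^sup>2) \<partial>?P) \<le> ennreal (s\<^sup>2 * (C * k))" for s
      using regrouped_transform_difference_bound[OF f, of s] C_pos k unfolding K H_def
      by (simp add: ennreal_mult[symmetric] ac_simps)
  qed (use t k C_pos m in auto)
  then have "C * N \<le> m * (C * k) + t / m" by (simp add: N)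
  also have "m * (C * k) = sqrt C * (sqrt t * sqrt k)"
  proof -
    have "C * k = (sqrt C * sqrt k) * (sqrt C * sqrt k)"
      using C_pos k by (simp add: ac_simps flip: real_sqrt_mult)
    then show ?thesis unfolding m_def using C_pos k by simp
  qed
  also have "t / m = sqrt C * (sqrt t * sqrt k)"
  proof -
    have "t / m = (t / sqrt t) * (sqrt C * sqrt k)" by (simp add: m_def)
    then show ?thesis using t by (simp add: real_div_sqrt mult.left_commute)
  qed
  finally have "C * N \<le> sqrt C * (sqrt t * sqrt k) + sqrt C * (sqrt t * sqrt k)" .
  then have "sqrt C * (sqrt C * N) \<le> sqrt C * (2 * (sqrt t * sqrt k))"
  proof -
    have "sqrt C * (sqrt C * N) = C * N" using C_pos by (simp flip: mult.assoc)
    then show ?thesis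
      using \<open>C * N \<le> sqrt C * (sqrt t * sqrt k) + sqrt C * (sqrt t * sqrt k)\<close>
      by (simp only: mult_2 distrib_left)
  qed
  then have "sqrt C * N \<le> 2 * (sqrt t * sqrt k)" using C_pos by simp
  then show ?thesis by (simp add: N_def)
qed

lemma uncertainty_principle:
  assumes f: "f \<in> L2 M"
  shows "ennreal (sqrt C / 2 * (LINT a|M. (cmod (f a))\<^sup>2))
    \<le> ennreal_sqrt (\<integral>\<^sup>+b. \<integral>\<^sup>+l. \<integral>\<^sup>+t. ennreal (t\<^sup>2 * (cmod (weighted_transform f (b, l, t)))\<^sup>2) \<partial>lborel \<partial>\<mu> \<partial>\<beta>)
      * ennreal_sqrt (\<integral>\<^sup>+\<delta>. \<integral>\<^sup>+\<gamma>. ennreal (\<gamma>\<^sup>2) * (hs_norm (fourier_L2 \<mu> \<nu> f \<delta> \<gamma>))\<^sup>2 \<partial>dgamma \<partial>\<nu>)"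
    (is "_ \<le> ennreal_sqrt ?T * ennreal_sqrt ?K")
proof (cases "(LINT a|M. (cmod (f a))\<^sup>2) = 0")
  case False
  then have pos: "?T \<noteq> 0" "?K \<noteq> 0"
    using zero_moment_transform[OF f] fourier_L2_zero_second_moment[OF f] by blast+
  show ?thesis
  proof (cases "?T = \<infinity> \<or> ?K = \<infinity>")
    case True
    then have "ennreal_sqrt ?T * ennreal_sqrt ?K = \<infinity>"
      using pos by (auto simp: ennreal_sqrt_top ennreal_top_mult ennreal_mult_top ennreal_sqrt_eq_0)
    then show ?thesis by (simp only: infinity_ennreal_def top_greatest)
  next
    case False
    obtain t where t: "?T = ennreal t" "0 \<le> t" using False by (cases ?T) auto
    obtain k where k: "?K = ennreal k" "0 \<le> k" using False by (cases ?K) auto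
    note tk = t k
    have tk_pos: "0 < t" "0 < k" using pos tk by (auto simp: order_less_le)
    show ?thesis
      using uncertainty_finite[OF f tk_pos tk(1,3)] tk(2,4)
      unfolding tk(1,3) ennreal_sqrt_ennreal[OF tk(2)] ennreal_sqrt_ennreal[OF tk(4)]
      by (simp add: ennreal_mult[symmetric] ennreal_leI)
  qed
qed simp

end

theorem theorem4p4:
  fixes \<mu> :: "'l::{topological_group_add, second_countable_topology, t2_space} measure"
    and \<beta> :: "'b::{topological_group_add, second_countable_topology, t2_space} measure"
    and \<nu> :: "'l rep set measure"
    and \<tau> :: "'b \<Rightarrow> 'l \<times> real \<Rightarrow> 'l \<times> real"
    and \<Delta> :: "'b \<Rightarrow> real"
    and \<psi> f :: "'l \<times> real \<Rightarrow> complex"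
    and C :: real
  assumes "compact (UNIV :: 'l set)" and "locally compact (UNIV :: 'b set)"
    and "unimodular TYPE('l \<times> real)" and "unimodular TYPE('b)"
    and "type_I TYPE('l \<times> real)" and "type_I TYPE('b)"
    and "haar_measure \<mu>" and "haar_measure \<beta>" and "plancherel_measure \<mu> \<nu>"
    and "automorphism_action \<tau>" and "modular_hom (haar_A \<mu>) \<tau> \<Delta>"
    and "feasible_wavelet \<mu> \<beta> \<nu> \<tau> \<Delta> \<psi> C"
    and "f \<in> L2 (haar_A \<mu>)"
  shows "ennreal_sqrt (\<integral>\<^sup>+b. \<integral>\<^sup>+l. \<integral>\<^sup>+t.
             ennreal (\<bar>t\<bar>\<^sup>2 * (cmod (wavelet_transform (haar_A \<mu>) \<tau> \<Delta> \<psi> f (b, l, t)))\<^sup>2 * \<Delta> b)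
             \<partial>lborel \<partial>\<mu> \<partial>\<beta>)
       * ennreal_sqrt (\<integral>\<^sup>+\<delta>. \<integral>\<^sup>+\<gamma>.
             ennreal (\<bar>\<gamma>\<bar>\<^sup>2) * (hs_norm (fourier_L2 \<mu> \<nu> f \<delta> \<gamma>))\<^sup>2
             \<partial>dgamma \<partial>\<nu>)
       \<ge> ennreal (sqrt C / 2 * (LINT a|haar_A \<mu>. (cmod (f a))\<^sup>2))"
proof -
  interpret wavelet_group \<mu> \<nu> \<beta> \<tau> \<Delta> \<psi> C
    by unfold_locales (fact assms)+
  have eq: "\<bar>t\<bar>\<^sup>2 * (cmod (wavelet_transform (haar_A \<mu>) \<tau> \<Delta> \<psi> f (b, l, t)))\<^sup>2 * \<Delta> b
      = t\<^sup>2 * (cmod (weighted_transform f (b, l, t)))\<^sup>2" for b l t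
    using weighted_transform_eq[of f "(b, l, t)"] by (simp add: mult.assoc)
  show ?thesis
    unfolding eq unfolding power2_abs by (rule uncertainty_principle[OF \<open>f \<in> L2 (haar_A \<mu>)\<close>])
qed

end
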